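(* The composition $$HL_*(W^P_1)\xrightarrow{(\pi_1)_*}H^{\mathrm{Lie}}_*(W^P_1)\xrightarrow{\theta_*\circ\mu_2}HC_{*-1}(U(W^P_1))$$ detects the Godbillon-Vey invariant, i.e., the composite $HL_3(W^P_1)\to HC_2(U(W^P_1))$ is injective and there is a class in $HL_3(W^P_1)$ mapping to the Godbillon-Vey class under $(\pi_1)_*$.
   Context: $W^P_1=\mathbf R[x]\otimes_{\mathbf R}\langle\frac{d}{dx}\rangle$ is the real Lie algebra of polynomial vector fields in one variable, $[x^n\frac{d}{dx},x^k\frac{d}{dx}]=(k-n)x^{n+k-1}\frac{d}{dx}$; $e_i=x^{i+1}\frac{d}{dx}$ for $i\ge-1$. $U(W^P_1)$ is its universal enveloping algebra, also regarded as a Lie algebra via $[a,b]=ab-ba$; $\mu_2:H^{\mathrm{Lie}}_*(W^P_1)\to H^{\mathrm{Lie}}_*(U(W^P_1))$ is induced by the inclusion $W^P_1\hookrightarrow U(W^P_1)$. The Godbillon-Vey class in $H^{\mathrm{Lie}}_3(W^P_1)$ is the class of the cycle $e_{-1}\wedge e_0\wedge e_1$. $HL_*(\mathsf g)$ is the homology of the complex with $\mathsf g^{\otimes n}$ in degree $n$ and $d(g_1,\ldots,g_n)=\sum_{1\le i<j\le n}(-1)^j(g_1,\ldots,g_{i-1},[g_i,g_j],g_{i+1},\ldots,\hat g_j,\ldots,g_n)$; $H^{\mathrm{Lie}}_*(\mathsf g)$ is the homology of the complex with $\mathsf g^{\wedge n}$ in degree $n$ and the same differential formula on exterior powers; $(\pi_1)_*$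 is induced by the canonical projection $\pi_1:\mathsf g^{\otimes n}\to\mathsf g^{\wedge n}$. For an algebra $A$ over $\mathbf R$, $HC_*(A)$ is the homology of $C^\lambda_n(A)=A^{\otimes(n+1)}/\operatorname{Im}(1-t)$, $t(a_0,\ldots,a_n)=(-1)^n(a_n,a_0,\ldots,a_{n-1})$, with boundary induced by the Hochschild boundary $b(a_0,\ldots,a_n)=\sum_{i=0}^{n-1}(-1)^i(a_0,\ldots,a_ia_{i+1},\ldots,a_n)+(-1)^n(a_na_0,a_1,\ldots,a_{n-1})$. $\theta_*:H^{\mathrm{Lie}}_{*+1}(A)\to HC_*(A)$ is induced by the chain map $\theta(a_0\wedge\cdots\wedge a_n)=\sum_{\sigma\in S_n}(\operatorname{sgn}\sigma)(a_0,a_{\sigma^{-1}(1)},\ldots,a_{\sigma^{-1}(n)})$. *)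

theory Defs
  imports
    Complex_Main
    "HOL-Library.Poly_Mapping"
    "HOL-Computational_Algebra.Polynomial"
    "HOL-Combinatorics.Permutations"
begin

section \<open>Linear extension and quotients\<close>

text \<open>
  \<open>linear_extension e f\<close> is the linear map sending \<open>e i\<close> to \<open>f i\<close>. It is only used for
  spanning families \<open>e\<close>, where there is at most one such map; existence is proved below for every
  instance used.
\<close>

definition linear_extension :: "('i \<Rightarrow> 'v::real_vector) \<Rightarrow> ('i \<Rightarrow> 'w::real_vector) \<Rightarrow> 'v \<Rightarrow> 'w"
  where "linear_extension e f = (THE L. linear L \<and> (\<forall>i. L (e i) = f i))"

lemma linear_extension_eqI:
  assumes "span (range e) = UNIV" "linear L" "\<And>i. L (e i) = f i"
  shows "linear_extension e f = L"
  unfolding linear_extension_def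
proof (rule the_equality)
  show "linear L \<and> (\<forall>i. L (e i) = f i)" using assms by blast
  fix M assume M: "linear M \<and> (\<forall>i. M (e i) = f i)"
  show "M = L"
  proof
    fix x
    have "x \<in> span (range e)" using assms(1) by simp
    then show "M x = L x"
      by (rule linear_eq_on_span[of M L, rotated 3]) (use M assms in auto)
  qed
qed

lemma linear_extension_props:
  assumes "span (range e) = UNIV" "linear L" "\<And>i. L (e i) = f i"
  shows "linear (linear_extension e f)" "linear_extension e f (e i) = f i"
  using linear_extension_eqI[OF assms] assms by auto

lemma equivp_subspace:
  fixes S :: "'a::real_vector set"
  assumes "subspace S"
  shows "equivp (\<lambda>p q. p - q \<in> S)"
proof (rule equivpI)
  show "reflp (\<lambda>p q. p - q \<in> S)" using subspace_0[OF assms] by (simp add: reflp_def)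
  show "symp (\<lambda>p q. p - q \<in> S)" 
    unfolding symp_def using subspace_neg[OF assms] by fastforce
  show "transp (\<lambda>p q. p - q \<in> S)" 
    unfolding transp_def using subspace_add[OF assms] by fastforce
qed

lemma subspace_diff_add:
  assumes "subspace S" "p - p' \<in> S" "q - q' \<in> S"
  shows "p + q - (p' + q') \<in> S"
  using subspace_add[OF assms] by (simp add: algebra_simps)

lemma subspace_diff_diff:
  assumes "subspace S" "p - p' \<in> S" "q - q' \<in> S"
  shows "p - q - (p' - q') \<in> S"
  using subspace_diff[OF assms] by (simp add: algebra_simps)

lemma subspace_diff_minus:
  assumes "subspace S" "p - p' \<in> S"
  shows "- p - (- p') \<in> S"
  using subspace_neg[OF assms] by (simp add: algebra_simps)

lemma subspace_diff_scaleR: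
  assumes "subspace S" "p - p' \<in> S"
  shows "r *\<^sub>R p - r *\<^sub>R p' \<in> S"
  using subspace_scale[OF assms] by (simp add: algebra_simps)

lemmas subspace_diffs = subspace_diff_add subspace_diff_diff subspace_diff_minus subspace_diff_scaleR

lemma ideal_diff_mult:
  fixes S :: "'a::real_algebra set"
  assumes "subspace S" "\<And>a b. a \<in> S \<Longrightarrow> b * a \<in> S" "\<And>a b. a \<in> S \<Longrightarrow> a * b \<in> S"
    and "p - p' \<in> S" "q - q' \<in> S"
  shows "p * q - p' * q' \<in> S"
proof -
  have "p * q - p' * q' = (p - p') * q + p' * (q - q')" by (simp add: algebra_simps)
  then show ?thesis using assms by (simp add: subspace_add)
qed

text \<open>The two-sided ideal generated by \<open>G\<close>.\<close>

definition ideal_gen :: "'a::real_algebra_1 set \<Rightarrow> 'a set"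
  where "ideal_gen G = span {p * g * q | p g q. g \<in> G}"

lemma subspace_ideal_gen: "subspace (ideal_gen G)"
  by (simp add: ideal_gen_def)

lemma ideal_gen_base: "g \<in> G \<Longrightarrow> p * g * q \<in> ideal_gen G"
  unfolding ideal_gen_def by (rule span_base) blast

lemma ideal_gen_base': "g \<in> G \<Longrightarrow> g \<in> ideal_gen G"
  using ideal_gen_base[of g G 1 1] by simp

lemma ideal_gen_mult_left: "a \<in> ideal_gen G \<Longrightarrow> b * a \<in> ideal_gen G"
  unfolding ideal_gen_def
proof (induction rule: span_induct)
  case base
  show ?case
    by (rule subspaceI) (auto simp: algebra_simps span_add span_scale span_zero)
next
  case (step x)
  then obtain p g q where "x = p * g * q" "g \<in> G" by blast
  then have "b * x = (b * p) * g * q" by (simp add: mult.assoc)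
  with \<open>g \<in> G\<close> show ?case by (blast intro: span_base)
qed

lemma ideal_gen_mult_right: "a \<in> ideal_gen G \<Longrightarrow> a * b \<in> ideal_gen G"
  unfolding ideal_gen_def
proof (induction rule: span_induct)
  case base
  show ?case
    by (rule subspaceI) (auto simp: algebra_simps span_add span_scale span_zero)
next
  case (step x)
  then obtain p g q where "x = p * g * q" "g \<in> G" by blast
  then have "x * b = p * g * (q * b)" by (simp add: mult.assoc)
  with \<open>g \<in> G\<close> show ?case by (blast intro: span_base)
qed

section \<open>Real Lie algebras\<close>

class real_lie_algebra = real_vector +
  fixes lie_bracket :: "'a \<Rightarrow> 'a \<Rightarrow> 'a"
  assumes lie_bracket_add_left: "lie_bracket (x + y) z = lie_bracket x z + lie_bracket y z"
    and lie_bracket_add_right: "lie_bracket z (x + y) = lie_bracket z x + lie_bracket z y"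
    and lie_bracket_scaleR_left: "lie_bracket (r *\<^sub>R x) y = r *\<^sub>R lie_bracket x y"
    and lie_bracket_scaleR_right: "lie_bracket x (r *\<^sub>R y) = r *\<^sub>R lie_bracket x y"
    and lie_bracket_self: "lie_bracket x x = 0"
    and jacobi: "lie_bracket x (lie_bracket y z) + lie_bracket y (lie_bracket z x)
                   + lie_bracket z (lie_bracket x y) = 0"

lemmas lie_bracket_linear = lie_bracket_add_left lie_bracket_add_right
  lie_bracket_scaleR_left lie_bracket_scaleR_right

section \<open>Tensor algebra\<close>

text \<open>
  The free real vector space on words over \<^typ>\<open>'a\<close> is \<^typ>\<open>'a list \<Rightarrow>\<^sub>0 real\<close>, with
  concatenation of words as multiplication.
\<close>

instantiation list :: (type) monoid_add
begin
definition zero_list :: "'a list" where "zero_list = []"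
definition plus_list :: "'a list \<Rightarrow> 'a list \<Rightarrow> 'a list" where "plus_list = (@)"
instance by standard (simp_all add: zero_list_def plus_list_def)
end

instantiation poly_mapping :: (type, real_vector) real_vector
begin
lift_definition scaleR_poly_mapping :: "real \<Rightarrow> ('a \<Rightarrow>\<^sub>0 'b) \<Rightarrow> ('a \<Rightarrow>\<^sub>0 'b)"
  is "\<lambda>r f k. r *\<^sub>R f k"
  by (rule finite_subset[rotated]) auto
instance
  by standard (transfer; simp add: fun_eq_iff scaleR_add_left scaleR_add_right)+
end

definition word :: "'a list \<Rightarrow> ('a list \<Rightarrow>\<^sub>0 real)"
  where "word xs = Poly_Mapping.single xs 1"

lemma single_conv_word: "Poly_Mapping.single xs c = c *\<^sub>R word xs"
  by (rule poly_mapping_eqI) (simp add: scaleR_poly_mapping.rep_eq word_def lookup_single when_def)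

lemma poly_mapping_conv_words: "p = (\<Sum>xs\<in>Poly_Mapping.keys p. Poly_Mapping.lookup p xs *\<^sub>R word xs)"
  by (rule poly_mapping_eqI)
     (auto simp: lookup_sum scaleR_poly_mapping.rep_eq word_def lookup_single when_def in_keys_iff
        if_distrib cong: if_cong)

lemma span_word: "span (range word) = UNIV"
proof -
  have "p \<in> span (range word)" for p :: "'a list \<Rightarrow>\<^sub>0 real"
    by (subst poly_mapping_conv_words) (auto intro!: span_sum span_scale intro: span_base)
  then show ?thesis by blast
qed

lemma word_mult [simp]: "word xs * word ys = word (xs @ ys)"
  by (simp add: word_def mult_single plus_list_def)

lemma word_Nil: "word [] = 1"
  by (simp add: word_def flip: zero_list_def)

lemma scaleR_word_algebra:
  fixes p q :: "'a list \<Rightarrow>\<^sub>0 real"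
  shows "(r *\<^sub>R p) * q = r *\<^sub>R (p * q)" "p * (r *\<^sub>R q) = r *\<^sub>R (p * q)"
proof -
  have 1: "r *\<^sub>R p = Poly_Mapping.single 0 r * p" for p :: "'a list \<Rightarrow>\<^sub>0 real"
  proof -
    have "r *\<^sub>R p = Poly_Mapping.map ((*) r) p"
      by (rule poly_mapping_eqI)
         (simp add: scaleR_poly_mapping.rep_eq Poly_Mapping.map.rep_eq when_def)
    then show ?thesis by (simp add: mult_map_scale_conv_mult)
  qed
  have 2: "Poly_Mapping.single 0 r * p = p * Poly_Mapping.single 0 r" for p :: "'a list \<Rightarrow>\<^sub>0 real"
  proof -
    have "p \<in> span (range word)" by (simp add: span_word)
    then show ?thesis
    proof (induction rule: span_induct_alt)
      case base then show ?case by simp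
    next
      case (step c x y)
      have "Poly_Mapping.single 0 r * (c *\<^sub>R x) = (c *\<^sub>R x) * Poly_Mapping.single 0 r"
        using step(1) by (auto simp: mult_single mult.commute word_def simp flip: word_def)
          (simp add: mult_single mult.commute flip: single_conv_word)
      with step show ?case by (simp add: algebra_simps)
    qed
  qed
  show "(r *\<^sub>R p) * q = r *\<^sub>R (p * q)" by (simp add: 1 mult.assoc)
  have "p * (r *\<^sub>R q) = p * Poly_Mapping.single 0 r * q" by (simp add: 1 mult.assoc)
  also have "\<dots> = r *\<^sub>R (p * q)" by (simp add: 1 mult.assoc flip: 2)
  finally show "p * (r *\<^sub>R q) = r *\<^sub>R (p * q)" .
qed

definition word_extend :: "('a list \<Rightarrow> 'b::real_vector) \<Rightarrow> ('a list \<Rightarrow>\<^sub>0 real) \<Rightarrow> 'b"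
  where "word_extend f p = (\<Sum>xs\<in>Poly_Mapping.keys p. Poly_Mapping.lookup p xs *\<^sub>R f xs)"

lemma word_extend_superset:
  assumes "finite A" "Poly_Mapping.keys p \<subseteq> A"
  shows "word_extend f p = (\<Sum>xs\<in>A. Poly_Mapping.lookup p xs *\<^sub>R f xs)"
  unfolding word_extend_def
  by (rule sum.mono_neutral_left) (use assms in \<open>auto simp: in_keys_iff\<close>)

lemma linear_word_extend: "linear (word_extend f)"
proof (rule linearI)
  fix p q :: "'a list \<Rightarrow>\<^sub>0 real"
  let ?A = "Poly_Mapping.keys p \<union> Poly_Mapping.keys q"
  have "finite ?A" "Poly_Mapping.keys (p + q) \<subseteq> ?A" by (auto simp: Poly_Mapping.keys_add)
  then show "word_extend f (p + q) = word_extend f p + word_extend f q"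
    by (simp add: word_extend_superset[of ?A] lookup_add scaleR_add_left sum.distrib)
next
  fix r and p :: "'a list \<Rightarrow>\<^sub>0 real"
  have "Poly_Mapping.keys (r *\<^sub>R p) \<subseteq> Poly_Mapping.keys p"
    by (auto simp: in_keys_iff scaleR_poly_mapping.rep_eq)
  then show "word_extend f (r *\<^sub>R p) = r *\<^sub>R word_extend f p"
    by (simp add: word_extend_superset[of "Poly_Mapping.keys p"] scaleR_poly_mapping.rep_eq
        scaleR_sum_right)
qed

lemma word_extend_word [simp]: "word_extend f (word xs) = f xs"
  by (simp add: word_extend_def word_def)

text \<open>The tensor algebra of \<open>V\<close> is the free vector space on words modulo multilinearity.\<close>

definition tensor_relations :: "('a::real_vector list \<Rightarrow>\<^sub>0 real) set"
  where "tensor_relations = span {word (us @ (r *\<^sub>R x + s *\<^sub>R y) # vs)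
      - r *\<^sub>R word (us @ x # vs) - s *\<^sub>R word (us @ y # vs) | us vs x y r s. True}"

lemma subspace_tensor_relations: "subspace tensor_relations"
  by (simp add: tensor_relations_def)

lemma tensor_relations_base:
  "word (us @ (r *\<^sub>R x + s *\<^sub>R y) # vs)
     - r *\<^sub>R word (us @ x # vs) - s *\<^sub>R word (us @ y # vs) \<in> tensor_relations"
  unfolding tensor_relations_def by (rule span_base) blast

lemma tensor_relations_mult_left: "a \<in> tensor_relations \<Longrightarrow> b * a \<in> tensor_relations"
proof -
  assume a: "a \<in> tensor_relations"
  have w: "word ws * a \<in> tensor_relations" for ws
    using a unfolding tensor_relations_def
  proof (induction rule: span_induct)
    case base
    show ?case
      by (rule subspaceI)
         (auto simp: algebra_simps scaleR_word_algebra span_add span_scale span_zero)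
  next
    case (step x)
    then obtain us vs u v r s where
      "x = word (us @ (r *\<^sub>R u + s *\<^sub>R v) # vs) - r *\<^sub>R word (us @ u # vs) - s *\<^sub>R word (us @ v # vs)"
      by blast
    then have "word ws * x = word ((ws @ us) @ (r *\<^sub>R u + s *\<^sub>R v) # vs)
        - r *\<^sub>R word ((ws @ us) @ u # vs) - s *\<^sub>R word ((ws @ us) @ v # vs)"
      by (simp add: right_diff_distrib left_diff_distrib scaleR_word_algebra)
    then show ?case by (blast intro: span_base)
  qed
  have "b \<in> span (range word)" by (simp add: span_word)
  then show ?thesis
    by (induction rule: span_induct_alt)
       (auto simp: distrib_right scaleR_word_algebra subspace_0[OF subspace_tensor_relations] w
          intro!: subspace_add[OF subspace_tensor_relations] subspace_scale[OF subspace_tensor_relations])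
qed

lemma tensor_relations_mult_right: "a \<in> tensor_relations \<Longrightarrow> a * b \<in> tensor_relations"
proof -
  assume a: "a \<in> tensor_relations"
  have w: "a * word ws \<in> tensor_relations" for ws
    using a unfolding tensor_relations_def
  proof (induction rule: span_induct)
    case base
    show ?case
      by (rule subspaceI)
         (auto simp: algebra_simps scaleR_word_algebra span_add span_scale span_zero)
  next
    case (step x)
    then obtain us vs u v r s where
      "x = word (us @ (r *\<^sub>R u + s *\<^sub>R v) # vs) - r *\<^sub>R word (us @ u # vs) - s *\<^sub>R word (us @ v # vs)"
      by blast
    then have "x * word ws = word (us @ (r *\<^sub>R u + s *\<^sub>R v) # (vs @ ws))
        - r *\<^sub>R word (us @ u # (vs @ ws)) - s *\<^sub>R word (us @ v # (vs @ ws))"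
      by (simp add: right_diff_distrib left_diff_distrib scaleR_word_algebra)
    then show ?case by (blast intro: span_base)
  qed
  have "b \<in> span (range word)" by (simp add: span_word)
  then show ?thesis
    by (induction rule: span_induct_alt)
       (auto simp: distrib_left scaleR_word_algebra subspace_0[OF subspace_tensor_relations] w
          intro!: subspace_add[OF subspace_tensor_relations] subspace_scale[OF subspace_tensor_relations])
qed

lemma word_extend_tensor_relations:
  assumes "\<And>us vs x y r s. f (us @ (r *\<^sub>R x + s *\<^sub>R y) # vs) = r *\<^sub>R f (us @ x # vs) + s *\<^sub>R f (us @ y # vs)"
    and "p \<in> tensor_relations"
  shows "word_extend f p = 0"
  using assms(2) unfolding tensor_relations_def
  by (induction rule: span_induct)
     (auto simp: linear_subspace_kernel[OF linear_word_extend] linear_diff[OF linear_word_extend]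
        linear_scale[OF linear_word_extend] assms(1))

quotient_type (overloaded) 'a tensor = "('a::real_vector) list \<Rightarrow>\<^sub>0 real"
  / "\<lambda>p q. p - q \<in> tensor_relations"
  by (rule equivp_subspace[OF subspace_tensor_relations])

instantiation tensor :: (real_vector) real_algebra_1
begin
lift_definition zero_tensor :: "'a tensor" is 0 .
lift_definition one_tensor :: "'a tensor" is 1 .
lift_definition plus_tensor :: "'a tensor \<Rightarrow> 'a tensor \<Rightarrow> 'a tensor" is "(+)"
  by (rule subspace_diff_add[OF subspace_tensor_relations])
lift_definition minus_tensor :: "'a tensor \<Rightarrow> 'a tensor \<Rightarrow> 'a tensor" is "(-)"
  by (rule subspace_diff_diff[OF subspace_tensor_relations])
lift_definition uminus_tensor :: "'a tensor \<Rightarrow> 'a tensor" is uminus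
  by (rule subspace_diff_minus[OF subspace_tensor_relations])
lift_definition scaleR_tensor :: "real \<Rightarrow> 'a tensor \<Rightarrow> 'a tensor" is "\<lambda>r p. r *\<^sub>R p"
  by (rule subspace_diff_scaleR[OF subspace_tensor_relations])
lift_definition times_tensor :: "'a tensor \<Rightarrow> 'a tensor \<Rightarrow> 'a tensor" is "(*)"
proof -
  fix p p' q q' :: "'a list \<Rightarrow>\<^sub>0 real"
  assume "p - p' \<in> tensor_relations" "q - q' \<in> tensor_relations"
  moreover have "p * q - p' * q' = (p - p') * q + p' * (q - q')" by (simp add: algebra_simps)
  ultimately show "p * q - p' * q' \<in> tensor_relations"
    by (simp add: subspace_add[OF subspace_tensor_relations] tensor_relations_mult_left
        tensor_relations_mult_right)
qed
instance
proof
  show "(0::'a tensor) \<noteq> 1"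
  proof (transfer, rule notI)
    assume "0 - 1 \<in> (tensor_relations :: ('a list \<Rightarrow>\<^sub>0 real) set)"
    then have "word_extend (\<lambda>xs. if xs = [] then 1 else (0::real)) (0 - 1 :: 'a list \<Rightarrow>\<^sub>0 real) = 0"
      by (intro word_extend_tensor_relations) auto
    then show False
      by (simp add: linear_diff[OF linear_word_extend] linear_0[OF linear_word_extend]
          linear_neg[OF linear_word_extend] flip: word_Nil)
  qed
qed (transfer; simp add: algebra_simps scaleR_word_algebra subspace_0[OF subspace_tensor_relations])+
end

text \<open>\<open>tens [v1, \<dots>, vn]\<close> is the pure tensor \<open>v1 \<otimes> \<dots> \<otimes> vn\<close>.\<close>

lift_definition tens :: "'a::real_vector list \<Rightarrow> 'a tensor" is word .

lemma tens_mult [simp]: "tens xs * tens ys = tens (xs @ ys)"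
  by transfer (simp add: subspace_0[OF subspace_tensor_relations])

lemma tens_mult_left: "tens xs * (tens ys * p) = tens (xs @ ys) * p"
  by (simp flip: mult.assoc)

lemma tens_Nil [simp]: "tens [] = 1"
  by transfer (simp add: word_Nil subspace_0[OF subspace_tensor_relations])

lemma tens_slot: "tens (us @ (r *\<^sub>R x + s *\<^sub>R y) # vs) = r *\<^sub>R tens (us @ x # vs) + s *\<^sub>R tens (us @ y # vs)"
  by transfer (use tensor_relations_base in \<open>simp add: algebra_simps\<close>)

lemma linear_abs_tensor: "linear abs_tensor"
  by (rule linearI) (simp_all add: plus_tensor.abs_eq scaleR_tensor.abs_eq)

lemma abs_tensor_surj: "t \<in> range abs_tensor"
  by (induct t rule: tensor.abs_induct) simp

lemma span_tens: "span (range (tens :: 'a::real_vector list \<Rightarrow> _)) = UNIV"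
proof -
  have "range (tens :: 'a list \<Rightarrow> _) = abs_tensor ` range word" by (auto simp: tens.abs_eq)
  then have "span (range (tens :: 'a list \<Rightarrow> _)) = abs_tensor ` UNIV"
    by (simp only: linear_span_image[OF linear_abs_tensor] span_word)
  also have "\<dots> = UNIV" by (auto intro: abs_tensor_surj)
  finally show ?thesis .
qed

definition multilinear :: "('a::real_vector list \<Rightarrow> 'b::real_vector) \<Rightarrow> bool"
  where "multilinear f \<longleftrightarrow> (\<forall>us vs x y r s.
    f (us @ (r *\<^sub>R x + s *\<^sub>R y) # vs) = r *\<^sub>R f (us @ x # vs) + s *\<^sub>R f (us @ y # vs))"

lemma tensor_universal:
  assumes "multilinear f"
  obtains L where "linear L" "\<And>xs. L (tens xs) = f xs"
proof
  let ?E = "word_extend f"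
  define L where "L = (\<lambda>t. ?E (rep_tensor t))"
  have E0: "p \<in> tensor_relations \<Longrightarrow> ?E p = 0" for p
    using assms by (intro word_extend_tensor_relations) (auto simp: multilinear_def)
  have L: "L (abs_tensor p) = ?E p" for p
  proof -
    have "rep_tensor (abs_tensor p) - p \<in> tensor_relations"
      using Quotient3_rel[OF Quotient3_tensor, of "rep_tensor (abs_tensor p)" p]
        Quotient3_abs_rep[OF Quotient3_tensor] subspace_0[OF subspace_tensor_relations]
      by auto
    then show ?thesis
      using E0 unfolding L_def by (metis linear_diff[OF linear_word_extend] right_minus_eq)
  qed
  show "L (tens xs) = f xs" for xs by (simp add: tens.abs_eq L)
  show "linear L"
  proof (rule linearI)
    fix a b :: "'a tensor" and r
    obtain p q where "a = abs_tensor p" "b = abs_tensor q"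
      using abs_tensor_surj by blast
    then show "L (a + b) = L a + L b" "L (r *\<^sub>R a) = r *\<^sub>R L a"
      by (simp_all add: L plus_tensor.abs_eq scaleR_tensor.abs_eq
          linear_add[OF linear_word_extend] linear_scale[OF linear_word_extend])
  qed
qed

lemma linear_extension_tens:
  assumes "multilinear f"
  shows "linear (linear_extension tens f)" "linear_extension tens f (tens xs) = f xs"
proof -
  obtain L where "linear L" "\<And>xs. L (tens xs) = f xs"
    using tensor_universal[OF assms] by blast
  then show "linear (linear_extension tens f)" "linear_extension tens f (tens xs) = f xs"
    by (auto intro: linear_extension_props[OF span_tens])
qed

lemma multilinearI:
  assumes "\<And>xs k x y r s. k < length xs \<Longrightarrow>
    f (xs[k := r *\<^sub>R x + s *\<^sub>R y]) = r *\<^sub>R f (xs[k := x]) + s *\<^sub>R f (xs[k := y])"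
  shows "multilinear f"
  unfolding multilinear_def
proof (intro allI)
  fix us vs :: "'a list" and x y r s
  show "f (us @ (r *\<^sub>R x + s *\<^sub>R y) # vs) = r *\<^sub>R f (us @ x # vs) + s *\<^sub>R f (us @ y # vs)"
    using assms[of "length us" "us @ 0 # vs" r x s y] by simp
qed

lemma multilinear_update:
  assumes "multilinear f" "k < length xs"
  shows "f (xs[k := r *\<^sub>R x + s *\<^sub>R y]) = r *\<^sub>R f (xs[k := x]) + s *\<^sub>R f (xs[k := y])"
  using assms by (simp add: upd_conv_take_nth_drop multilinear_def)

lemma tens_combine:
  assumes "length A = N" "length B = N" "length C = N" "m < N" "A ! m = r *\<^sub>R B ! m + s *\<^sub>R C ! m"
    and "\<And>i. i < N \<Longrightarrow> i \<noteq> m \<Longrightarrow> A ! i = B ! i" "\<And>i. i < N \<Longrightarrow> i \<noteq> m \<Longrightarrow> A ! i = C ! i"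
  shows "tens A = r *\<^sub>R tens B + s *\<^sub>R tens C"
proof -
  have "B = A[m := B ! m]" "C = A[m := C ! m]" "A = A[m := r *\<^sub>R B ! m + s *\<^sub>R C ! m]"
    using assms by (auto intro!: nth_equalityI simp: nth_list_update)
  moreover have "tens (A[m := r *\<^sub>R x + s *\<^sub>R y]) = r *\<^sub>R tens (A[m := x]) + s *\<^sub>R tens (A[m := y])" for x y
    using assms(1,4) by (intro multilinear_update) (auto simp: multilinear_def tens_slot)
  ultimately show ?thesis by metis
qed

text \<open>The homogeneous component \<open>V\<^sup>\<otimes>\<^sup>n\<close> of the tensor algebra.\<close>

definition tensor_power :: "nat \<Rightarrow> 'a::real_vector tensor set"
  where "tensor_power n = span {tens xs | xs. length xs = n}"

section \<open>Exterior powers\<close>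

definition exterior_ideal :: "'a::real_vector tensor set"
  where "exterior_ideal = ideal_gen {tens [v] * tens [v] | v. True}"

lemma subspace_exterior_ideal: "subspace exterior_ideal"
  by (simp add: exterior_ideal_def subspace_ideal_gen)

lemmas exterior_ideal_mult_left = ideal_gen_mult_left[where G = "{tens [v] * tens [v] | v. True}",
    folded exterior_ideal_def]
lemmas exterior_ideal_mult_right = ideal_gen_mult_right[where G = "{tens [v] * tens [v] | v. True}",
    folded exterior_ideal_def]

lemma exterior_ideal_base: "tens [v, v] \<in> exterior_ideal"
proof -
  have "tens [v] * tens [v] \<in> exterior_ideal"
    unfolding exterior_ideal_def by (rule ideal_gen_base') blast
  then show ?thesis by simp
qed

quotient_type (overloaded) 'a exterior = "('a::real_vector) tensor" / "\<lambda>p q. p - q \<in> exterior_ideal"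
  by (rule equivp_subspace[OF subspace_exterior_ideal])

instantiation exterior :: (real_vector) real_vector
begin
lift_definition zero_exterior :: "'a exterior" is 0 .
lift_definition plus_exterior :: "'a exterior \<Rightarrow> 'a exterior \<Rightarrow> 'a exterior" is "(+)"
  by (rule subspace_diff_add[OF subspace_exterior_ideal])
lift_definition minus_exterior :: "'a exterior \<Rightarrow> 'a exterior \<Rightarrow> 'a exterior" is "(-)"
  by (rule subspace_diff_diff[OF subspace_exterior_ideal])
lift_definition uminus_exterior :: "'a exterior \<Rightarrow> 'a exterior" is uminus
  by (rule subspace_diff_minus[OF subspace_exterior_ideal])
lift_definition scaleR_exterior :: "real \<Rightarrow> 'a exterior \<Rightarrow> 'a exterior" is "\<lambda>r p. r *\<^sub>R p"
  by (rule subspace_diff_scaleR[OF subspace_exterior_ideal])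
instance
  by standard (transfer; simp add: algebra_simps subspace_0[OF subspace_exterior_ideal])+
end

text \<open>The canonical projection \<open>\<pi>\<^sub>1\<close> from tensors to exterior powers.\<close>

definition to_exterior :: "'a::real_vector tensor \<Rightarrow> 'a exterior"
  where "to_exterior = abs_exterior"

definition wedge :: "'a::real_vector list \<Rightarrow> 'a exterior"
  where "wedge xs = to_exterior (tens xs)"

definition exterior_power :: "nat \<Rightarrow> 'a::real_vector exterior set"
  where "exterior_power n = to_exterior ` tensor_power n"

lemma linear_to_exterior: "linear to_exterior"
  by (rule linearI) (simp_all add: to_exterior_def plus_exterior.abs_eq scaleR_exterior.abs_eq)

lemma to_exterior_eq_iff: "to_exterior p = to_exterior q \<longleftrightarrow> p - q \<in> exterior_ideal"
  by (simp add: to_exterior_def exterior.abs_eq_iff)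

lemma to_exterior_eq_0_iff: "to_exterior p = 0 \<longleftrightarrow> p \<in> exterior_ideal"
  using to_exterior_eq_iff[of p 0] by (simp add: linear_0[OF linear_to_exterior])

lemma to_exterior_surj: "t \<in> range to_exterior"
  by (induct t rule: exterior.abs_induct) (auto simp: to_exterior_def)

lemma span_wedge: "span (range (wedge :: 'a::real_vector list \<Rightarrow> _)) = UNIV"
proof -
  have "range (wedge :: 'a list \<Rightarrow> _) = to_exterior ` range tens" by (auto simp: wedge_def)
  then have "span (range (wedge :: 'a list \<Rightarrow> _)) = to_exterior ` UNIV"
    by (simp only: linear_span_image[OF linear_to_exterior] span_tens)
  also have "\<dots> = UNIV" by (auto intro: to_exterior_surj)
  finally show ?thesis .
qed

lemma multilinear_linear_comp:
  assumes "multilinear f" "linear L"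
  shows "multilinear (\<lambda>xs. L (f xs))"
  using assms by (simp add: multilinear_def linear_add linear_scale)

lemma multilinear_tens: "multilinear tens"
  by (simp add: multilinear_def tens_slot)

lemma multilinear_wedge: "multilinear wedge"
  unfolding wedge_def by (rule multilinear_linear_comp[OF multilinear_tens linear_to_exterior])

definition alternating :: "('a list \<Rightarrow> 'b::zero) \<Rightarrow> bool"
  where "alternating f \<longleftrightarrow> (\<forall>us v vs. f (us @ v # v # vs) = 0)"

lemma exterior_universal:
  assumes "multilinear f" "alternating f"
  obtains L where "linear L" "\<And>xs. L (wedge xs) = f xs"
proof -
  obtain M where M: "linear M" "\<And>xs. M (tens xs) = f xs"
    using tensor_universal[OF assms(1)] by blast
  have *: "M (p * tens [v, v] * q) = 0" for p q v
  proof -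
    have q: "linear (\<lambda>q. M (p * q))" for p
      by (rule linearI) (simp_all add: linear_add[OF M(1)] linear_scale[OF M(1)] algebra_simps)
    have p: "linear (\<lambda>p. M (p * q))" for q
      by (rule linearI) (simp_all add: linear_add[OF M(1)] linear_scale[OF M(1)] algebra_simps)
    have z: "linear (\<lambda>p. 0 :: 'b)" by (rule linearI) simp_all
    have 1: "M (tens us * tens [v, v] * q) = 0" for us
      by (rule linear_eq_on_span[OF q z, of "range tens"])
         (use assms(2) in \<open>auto simp: span_tens M(2) alternating_def\<close>)
    have "M (p * (tens [v, v] * q)) = 0"
      by (rule linear_eq_on_span[OF p z, of "range tens"])
         (use 1 in \<open>auto simp: span_tens simp flip: mult.assoc\<close>)
    then show ?thesis by (simp add: mult.assoc)
  qed
  have M0: "M p = 0" if "p \<in> exterior_ideal" for p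
    using that unfolding exterior_ideal_def ideal_gen_def
    by (induction rule: span_induct) (auto simp: linear_subspace_kernel[OF M(1)] *)
  define L where "L = (\<lambda>t. M (inv to_exterior t))"
  have L: "L (to_exterior p) = M p" for p
  proof -
    have "inv to_exterior (to_exterior p) - p \<in> exterior_ideal"
      using to_exterior_surj[of "to_exterior p"] by (simp add: f_inv_into_f flip: to_exterior_eq_iff)
    from M0[OF this] show ?thesis by (simp add: L_def linear_diff[OF M(1)])
  qed
  have "L (wedge xs) = f xs" for xs by (simp add: wedge_def L M(2))
  moreover have "linear L"
  proof (rule linearI)
    fix a b :: "'a exterior" and r
    obtain p q where "a = to_exterior p" "b = to_exterior q"
      using to_exterior_surj by blast
    then show "L (a + b) = L a + L b" "L (r *\<^sub>R a) = r *\<^sub>R L a"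
      by (simp_all add: L linear_add[OF M(1)] linear_scale[OF M(1)]
          flip: linear_add[OF linear_to_exterior] linear_scale[OF linear_to_exterior])
  qed
  ultimately show thesis using that by blast
qed

lemma linear_extension_wedge:
  assumes "multilinear f" "alternating f"
  shows "linear (linear_extension wedge f)" "linear_extension wedge f (wedge xs) = f xs"
proof -
  obtain L where "linear L" "\<And>xs. L (wedge xs) = f xs"
    using exterior_universal[OF assms] by blast
  then show "linear (linear_extension wedge f)" "linear_extension wedge f (wedge xs) = f xs"
    by (auto intro: linear_extension_props[OF span_wedge])
qed

lemma alternating_wedge: "alternating wedge"
proof -
  have "tens us * tens [v, v] * tens vs \<in> exterior_ideal" for us vs and v :: 'a
    by (intro exterior_ideal_mult_left exterior_ideal_mult_right exterior_ideal_base)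
  then show ?thesis by (simp add: alternating_def wedge_def to_exterior_eq_0_iff)
qed

text \<open>The map of exterior algebras induced by a linear map.\<close>

definition exterior_map :: "('a::real_vector \<Rightarrow> 'b::real_vector) \<Rightarrow> 'a exterior \<Rightarrow> 'b exterior"
  where "exterior_map f = linear_extension wedge (\<lambda>xs. wedge (map f xs))"

lemma exterior_map:
  assumes "linear f"
  shows "linear (exterior_map f)" "exterior_map f (wedge xs) = wedge (map f xs)"
proof -
  have 1: "multilinear (\<lambda>xs. wedge (map f xs))"
    by (simp add: multilinear_def linear_add[OF assms] linear_scale[OF assms]
        multilinear_wedge[unfolded multilinear_def])
  have 2: "alternating (\<lambda>xs. wedge (map f xs))"
    by (simp add: alternating_def alternating_wedge[unfolded alternating_def])
  show "linear (exterior_map f)" "exterior_map f (wedge xs) = wedge (map f xs)"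
    using linear_extension_wedge[OF 1 2] by (simp_all add: exterior_map_def)
qed

section \<open>Leibniz and Chevalley--Eilenberg differentials\<close>

definition omit :: "nat \<Rightarrow> 'a list \<Rightarrow> 'a list"
  where "omit j xs = take j xs @ drop (Suc j) xs"

text \<open>Positions are counted from \<open>0\<close>, so the sign \<open>(-1)\<^sup>j\<close> of the usual formula becomes
  \<open>(-1)\<^sup>j\<^sup>+\<^sup>1\<close>.\<close>

definition leibniz_boundary :: "'g::real_lie_algebra tensor \<Rightarrow> 'g tensor"
  where "leibniz_boundary = linear_extension tens (\<lambda>g. \<Sum>j<length g. \<Sum>i<j.
    (-1) ^ (j + 1) *\<^sub>R tens (omit j (g[i := lie_bracket (g ! i) (g ! j)])))"

definition lie_boundary :: "'g::real_lie_algebra exterior \<Rightarrow> 'g exterior"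
  where "lie_boundary = linear_extension wedge (\<lambda>g. \<Sum>j<length g. \<Sum>i<j.
    (-1) ^ (j + 1) *\<^sub>R wedge (omit j (g[i := lie_bracket (g ! i) (g ! j)])))"

lemma length_omit: "j < length xs \<Longrightarrow> length (omit j xs) = length xs - 1"
  by (simp add: omit_def)

lemma nth_omit: "j < length xs \<Longrightarrow> m < length xs - 1 \<Longrightarrow> omit j xs ! m = (if m < j then xs ! m else xs ! Suc m)"
  by (auto simp: omit_def nth_append min_def)

definition leibniz_sum :: "'g::real_lie_algebra list \<Rightarrow> 'g tensor"
  where "leibniz_sum g = (\<Sum>j<length g. \<Sum>i<j.
    (-1) ^ (j + 1) *\<^sub>R tens (omit j (g[i := lie_bracket (g ! i) (g ! j)])))"

lemma multilinear_leibniz_sum: "multilinear leibniz_sum"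
proof (rule multilinearI)
  fix g :: "'a list" and k x y r s
  assume k: "k < length g"
  have "tens (omit j (g[k := r *\<^sub>R x + s *\<^sub>R y, i := lie_bracket (g[k := r *\<^sub>R x + s *\<^sub>R y] ! i) (g[k := r *\<^sub>R x + s *\<^sub>R y] ! j)]))
    = r *\<^sub>R tens (omit j (g[k := x, i := lie_bracket (g[k := x] ! i) (g[k := x] ! j)]))
    + s *\<^sub>R tens (omit j (g[k := y, i := lie_bracket (g[k := y] ! i) (g[k := y] ! j)]))"
    if ij: "i < j" "j < length g" for i j
    by (rule tens_combine[where N = "length g - 1" and m = "if k = j then i else if k < j then k else k - 1"])
       (use k ij in \<open>auto simp: length_omit nth_omit nth_list_update lie_bracket_linear\<close>)
  then show "leibniz_sum (g[k := r *\<^sub>R x + s *\<^sub>R y]) = r *\<^sub>R leibniz_sum (g[k := x]) + s *\<^sub>R leibniz_sum (g[k := y])"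
    unfolding leibniz_sum_def by (simp add: scaleR_sum_right sum.distrib sum_subtractf sum_negf algebra_simps)
qed

lemma leibniz_boundary:
  "linear leibniz_boundary"
  "leibniz_boundary (tens g) = (\<Sum>j<length g. \<Sum>i<j.
    (-1) ^ (j + 1) *\<^sub>R tens (omit j (g[i := lie_bracket (g ! i) (g ! j)])))"
  using linear_extension_tens[OF multilinear_leibniz_sum]
  unfolding leibniz_boundary_def leibniz_sum_def by blast+

lemma leibniz_boundary_eq_sum: "leibniz_boundary (tens g) = leibniz_sum g"
  by (simp only: leibniz_boundary(2) leibniz_sum_def)

definition adjoint_sum :: "'g::real_lie_algebra \<Rightarrow> 'g list \<Rightarrow> 'g tensor"
  where "adjoint_sum y xs = (\<Sum>i<length xs. tens (xs[i := lie_bracket (xs ! i) y]))"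

lemma adjoint_sum_Nil [simp]: "adjoint_sum y [] = 0"
  by (simp add: adjoint_sum_def)

lemma adjoint_sum_Cons: "adjoint_sum y (x # xs) = tens (lie_bracket x y # xs) + tens [x] * adjoint_sum y xs"
  by (simp add: adjoint_sum_def sum.lessThan_Suc_shift sum_distrib_left del: sum.lessThan_Suc)

lemma adjoint_sum_append:
  "adjoint_sum y (xs @ ys) = adjoint_sum y xs * tens ys + tens xs * adjoint_sum y ys"
  by (induction xs) (simp_all add: adjoint_sum_Cons algebra_simps flip: mult.assoc)

lemma leibniz_sum_snoc:
  "leibniz_sum (xs @ [y]) = leibniz_sum xs * tens [y] + (-1) ^ (length xs + 1) *\<^sub>R adjoint_sum y xs"
proof -
  have 1: "omit j ((xs @ [y])[i := lie_bracket ((xs @ [y]) ! i) ((xs @ [y]) ! j)])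
      = omit j (xs[i := lie_bracket (xs ! i) (xs ! j)]) @ [y]" if "i < j" "j < length xs" for i j
    using that by (simp add: omit_def nth_append list_update_append)
  have 2: "omit (length xs) ((xs @ [y])[i := lie_bracket ((xs @ [y]) ! i) y])
      = xs[i := lie_bracket (xs ! i) y]" if "i < length xs" for i
    using that by (simp add: omit_def nth_append list_update_append)
  show ?thesis
    unfolding leibniz_sum_def adjoint_sum_def
    by (simp add: 1 2 scaleR_sum_right sum_distrib_right del: power_Suc cong: sum.cong_simp)
qed

lemma tens_polarize: "tens [v, a] + tens [a, v] \<in> exterior_ideal"
proof -
  have "tens [v + a, v + a] = tens [v, v] + tens [v, a] + (tens [a, v] + tens [a, a])"
    using tens_slot[of "[]" 1 v 1 a "[v + a]"] tens_slot[of "[v]" 1 v 1 a "[]"]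
      tens_slot[of "[a]" 1 v 1 a "[]"] by simp
  then have "tens [v, a] + tens [a, v] = tens [v + a, v + a] - tens [v, v] - tens [a, a]"
    by simp
  then show ?thesis
    by (simp add: subspace_diff[OF subspace_exterior_ideal] exterior_ideal_base)
qed

lemma leibniz_sum_exterior_ideal: "leibniz_sum (us @ v # v # vs) \<in> exterior_ideal"
proof (induction vs rule: rev_induct)
  case Nil
  have "tens (us @ [lie_bracket v v]) = 0"
    using tens_slot[of us 0 v 0 v "[]"] by (simp add: lie_bracket_self)
  then have a: "adjoint_sum v (us @ [v]) = adjoint_sum v us * tens [v]"
    by (simp add: adjoint_sum_append adjoint_sum_Cons)
  have "leibniz_sum (us @ [v, v]) = leibniz_sum ((us @ [v]) @ [v])" by simp
  also have "\<dots> = leibniz_sum us * (tens [v] * tens [v])"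
    by (simp only: leibniz_sum_snoc a) (simp add: algebra_simps)
  finally show ?case
    by (simp add: exterior_ideal_mult_left exterior_ideal_base)
next
  case (snoc y vs)
  let ?a = "lie_bracket v y"
  have "adjoint_sum y (us @ [v, v] @ vs) = adjoint_sum y us * tens [v, v] * tens vs
      + tens us * (tens [v, ?a] + tens [?a, v]) * tens vs + tens us * tens [v, v] * adjoint_sum y vs"
    by (simp add: adjoint_sum_append adjoint_sum_Cons algebra_simps tens_mult_left)
  also have "\<dots> \<in> exterior_ideal"
    by (intro subspace_add[OF subspace_exterior_ideal] exterior_ideal_mult_left
        exterior_ideal_mult_right exterior_ideal_base tens_polarize)
  finally have 1: "adjoint_sum y (us @ v # v # vs) \<in> exterior_ideal" by simp
  have "leibniz_sum ((us @ v # v # vs) @ [y]) \<in> exterior_ideal"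
    unfolding leibniz_sum_snoc
    by (intro subspace_add[OF subspace_exterior_ideal] subspace_scale[OF subspace_exterior_ideal]
        exterior_ideal_mult_right snoc 1)
  then show ?case by simp
qed

lemma lie_boundary:
  fixes g :: "'g::real_lie_algebra list" and p :: "'g tensor"
  shows "linear (lie_boundary :: 'g exterior \<Rightarrow> _)"
  "lie_boundary (wedge g) = (\<Sum>j<length g. \<Sum>i<j.
    (-1) ^ (j + 1) *\<^sub>R wedge (omit j (g[i := lie_bracket (g ! i) (g ! j)])))"
  "lie_boundary (to_exterior p) = to_exterior (leibniz_boundary p)"
proof -
  have e: "(\<Sum>j<length g. \<Sum>i<j. (-1) ^ (j + 1) *\<^sub>R wedge (omit j (g[i := lie_bracket (g ! i) (g ! j)])))
      = to_exterior (leibniz_sum g)" for g :: "'g list"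
    by (simp add: leibniz_sum_def wedge_def linear_sum[OF linear_to_exterior]
        linear_scale[OF linear_to_exterior] linear_neg[OF linear_to_exterior])
  have 1: "multilinear (\<lambda>g :: 'g list. to_exterior (leibniz_sum g))"
    by (rule multilinear_linear_comp[OF multilinear_leibniz_sum linear_to_exterior])
  have 2: "alternating (\<lambda>g :: 'g list. to_exterior (leibniz_sum g))"
    by (simp add: alternating_def to_exterior_eq_0_iff leibniz_sum_exterior_ideal)
  have d: "(lie_boundary :: 'g exterior \<Rightarrow> _) = linear_extension wedge (\<lambda>g. to_exterior (leibniz_sum g))"
    unfolding lie_boundary_def e ..
  note L = linear_extension_wedge[OF 1 2, folded d]
  show "linear (lie_boundary :: 'g exterior \<Rightarrow> _)" by (fact L(1))
  show "lie_boundary (wedge g) = (\<Sum>j<length g. \<Sum>i<j.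
    (-1) ^ (j + 1) *\<^sub>R wedge (omit j (g[i := lie_bracket (g ! i) (g ! j)])))"
    unfolding e by (rule L(2))
  have "linear (\<lambda>p :: 'g tensor. lie_boundary (to_exterior p))" "linear (\<lambda>p :: 'g tensor. to_exterior (leibniz_boundary p))"
    using linear_compose[OF linear_to_exterior L(1)] linear_compose[OF leibniz_boundary(1) linear_to_exterior]
    by (simp_all add: o_def)
  then show "lie_boundary (to_exterior p) = to_exterior (leibniz_boundary p)"
    by (rule linear_eq_on_span[of _ _ "range tens"])
       (use L(2) in \<open>auto simp: span_tens leibniz_boundary_eq_sum wedge_def\<close>)
qed

lemma exterior_map_lie_boundary:
  fixes f :: "'g::real_lie_algebra \<Rightarrow> 'h::real_lie_algebra"
  assumes "linear f" "\<And>x y. f (lie_bracket x y) = lie_bracket (f x) (f y)"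
  shows "exterior_map f (lie_boundary w) = lie_boundary (exterior_map f w)"
proof -
  note E = exterior_map[OF assms(1)]
  have "linear (\<lambda>w. exterior_map f (lie_boundary w))" "linear (\<lambda>w. lie_boundary (exterior_map f w))"
    using linear_compose[OF lie_boundary(1) E(1)] linear_compose[OF E(1) lie_boundary(1)]
    by (simp_all only: o_def)
  then show ?thesis
  proof (rule linear_eq_on_span[of _ _ "range wedge"])
    fix v :: "'g exterior" assume "v \<in> range wedge"
    then obtain g where v: "v = wedge g" by blast
    have "map f (omit j (g[i := lie_bracket (g ! i) (g ! j)]))
        = omit j ((map f g)[i := lie_bracket (map f g ! i) (map f g ! j)])"
      if "i < j" "j < length g" for i j
      using that by (intro nth_equalityI) (auto simp: length_omit nth_omit nth_list_update assms(2))
    then show "exterior_map f (lie_boundary v) = lie_boundary (exterior_map f v)"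
      unfolding v lie_boundary(2) E(2) linear_sum[OF E(1)] linear_scale[OF E(1)]
      by (intro sum.cong) simp_all
  qed (simp add: span_wedge)
qed

section \<open>Cyclic complex\<close>

definition rotate_right :: "'a list \<Rightarrow> 'a list"
  where "rotate_right a = rotate (length a - 1) a"

lemma rotate_right_snoc: "rotate_right (xs @ [y]) = y # xs"
  by (simp add: rotate_right_def rotate_append)

lemma length_rotate_right [simp]: "length (rotate_right a) = length a"
  by (simp add: rotate_right_def)

lemma nth_rotate_right:
  "i < length a \<Longrightarrow> rotate_right a ! i = (if i = 0 then a ! (length a - 1) else a ! (i - 1))"
  by (cases a rule: rev_cases) (auto simp: rotate_right_snoc nth_Cons nth_append split: nat.splits)

text \<open>The signed cyclic operator \<open>t(a0, \<dots>, an) = (-1)\<^sup>n (an, a0, \<dots>, a(n-1))\<close>.\<close>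

definition cyclic_operator :: "'a::real_vector tensor \<Rightarrow> 'a tensor"
  where "cyclic_operator = linear_extension tens (\<lambda>a. (-1) ^ (length a - 1) *\<^sub>R tens (rotate_right a))"

lemma cyclic_operator:
  fixes a :: "'a::real_vector list"
  shows "linear (cyclic_operator :: 'a tensor \<Rightarrow> _)"
    "cyclic_operator (tens a) = (-1) ^ (length a - 1) *\<^sub>R tens (rotate_right a)"
proof -
  have "multilinear (\<lambda>a :: 'a list. (-1) ^ (length a - 1) *\<^sub>R tens (rotate_right a))"
  proof (rule multilinearI)
    fix a :: "'a list" and k x y r s
    assume k: "k < length a"
    then have "a \<noteq> []" by auto
    have "tens (rotate_right (a[k := r *\<^sub>R x + s *\<^sub>R y]))
      = r *\<^sub>R tens (rotate_right (a[k := x])) + s *\<^sub>R tens (rotate_right (a[k := y]))"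
      by (rule tens_combine[where N = "length a" and m = "if k = length a - 1 then 0 else Suc k"])
         (use k \<open>a \<noteq> []\<close> in \<open>auto simp: nth_rotate_right nth_list_update\<close>)
    then show "(-1) ^ (length (a[k := r *\<^sub>R x + s *\<^sub>R y]) - 1) *\<^sub>R tens (rotate_right (a[k := r *\<^sub>R x + s *\<^sub>R y]))
      = r *\<^sub>R (-1) ^ (length (a[k := x]) - 1) *\<^sub>R tens (rotate_right (a[k := x]))
      + s *\<^sub>R (-1) ^ (length (a[k := y]) - 1) *\<^sub>R tens (rotate_right (a[k := y]))"
      by (simp add: algebra_simps)
  qed
  from linear_extension_tens[OF this] show "linear (cyclic_operator :: 'a tensor \<Rightarrow> _)"
    "cyclic_operator (tens a) = (-1) ^ (length a - 1) *\<^sub>R tens (rotate_right a)"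
    unfolding cyclic_operator_def by blast+
qed

definition cyclic_relations :: "'a::real_vector tensor set"
  where "cyclic_relations = range (\<lambda>p. p - cyclic_operator p)"

lemma subspace_cyclic_relations: "subspace (cyclic_relations :: 'a::real_vector tensor set)"
proof -
  have "linear (\<lambda>p :: 'a tensor. p - cyclic_operator p)"
    by (intro linear_compose_sub linear_ident cyclic_operator)
  then show ?thesis
    unfolding cyclic_relations_def by (rule linear_subspace_image) (rule subspace_UNIV)
qed

quotient_type (overloaded) 'a cyclic = "('a::real_vector) tensor" / "\<lambda>p q. p - q \<in> cyclic_relations"
  by (rule equivp_subspace[OF subspace_cyclic_relations])

instantiation cyclic :: (real_vector) real_vector
begin
lift_definition zero_cyclic :: "'a cyclic" is 0 .
lift_definition plus_cyclic :: "'a cyclic \<Rightarrow> 'a cyclic \<Rightarrow> 'a cyclic" is "(+)"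
  by (rule subspace_diff_add[OF subspace_cyclic_relations])
lift_definition minus_cyclic :: "'a cyclic \<Rightarrow> 'a cyclic \<Rightarrow> 'a cyclic" is "(-)"
  by (rule subspace_diff_diff[OF subspace_cyclic_relations])
lift_definition uminus_cyclic :: "'a cyclic \<Rightarrow> 'a cyclic" is uminus
  by (rule subspace_diff_minus[OF subspace_cyclic_relations])
lift_definition scaleR_cyclic :: "real \<Rightarrow> 'a cyclic \<Rightarrow> 'a cyclic" is "\<lambda>r p. r *\<^sub>R p"
  by (rule subspace_diff_scaleR[OF subspace_cyclic_relations])
instance
  by standard (transfer; simp add: algebra_simps subspace_0[OF subspace_cyclic_relations])+
end

definition to_cyclic :: "'a::real_vector tensor \<Rightarrow> 'a cyclic"
  where "to_cyclic = abs_cyclic"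

lemma linear_to_cyclic: "linear to_cyclic"
  by (rule linearI) (simp_all add: to_cyclic_def plus_cyclic.abs_eq scaleR_cyclic.abs_eq)

lemma to_cyclic_eq_iff: "to_cyclic p = to_cyclic q \<longleftrightarrow> p - q \<in> cyclic_relations"
  by (simp add: to_cyclic_def cyclic.abs_eq_iff)

lemma to_cyclic_surj: "t \<in> range to_cyclic"
  by (induct t rule: cyclic.abs_induct) (auto simp: to_cyclic_def)

lemma to_cyclic_rotate:
  "to_cyclic (tens a) = (-1) ^ (length a - 1) *\<^sub>R to_cyclic (tens (rotate_right a))"
proof -
  have "to_cyclic (tens a) = to_cyclic (cyclic_operator (tens a))"
    by (auto simp: to_cyclic_eq_iff cyclic_relations_def)
  then show ?thesis by (simp add: cyclic_operator linear_scale[OF linear_to_cyclic])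
qed

text \<open>\<open>C\<^sup>\<lambda>\<^sub>n(A) = A\<^sup>\<otimes>\<^sup>n\<^sup>+\<^sup>1 / Im(1 - t)\<close>.\<close>

definition cyclic_chains :: "nat \<Rightarrow> 'a::real_vector cyclic set"
  where "cyclic_chains n = to_cyclic ` tensor_power (n + 1)"

text \<open>The complex starts in degree \<open>0\<close>, that is with words of length \<open>1\<close>, where \<open>b\<close> vanishes.\<close>

definition hochschild_boundary :: "'a::real_algebra tensor \<Rightarrow> 'a tensor"
  where "hochschild_boundary = linear_extension tens (\<lambda>a. if length a \<le> 1 then 0 else
    let n = length a - 1 in
      (\<Sum>i<n. (-1) ^ i *\<^sub>R tens (take i a @ (a ! i * a ! (i + 1)) # drop (i + 2) a))
      + (-1) ^ n *\<^sub>R tens ((a ! n * a ! 0) # take (n - 1) (tl a)))"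

text \<open>The map induced by \<open>b\<close> on the quotient.\<close>

definition cyclic_boundary :: "'a::real_algebra cyclic \<Rightarrow> 'a cyclic"
  where "cyclic_boundary = linear_extension to_cyclic (\<lambda>p. to_cyclic (hochschild_boundary p))"

definition hochschild_face :: "nat \<Rightarrow> 'a::real_algebra list \<Rightarrow> 'a list"
  where "hochschild_face i a = (let n = length a - 1 in
    if i < n then take i a @ (a ! i * a ! (i + 1)) # drop (i + 2) a
    else (a ! n * a ! 0) # take (n - 1) (tl a))"

definition hochschild_sum :: "'a::real_algebra list \<Rightarrow> 'a tensor"
  where "hochschild_sum a = (if length a \<le> 1 then 0 else
    \<Sum>i\<le>length a - 1. (-1) ^ i *\<^sub>R tens (hochschild_face i a))"

lemma hochschild_sum_eq:
  "hochschild_sum a = (if length a \<le> 1 then 0 else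
    let n = length a - 1 in
      (\<Sum>i<n. (-1) ^ i *\<^sub>R tens (take i a @ (a ! i * a ! (i + 1)) # drop (i + 2) a))
      + (-1) ^ n *\<^sub>R tens ((a ! n * a ! 0) # take (n - 1) (tl a)))"
  by (simp add: hochschild_sum_def hochschild_face_def Let_def lessThan_Suc_atMost[symmetric])

lemma length_hochschild_face: "i < length a \<Longrightarrow> 1 < length a \<Longrightarrow> length (hochschild_face i a) = length a - 1"
  by (auto simp: hochschild_face_def Let_def)

lemma nth_hochschild_face:
  assumes "i < length a" "m < length a - 1"
  shows "hochschild_face i a ! m = (if i = length a - 1 then if m = 0 then a ! i * a ! 0 else a ! m
    else if m < i then a ! m else if m = i then a ! i * a ! Suc i else a ! Suc m)"
  using assms
  by (auto simp: hochschild_face_def Let_def nth_append nth_Cons nth_tl split: nat.splits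
      intro!: arg_cong[where f = "\<lambda>i. a ! i"])

lemma multilinear_hochschild_sum: "multilinear hochschild_sum"
proof (rule multilinearI)
  fix a :: "'a list" and k x y r s
  assume k: "k < length a"
  have "tens (hochschild_face i (a[k := r *\<^sub>R x + s *\<^sub>R y]))
    = r *\<^sub>R tens (hochschild_face i (a[k := x])) + s *\<^sub>R tens (hochschild_face i (a[k := y]))"
    if i: "i < length a" "1 < length a" for i
  proof -
    have "a \<noteq> []" using i by auto
    consider "i = length a - 1" "k = i" | "i = length a - 1" "k < i"
      | "i < length a - 1" "k \<le> i" | "i < length a - 1" "i < k"
      using i k by linarith
    then show ?thesis
    proof cases
      case 1
      then show ?thesis
        by (intro tens_combine[where N = "length a - 1" and m = 0])
           (use k i \<open>a \<noteq> []\<close> in \<open>auto simp: length_hochschild_face nth_hochschild_face nth_list_update algebra_simps\<close>)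
    next
      case 2
      then show ?thesis
        by (intro tens_combine[where N = "length a - 1" and m = k])
           (use k i \<open>a \<noteq> []\<close> in \<open>auto simp: length_hochschild_face nth_hochschild_face nth_list_update algebra_simps\<close>)
    next
      case 3
      then show ?thesis
        by (intro tens_combine[where N = "length a - 1" and m = k])
           (use k i \<open>a \<noteq> []\<close> in \<open>auto simp: length_hochschild_face nth_hochschild_face nth_list_update algebra_simps\<close>)
    next
      case 4
      then show ?thesis
        by (intro tens_combine[where N = "length a - 1" and m = "k - 1"])
           (use k i in \<open>auto simp: length_hochschild_face nth_hochschild_face nth_list_update algebra_simps\<close>)
    qed
  qed
  then have 1: "tens (hochschild_face i (a[k := r *\<^sub>R x + s *\<^sub>R y]))
    = r *\<^sub>R tens (hochschild_face i (a[k := x])) + s *\<^sub>R tens (hochschild_face i (a[k := y]))"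
    if "i \<le> length a - Suc 0" "\<not> length a \<le> Suc 0" for i
    using that by simp
  show "hochschild_sum (a[k := r *\<^sub>R x + s *\<^sub>R y]) = r *\<^sub>R hochschild_sum (a[k := x]) + s *\<^sub>R hochschild_sum (a[k := y])"
    unfolding hochschild_sum_def by (simp add: 1 scaleR_sum_right sum.distrib algebra_simps)
qed

lemma hochschild_boundary:
  fixes a :: "'a::real_algebra list"
  shows "linear (hochschild_boundary :: 'a tensor \<Rightarrow> _)"
    "hochschild_boundary (tens a) = (if length a \<le> 1 then 0 else
    let n = length a - 1 in
      (\<Sum>i<n. (-1) ^ i *\<^sub>R tens (take i a @ (a ! i * a ! (i + 1)) # drop (i + 2) a))
      + (-1) ^ n *\<^sub>R tens ((a ! n * a ! 0) # take (n - 1) (tl a)))"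
  using linear_extension_tens[OF multilinear_hochschild_sum]
  unfolding hochschild_boundary_def hochschild_sum_eq by blast+

lemma hochschild_boundary_eq_sum: "hochschild_boundary (tens a) = hochschild_sum a"
  by (simp only: hochschild_boundary(2) hochschild_sum_eq)

lemma hochschild_face_rotate:
  assumes "Suc i < length a"
  shows "hochschild_face (Suc i) (rotate_right a) = rotate_right (hochschild_face i a)"
proof (rule nth_equalityI)
  obtain n where n: "length a = Suc (Suc n)"
    using assms by (intro that[of "length a - 2"]) simp
  have "a \<noteq> []" using n by auto
  fix m assume "m < length (hochschild_face (Suc i) (rotate_right a))"
  then have m: "m < Suc n" using assms n by (simp add: length_hochschild_face)
  have l: "length (hochschild_face i a) = Suc n" using assms n by (simp add: length_hochschild_face)
  have i: "i \<le> n" using assms n by simp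
  have R: "rotate_right (hochschild_face i a) ! m = hochschild_face i a ! (if m = 0 then n else m - 1)"
    using nth_rotate_right[of m "hochschild_face i a"] m by (simp add: l)
  show "hochschild_face (Suc i) (rotate_right a) ! m = rotate_right (hochschild_face i a) ! m"
  proof (cases m)
    case 0
    then show ?thesis
      unfolding R using i n m \<open>a \<noteq> []\<close>
      by (cases "i = n") (simp_all add: nth_hochschild_face nth_rotate_right)
  next
    case (Suc m')
    then consider "i = n" | "i < n" "m' < i" | "i < n" "m' = i" | "i < n" "m' > i" using i by linarith
    then show ?thesis
      unfolding R using Suc n m \<open>a \<noteq> []\<close>
      by cases (simp_all add: nth_hochschild_face nth_rotate_right)
  qed
qed (use assms in \<open>simp add: length_hochschild_face\<close>)

lemma hochschild_face_rotate_0: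
  assumes "1 < length a"
  shows "hochschild_face 0 (rotate_right a) = hochschild_face (length a - 1) a"
proof -
  have "a \<noteq> []" using assms by auto
  show ?thesis
  by (rule nth_equalityI)
     (use assms \<open>a \<noteq> []\<close> in \<open>auto simp: length_hochschild_face[OF less_trans[OF zero_less_one]]
        length_hochschild_face nth_hochschild_face[OF less_trans[OF zero_less_one]]
        nth_hochschild_face nth_rotate_right\<close>)
qed

lemma to_cyclic_hochschild_rotate:
  "to_cyclic (hochschild_sum a)
    = (-1) ^ (length a - 1) *\<^sub>R to_cyclic (hochschild_sum (rotate_right a))"
proof (cases "length a \<le> 1")
  case True
  then show ?thesis by (simp add: hochschild_sum_def linear_0[OF linear_to_cyclic])
next
  case False
  then obtain n where n: "length a = Suc (Suc n)" 
    by (intro that[of "length a - 2"]) simp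
  let ?c = "\<lambda>xs. to_cyclic (tens xs)"
  have 1: "?c (hochschild_face i a) = (-1) ^ n *\<^sub>R ?c (hochschild_face (Suc i) (rotate_right a))"
    if "i \<le> n" for i
    using that to_cyclic_rotate[of "hochschild_face i a"] n
    by (simp add: hochschild_face_rotate length_hochschild_face)
  have 2: "to_cyclic (hochschild_sum c) = (\<Sum>i\<le>Suc n. (-1) ^ i *\<^sub>R ?c (hochschild_face i c))"
    if "length c = Suc (Suc n)" for c :: "'a list"
  proof -
    have "hochschild_sum c = (\<Sum>i\<le>Suc n. (-1) ^ i *\<^sub>R tens (hochschild_face i c))"
      using that by (simp add: hochschild_sum_def)
    then show ?thesis
      by (simp only: linear_sum[OF linear_to_cyclic] linear_scale[OF linear_to_cyclic])
  qed
  define G where "G i = ?c (hochschild_face i (rotate_right a))" for i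
  have 3: "(-1) ^ i *\<^sub>R ?c (hochschild_face i a) = (-1) ^ Suc n *\<^sub>R (-1) ^ Suc i *\<^sub>R G (Suc i)"
    if "i \<le> n" for i
    using that by (simp add: 1 G_def mult.commute)
  have 4: "?c (hochschild_face (Suc n) a) = G 0"
    using hochschild_face_rotate_0[of a] n by (simp add: G_def)
  have "to_cyclic (hochschild_sum a)
      = (\<Sum>i\<le>n. (-1) ^ i *\<^sub>R ?c (hochschild_face i a)) + (-1) ^ Suc n *\<^sub>R G 0"
    unfolding 2[OF n] sum.atMost_Suc 4 ..
  also have "(\<Sum>i\<le>n. (-1) ^ i *\<^sub>R ?c (hochschild_face i a))
      = (-1) ^ Suc n *\<^sub>R (\<Sum>i\<le>n. (-1) ^ Suc i *\<^sub>R G (Suc i))"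
    unfolding scaleR_sum_right by (intro sum.cong refl 3) simp
  finally have "to_cyclic (hochschild_sum a) = (-1) ^ Suc n *\<^sub>R (\<Sum>i\<le>Suc n. (-1) ^ i *\<^sub>R G i)"
    unfolding sum.atMost_Suc_shift by (simp only: scaleR_add_right power_0 scaleR_one add.commute)
  also have "(\<Sum>i\<le>Suc n. (-1) ^ i *\<^sub>R G i) = to_cyclic (hochschild_sum (rotate_right a))"
    unfolding G_def using 2[of "rotate_right a"] n by simp
  finally show ?thesis by (simp only: n diff_Suc_1)
qed

lemma cyclic_boundary:
  fixes p :: "'a::real_algebra tensor"
  shows "linear (cyclic_boundary :: 'a cyclic \<Rightarrow> _)"
    "cyclic_boundary (to_cyclic p) = to_cyclic (hochschild_boundary p)"
proof -
  have lin: "linear (\<lambda>p :: 'a tensor. to_cyclic (hochschild_boundary p))"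
    using linear_compose[OF hochschild_boundary(1) linear_to_cyclic] by (simp add: o_def)
  have "to_cyclic (hochschild_boundary p) = to_cyclic (hochschild_boundary (cyclic_operator p))"
    for p :: "'a tensor"
  proof (rule linear_eq_on_span[OF lin, of "\<lambda>p. to_cyclic (hochschild_boundary (cyclic_operator p))" "range tens"])
    show "linear (\<lambda>p :: 'a tensor. to_cyclic (hochschild_boundary (cyclic_operator p)))"
      using linear_compose[OF cyclic_operator(1) lin] by (simp add: o_def)
  next
    show "to_cyclic (hochschild_boundary p) = to_cyclic (hochschild_boundary (cyclic_operator p))"
      if "p \<in> range tens" for p :: "'a tensor"
      using that to_cyclic_hochschild_rotate
      by (auto simp: cyclic_operator hochschild_boundary_eq_sum linear_scale[OF lin] simp del: One_nat_def)
  qed (simp add: span_tens)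
  then have 0: "to_cyclic (hochschild_boundary p) = 0" if "p \<in> cyclic_relations" for p :: "'a tensor"
    using that by (auto simp: cyclic_relations_def linear_diff[OF lin])
  define L where "L t = to_cyclic (hochschild_boundary (inv to_cyclic t))" for t :: "'a cyclic"
  have L: "L (to_cyclic p) = to_cyclic (hochschild_boundary p)" for p
  proof -
    have "inv to_cyclic (to_cyclic p) - p \<in> cyclic_relations"
      using to_cyclic_surj[of "to_cyclic p"] by (simp add: f_inv_into_f flip: to_cyclic_eq_iff)
    from 0[OF this] show ?thesis by (simp add: L_def linear_diff[OF lin])
  qed
  have linL: "linear L"
  proof (rule linearI)
    fix a b :: "'a cyclic" and r
    obtain p q where "a = to_cyclic p" "b = to_cyclic q"
      using to_cyclic_surj by blast
    then show "L (a + b) = L a + L b" "L (r *\<^sub>R a) = r *\<^sub>R L a"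
      by (simp_all add: L linear_add[OF lin] linear_scale[OF lin]
          flip: linear_add[OF linear_to_cyclic] linear_scale[OF linear_to_cyclic])
  qed
  have sp: "span (range (to_cyclic :: 'a tensor \<Rightarrow> _)) = UNIV"
  proof -
    have "range (to_cyclic :: 'a tensor \<Rightarrow> _) = UNIV" using to_cyclic_surj by blast
    then show ?thesis by simp
  qed
  show "linear (cyclic_boundary :: 'a cyclic \<Rightarrow> _)"
    "cyclic_boundary (to_cyclic p) = to_cyclic (hochschild_boundary p)"
    using linear_extension_props[OF sp linL L] by (simp_all add: cyclic_boundary_def)
qed

section \<open>The map from the exterior powers to the cyclic complex\<close>

text \<open>
  \<open>permute_list (inv \<sigma>) [a0, \<dots>, an]\<close> is \<open>[a(\<sigma>\<inverse> 0), \<dots>, a(\<sigma>\<inverse> n)]\<close>, and \<open>\<sigma>\<close> runs through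
  the permutations fixing \<open>0\<close>.
\<close>

definition theta :: "'a::real_vector exterior \<Rightarrow> 'a cyclic"
  where "theta = linear_extension wedge (\<lambda>a. \<Sum>\<sigma> | \<sigma> permutes {1..<length a}.
    of_int (sign \<sigma>) *\<^sub>R to_cyclic (tens (permute_list (inv \<sigma>) a)))"

definition theta_sum :: "'a::real_vector list \<Rightarrow> 'a cyclic"
  where "theta_sum a = (\<Sum>\<sigma> | \<sigma> permutes {1..<length a}.
    of_int (sign \<sigma>) *\<^sub>R to_cyclic (tens (permute_list \<sigma> a)))"

lemma theta_sum_inv:
  "(\<Sum>\<sigma> | \<sigma> permutes {1..<length a}. of_int (sign \<sigma>) *\<^sub>R to_cyclic (tens (permute_list (inv \<sigma>) a)))
    = theta_sum a"
  unfolding theta_sum_def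
proof (rule sum.reindex_bij_witness[of _ inv inv])
  fix \<sigma> assume "\<sigma> \<in> {\<sigma>. \<sigma> permutes {1..<length a}}"
  then have p: "\<sigma> permutes {1..<length a}" by simp
  then have "sign (inv \<sigma>) = sign \<sigma>"
    by (intro sign_inverse) (auto simp: permutation_permutes)
  then show "of_int (sign (inv \<sigma>)) *\<^sub>R to_cyclic (tens (permute_list (inv \<sigma>) a)) =
    of_int (sign \<sigma>) *\<^sub>R to_cyclic (tens (permute_list (inv \<sigma>) a))" by (simp only:)
qed (auto simp: permutes_inv permutes_inv_inv)

lemma permutes_extend: "\<sigma> permutes {1..<n::nat} \<Longrightarrow> \<sigma> permutes {..<n}"
  by (erule permutes_subset) auto

lemma multilinear_theta_sum: "multilinear theta_sum"
proof (rule multilinearI)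
  fix a :: "'a list" and k x y r s
  assume k: "k < length a"
  have "tens (permute_list q (a[k := r *\<^sub>R x + s *\<^sub>R y]))
    = r *\<^sub>R tens (permute_list q (a[k := x])) + s *\<^sub>R tens (permute_list q (a[k := y]))"
    if "q permutes {1..<length a}" for q
  proof (rule tens_combine[where N = "length a" and m = "inv q k"])
    have q: "q permutes {..<length a}" using that by (rule permutes_extend)
    show "inv q k < length a"
      using permutes_in_image[OF permutes_inv[OF q], of k] k by simp
    show "permute_list q (a[k := r *\<^sub>R x + s *\<^sub>R y]) ! inv q k
        = r *\<^sub>R permute_list q (a[k := x]) ! inv q k + s *\<^sub>R permute_list q (a[k := y]) ! inv q k"
      using k q \<open>inv q k < length a\<close> by (simp add: permute_list_nth permutes_inverses)
    fix i assume i: "i < length a" "i \<noteq> inv q k"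
    then have "q i \<noteq> k" using q by (metis permutes_inverses(2))
    then show "permute_list q (a[k := r *\<^sub>R x + s *\<^sub>R y]) ! i = permute_list q (a[k := x]) ! i"
      "permute_list q (a[k := r *\<^sub>R x + s *\<^sub>R y]) ! i = permute_list q (a[k := y]) ! i"
      using i q by (simp_all add: permute_list_nth)
  qed simp_all
  then show "theta_sum (a[k := r *\<^sub>R x + s *\<^sub>R y]) = r *\<^sub>R theta_sum (a[k := x]) + s *\<^sub>R theta_sum (a[k := y])"
    by (simp add: theta_sum_def linear_add[OF linear_to_cyclic] linear_scale[OF linear_to_cyclic]
        scaleR_sum_right sum.distrib[symmetric] scaleR_add_right mult.commute)
qed

definition rot_perm :: "nat \<Rightarrow> nat \<Rightarrow> nat"
  where "rot_perm N i = (if Suc i < N then Suc i else if Suc i = N then 0 else i)"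

lemma rot_perm_Suc: "0 < N \<Longrightarrow> rot_perm (Suc N) = rot_perm N \<circ> Transposition.transpose (N - 1) N"
  by (auto simp: rot_perm_def fun_eq_iff Transposition.transpose_def)

lemma rot_perm_permutes_sign:
  "rot_perm (Suc n) permutes {..<Suc n} \<and> sign (rot_perm (Suc n)) = (-1) ^ n"
proof (induction n)
  case 0
  have "rot_perm (Suc 0) = id" by (auto simp: rot_perm_def fun_eq_iff)
  then show ?case using permutes_id by (simp del: id_apply)
next
  case (Suc n)
  have t: "Transposition.transpose n (Suc n) permutes {..<Suc (Suc n)}" by (rule permutes_swap_id) auto
  have r: "rot_perm (Suc n) permutes {..<Suc (Suc n)}"
    using Suc by (auto elim: permutes_subset)
  have e: "rot_perm (Suc (Suc n)) = rot_perm (Suc n) \<circ> Transposition.transpose n (Suc n)"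
    using rot_perm_Suc[of "Suc n"] by simp
  have "permutation (rot_perm (Suc n))" "permutation (Transposition.transpose n (Suc n))"
    using r t by (auto simp: permutation_permutes)
  then show ?case
    unfolding e using Suc permutes_compose[OF t r] by (simp only: sign_compose sign_swap_id) simp
qed

lemma rotate_right_rot_perm: "rotate_right (permute_list (rot_perm (length a)) a) = a"
proof (cases a)
  case (Cons x xs)
  then have p: "rot_perm (length a) permutes {..<length a}"
    using rot_perm_permutes_sign[of "length xs"] by simp
  show ?thesis
  proof (rule nth_equalityI)
    fix i assume "i < length (rotate_right (permute_list (rot_perm (length a)) a))"
    then have i: "i < length a" by simp
    have "a \<noteq> []" using Cons by simp
    then show "rotate_right (permute_list (rot_perm (length a)) a) ! i = a ! i"
      using i by (auto simp: nth_rotate_right permute_list_nth[OF p] rot_perm_def)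
  qed simp
qed (simp add: rotate_right_def)

lemma to_cyclic_rot_perm:
  "to_cyclic (tens (permute_list (rot_perm (length a)) a)) = (-1) ^ (length a - 1) *\<^sub>R to_cyclic (tens a)"
  by (subst to_cyclic_rotate) (simp add: rotate_right_rot_perm)

lemma to_cyclic_rot_perm_pow:
  assumes "length a = Suc n" "q permutes {..<Suc n}"
  shows "to_cyclic (tens (permute_list (q \<circ> rot_perm (Suc n) ^^ k) a))
    = ((-1) ^ n) ^ k *\<^sub>R to_cyclic (tens (permute_list q a))"
proof (induction k)
  case (Suc k)
  let ?b = "permute_list (q \<circ> rot_perm (Suc n) ^^ k) a"
  have "permute_list (q \<circ> rot_perm (Suc n) ^^ Suc k) a = permute_list (rot_perm (length ?b)) ?b"
    using permute_list_compose[of "rot_perm (Suc n)" a "q \<circ> rot_perm (Suc n) ^^ k"]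
      assms(1) rot_perm_permutes_sign[of n]
    by (simp add: comp_assoc funpow_Suc_right del: funpow.simps)
  then show ?case
    by (simp only: to_cyclic_rot_perm Suc) (simp add: assms mult.commute)
qed simp

lemma rot_perm_pow_0: "k \<le> n \<Longrightarrow> (rot_perm (Suc n) ^^ k) 0 = k"
  by (induction k) (auto simp: rot_perm_def)

lemma funpow_0_id: "f ^^ 0 = id"
  by (simp add: fun_eq_iff)

lemma rot_perm_pow_permutes: "rot_perm (Suc n) ^^ k permutes {..<Suc n}"
proof (induction k)
  case 0
  show ?case unfolding funpow_0_id by (rule permutes_id)
next
  case (Suc k)
  then show ?case
    unfolding funpow.simps using rot_perm_permutes_sign[of n] by (blast intro: permutes_compose)
qed

lemma bij_betw_rot_perm:
  "bij_betw (\<lambda>(k, q). q \<circ> rot_perm (Suc n) ^^ k) ({..n} \<times> {q. q permutes {1..<Suc n}})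
     {q. q permutes {..<Suc n}}"
proof -
  let ?g = "\<lambda>(k, q). q \<circ> rot_perm (Suc n) ^^ k"
  let ?A = "{..n} \<times> {q. q permutes {1..<Suc n}}"
  let ?B = "{q. q permutes {..<Suc n}}"
  let ?c = "rot_perm (Suc n)"
  have key: "k = k' \<and> q = q'"
    if "k \<le> k'" "k' \<le> n" "q permutes {1..<Suc n}" "q' permutes {1..<Suc n}"
      "q \<circ> ?c ^^ k = q' \<circ> ?c ^^ k'" for k k' q q'
  proof -
    have "?c ^^ k' = ?c ^^ (k' - k) \<circ> ?c ^^ k"
      using that(1) by (simp flip: funpow_add)
    then have e: "q \<circ> ?c ^^ k = (q' \<circ> ?c ^^ (k' - k)) \<circ> ?c ^^ k"
      using that(5) by (simp add: comp_assoc)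
    have "surj (?c ^^ k)" using rot_perm_pow_permutes permutes_surj by blast
    then have q: "q = q' \<circ> ?c ^^ (k' - k)"
    proof (intro ext)
      fix x
      obtain y where "x = (?c ^^ k) y" using \<open>surj (?c ^^ k)\<close> by (rule surjE)
      then show "q x = (q' \<circ> ?c ^^ (k' - k)) x" using fun_cong[OF e, of y] by (simp only: o_apply)
    qed
    have "q 0 = 0" "q' 0 = 0" using permutes_not_in[OF that(3), of 0] permutes_not_in[OF that(4), of 0] by simp_all
    then have "q' (k' - k) = q' 0"
      using fun_cong[OF q, of 0] that(2) rot_perm_pow_0[of "k' - k" n] by simp
    then have "k' - k = 0" using permutes_inj[OF that(4)] by (simp only: inj_eq)
    with that(1) have "k = k'" by simp
    with q show ?thesis by simp
  qed
  have inj: "inj_on ?g ?A"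
  proof (rule inj_onI)
    fix z w assume zw: "z \<in> ?A" "w \<in> ?A" "?g z = ?g w"
    obtain k q k' q' where e: "z = (k, q)" "w = (k', q')" by (metis surj_pair)
    have "k = k' \<and> q = q'"
    proof (cases "k \<le> k'")
      case True
      show ?thesis by (rule key) (use True zw in \<open>simp_all only: e mem_Times_iff fst_conv snd_conv atMost_iff mem_Collect_eq case_prod_conv\<close>)
    next
      case False
      then have "k' \<le> k" by simp
      have "k' = k \<and> q' = q" by (rule key) (use \<open>k' \<le> k\<close> zw in \<open>simp_all only: e mem_Times_iff fst_conv snd_conv atMost_iff mem_Collect_eq case_prod_conv\<close>)
      then show ?thesis by blast
    qed
    then show "z = w" using e by simp
  qed
  have sub: "?g ` ?A \<subseteq> ?B"
  proof (rule image_subsetI)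
    fix z assume z: "z \<in> ?A"
    obtain k q where e: "z = (k, q)" by (metis surj_pair)
    have "q permutes {1..<Suc n}" using z by (simp add: e)
    from permutes_compose[OF rot_perm_pow_permutes permutes_extend[OF this], of k]
    show "?g z \<in> ?B" by (simp only: e case_prod_conv mem_Collect_eq)
  qed
  have fin: "finite ?B" by (rule finite_permutations) simp
  have "card (?g ` ?A) = card ?A" using inj by (rule card_image)
  also have "\<dots> = card ?B"
    by (simp add: card_cartesian_product card_permutations[OF refl])
  finally have "?g ` ?A = ?B" using sub fin by (simp add: card_subset_eq)
  with inj show ?thesis by (simp add: bij_betw_def)
qed

definition full_sum :: "'a::real_vector list \<Rightarrow> 'a cyclic"
  where "full_sum a = (\<Sum>\<tau> | \<tau> permutes {..<length a}.
    of_int (sign \<tau>) *\<^sub>R to_cyclic (tens (permute_list \<tau> a)))"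

lemma full_sum_theta_sum:
  assumes "length a = Suc n"
  shows "full_sum a = real (Suc n) *\<^sub>R theta_sum a"
proof -
  let ?c = "rot_perm (Suc n)"
  have perm: "permutation q" if "q permutes {..<Suc n}" for q
    using that by (auto simp: permutation_permutes)
  have sgn_pow: "sign (?c ^^ k) = ((-1) ^ n) ^ k" for k
  proof (induction k)
    case (Suc k)
    have "sign (?c ^^ Suc k) = sign ?c * sign (?c ^^ k)"
      unfolding funpow.simps
      using perm[OF rot_perm_pow_permutes, of k] perm[of ?c] rot_perm_permutes_sign[of n]
      by (intro sign_compose) blast+
    then show ?case
      using rot_perm_permutes_sign[of n] Suc by (simp only: power_Suc)
  qed (simp add: sign_id[unfolded id_def])
  have "full_sum a = (\<Sum>(k, q)\<in>{..n} \<times> {q. q permutes {1..<Suc n}}.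
     of_int (sign (q \<circ> ?c ^^ k)) *\<^sub>R to_cyclic (tens (permute_list (q \<circ> ?c ^^ k) a)))"
    unfolding full_sum_def assms
    by (subst sum.reindex_bij_betw[OF bij_betw_rot_perm, symmetric]) (simp add: case_prod_beta)
  also have "\<dots> = (\<Sum>(k, q)\<in>{..n} \<times> {q. q permutes {1..<Suc n}}.
     of_int (sign q) *\<^sub>R to_cyclic (tens (permute_list q a)))"
  proof (rule sum.cong[OF refl], clarify)
    fix k q assume "q permutes {1..<Suc n}"
    then have q: "q permutes {..<Suc n}" by (rule permutes_extend)
    have "sign (q \<circ> ?c ^^ k) = sign q * ((-1) ^ n) ^ k"
      using perm[OF q] perm[OF rot_perm_pow_permutes] by (simp add: sign_compose sgn_pow)
    moreover have "((-1 :: real) ^ n) ^ k * ((-1) ^ n) ^ k = 1"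
      by (simp flip: power_mult_distrib)
    ultimately show "of_int (sign (q \<circ> ?c ^^ k)) *\<^sub>R to_cyclic (tens (permute_list (q \<circ> ?c ^^ k) a))
      = of_int (sign q) *\<^sub>R to_cyclic (tens (permute_list q a))"
      by (simp add: to_cyclic_rot_perm_pow[OF assms q] mult.assoc)
  qed
  also have "\<dots> = (\<Sum>k\<le>n. theta_sum a)"
    by (simp add: theta_sum_def assms flip: sum.cartesian_product)
  also have "\<dots> = real (Suc n) *\<^sub>R theta_sum a"
    by (simp add: sum_constant_scaleR)
  finally show ?thesis .
qed

lemma full_sum_repeat:
  assumes "Suc p < length a" "a ! p = a ! Suc p"
  shows "full_sum a = 0"
proof -
  let ?t = "Transposition.transpose p (Suc p)"
  let ?G = "\<lambda>\<tau>. of_int (sign \<tau>) *\<^sub>R to_cyclic (tens (permute_list \<tau> a))"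
  have t: "?t permutes {..<length a}" using assms by (intro permutes_swap_id) auto
  have G: "?G (?t \<circ> \<tau>) = - ?G \<tau>" if \<tau>: "\<tau> permutes {..<length a}" for \<tau>
  proof -
    have "permute_list (?t \<circ> \<tau>) a = permute_list \<tau> a"
      by (rule nth_equalityI) (use assms in \<open>auto simp: permute_list_def Transposition.transpose_def\<close>)
    moreover have "permutation \<tau>" "permutation ?t"
      using \<tau> t by (auto simp: permutation_permutes)
    ultimately show ?thesis by (simp add: sign_compose sign_swap_id)
  qed
  have "full_sum a = (\<Sum>\<tau> | \<tau> permutes {..<length a}. ?G (?t \<circ> \<tau>))"
    unfolding full_sum_def
    by (rule sum.reindex_bij_witness[of _ "\<lambda>\<tau>. ?t \<circ> \<tau>" "\<lambda>\<tau>. ?t \<circ> \<tau>"])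
       (auto intro: permutes_compose[OF _ t] simp flip: comp_assoc)
  also have "\<dots> = - full_sum a"
    unfolding full_sum_def sum_negf[symmetric] by (rule sum.cong) (simp_all add: G)
  finally have "full_sum a + full_sum a = 0" by (simp add: eq_neg_iff_add_eq_0)
  then have "2 *\<^sub>R full_sum a = 0" by (simp only: scaleR_2)
  then show ?thesis by simp
qed

lemma alternating_theta_sum: "alternating theta_sum"
  unfolding alternating_def
proof (intro allI)
  fix us vs and v :: 'a
  let ?a = "us @ v # v # vs"
  have "full_sum ?a = 0"
    by (rule full_sum_repeat[of "length us"]) (simp_all add: nth_append)
  moreover have "full_sum ?a = real (Suc (length us + Suc (length vs))) *\<^sub>R theta_sum ?a"
    by (rule full_sum_theta_sum) simp
  ultimately show "theta_sum ?a = 0" by auto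
qed

lemma theta:
  fixes a :: "'a::real_vector list"
  shows "linear (theta :: 'a exterior \<Rightarrow> _)"
    "theta (wedge a) = (\<Sum>\<sigma> | \<sigma> permutes {1..<length a}.
      of_int (sign \<sigma>) *\<^sub>R to_cyclic (tens (permute_list (inv \<sigma>) a)))"
  using linear_extension_wedge[OF multilinear_theta_sum alternating_theta_sum]
  unfolding theta_def theta_sum_inv by blast+

section \<open>Universal enveloping algebra\<close>

definition uea_ideal :: "'g::real_lie_algebra tensor set"
  where "uea_ideal = ideal_gen {tens [x] * tens [y] - tens [y] * tens [x] - tens [lie_bracket x y] | x y. True}"

lemma subspace_uea_ideal: "subspace uea_ideal"
  by (simp add: uea_ideal_def subspace_ideal_gen)

lemma uea_ideal_mult: 
  assumes "p - p' \<in> uea_ideal" "q - q' \<in> uea_ideal"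
  shows "p * q - p' * q' \<in> uea_ideal"
  using assms unfolding uea_ideal_def
  by (intro ideal_diff_mult subspace_ideal_gen ideal_gen_mult_left ideal_gen_mult_right)

lemma one_notin_uea_ideal: "(1 :: 'g::real_lie_algebra tensor) \<notin> uea_ideal"
proof
  let ?E = "linear_extension tens (\<lambda>xs :: 'g list. if xs = [] then 1 else (0::real))"
  have "multilinear (\<lambda>xs :: 'g list. if xs = [] then 1 else (0::real))"
    by (simp add: multilinear_def)
  note E = linear_extension_tens[OF this]
  have z: "linear (\<lambda>p :: 'g tensor. 0 :: real)" by (rule linearI) simp_all
  have q: "linear (\<lambda>q. ?E (p * q))" and p: "linear (\<lambda>q. ?E (q * p))" for p
    by (rule linearI; simp add: linear_add[OF E(1)] linear_scale[OF E(1)] algebra_simps)+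
  have gen: "?E (p * (tens xs * q)) = 0" if "xs \<noteq> []" for p q xs
  proof -
    have "?E (tens us * (tens xs * q)) = 0" for us
    proof -
      have l: "linear (\<lambda>q. ?E (tens us * (tens xs * q)))"
        by (rule linearI) (simp_all add: linear_add[OF E(1)] linear_scale[OF E(1)] algebra_simps)
      show ?thesis
        by (rule linear_eq_on_span[OF l z, of "range tens"]) (use that in \<open>auto simp: span_tens E(2)\<close>)
    qed
    note 1 = this
    show ?thesis
      by (rule linear_eq_on_span[OF p z, of "range tens"]) (use 1 in \<open>auto simp: span_tens\<close>)
  qed
  have gen': "?E (p * (tens [x] * tens [y] - tens [y] * tens [x] - tens [lie_bracket x y]) * q) = 0" for p q x y
  proof -
    have "p * (tens [x] * tens [y] - tens [y] * tens [x] - tens [lie_bracket x y]) * q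
        = p * (tens [x, y] * q) - p * (tens [y, x] * q) - p * (tens [lie_bracket x y] * q)"
      by (simp add: left_diff_distrib right_diff_distrib mult.assoc tens_mult_left)
    then show ?thesis by (simp only: linear_diff[OF E(1)]) (simp only: gen list.distinct simp_thms diff_self)
  qed
  have "?E t = 0" if "t \<in> uea_ideal" for t
    using that unfolding uea_ideal_def ideal_gen_def
  proof (induction rule: span_induct)
    case base
    show ?case by (rule linear_subspace_kernel[OF E(1)])
  next
    case (step t)
    then show ?case using gen' by blast
  qed
  moreover assume "(1 :: 'g tensor) \<in> uea_ideal"
  ultimately have "?E 1 = 0" by blast
  then show False using E(2)[of "[]"] by simp
qed

quotient_type (overloaded) 'g uea = "('g::real_lie_algebra) tensor" / "\<lambda>p q. p - q \<in> uea_ideal"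
  by (rule equivp_subspace[OF subspace_uea_ideal])

instantiation uea :: (real_lie_algebra) real_algebra_1
begin
lift_definition zero_uea :: "'a uea" is 0 .
lift_definition one_uea :: "'a uea" is 1 .
lift_definition plus_uea :: "'a uea \<Rightarrow> 'a uea \<Rightarrow> 'a uea" is "(+)"
  by (rule subspace_diff_add[OF subspace_uea_ideal])
lift_definition minus_uea :: "'a uea \<Rightarrow> 'a uea \<Rightarrow> 'a uea" is "(-)"
  by (rule subspace_diff_diff[OF subspace_uea_ideal])
lift_definition uminus_uea :: "'a uea \<Rightarrow> 'a uea" is uminus
  by (rule subspace_diff_minus[OF subspace_uea_ideal])
lift_definition scaleR_uea :: "real \<Rightarrow> 'a uea \<Rightarrow> 'a uea" is "\<lambda>r p. r *\<^sub>R p"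
  by (rule subspace_diff_scaleR[OF subspace_uea_ideal])
lift_definition times_uea :: "'a uea \<Rightarrow> 'a uea \<Rightarrow> 'a uea" is "(*)"
  by (rule uea_ideal_mult)
instance
proof
  show "(0::'a uea) \<noteq> 1"
  proof (transfer, rule notI)
    assume "0 - 1 \<in> (uea_ideal :: 'a tensor set)"
    from subspace_neg[OF subspace_uea_ideal this] show False by (simp add: one_notin_uea_ideal)
  qed
qed (transfer; simp add: algebra_simps subspace_0[OF subspace_uea_ideal])+
end

instantiation uea :: (real_lie_algebra) real_lie_algebra
begin
definition lie_bracket_uea :: "'a uea \<Rightarrow> 'a uea \<Rightarrow> 'a uea"
  where "lie_bracket_uea a b = a * b - b * a"
instance
  by standard (simp_all add: lie_bracket_uea_def algebra_simps)
end

definition to_uea :: "'g::real_lie_algebra tensor \<Rightarrow> 'g uea"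
  where "to_uea = abs_uea"

definition uea_incl :: "'g::real_lie_algebra \<Rightarrow> 'g uea"
  where "uea_incl x = to_uea (tens [x])"

lemma to_uea_hom:
  "linear to_uea" "to_uea (p * q) = to_uea p * to_uea q" "to_uea 1 = 1"
  by (auto intro!: linearI simp: to_uea_def plus_uea.abs_eq scaleR_uea.abs_eq times_uea.abs_eq one_uea_def)

lemma to_uea_eq_iff: "to_uea p = to_uea q \<longleftrightarrow> p - q \<in> uea_ideal"
  by (simp add: to_uea_def uea.abs_eq_iff)

lemma to_uea_surj: "t \<in> range to_uea"
  by (induct t rule: uea.abs_induct) (auto simp: to_uea_def)

lemma linear_uea_incl: "linear uea_incl"
proof (rule linearI)
  fix x y :: 'a and r
  show "uea_incl (x + y) = uea_incl x + uea_incl y"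
    using tens_slot[of "[]" 1 x 1 y "[]"] by (simp add: uea_incl_def linear_add[OF to_uea_hom(1)])
  show "uea_incl (r *\<^sub>R x) = r *\<^sub>R uea_incl x"
    using tens_slot[of "[]" r x 0 x "[]"] by (simp add: uea_incl_def linear_scale[OF to_uea_hom(1)])
qed

lemma uea_incl_bracket: "uea_incl (lie_bracket x y) = lie_bracket (uea_incl x) (uea_incl y)"
proof -
  have "tens [x] * tens [y] - tens [y] * tens [x] - tens [lie_bracket x y] \<in> uea_ideal"
    unfolding uea_ideal_def by (rule ideal_gen_base') blast
  then have "to_uea (tens [x] * tens [y] - tens [y] * tens [x]) = to_uea (tens [lie_bracket x y])"
    by (simp only: to_uea_eq_iff)
  then show ?thesis
    by (simp add: uea_incl_def lie_bracket_uea_def linear_diff[OF to_uea_hom(1)] flip: to_uea_hom(2))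
qed

section \<open>Homology\<close>

text \<open>Homology classes are cosets of the space \<open>B\<close> of boundaries in the space \<open>Z\<close> of cycles.\<close>

definition homology_class :: "'v::real_vector set \<Rightarrow> 'v \<Rightarrow> 'v set"
  where "homology_class B z = {z + b | b. b \<in> B}"

definition homology :: "'v::real_vector set \<Rightarrow> 'v set \<Rightarrow> 'v set set"
  where "homology Z B = homology_class B ` Z"

text \<open>For a chain map \<open>f\<close> into a complex with boundaries \<open>B\<close>, this sends the class of \<open>z\<close> to the
  class of \<open>f z\<close>.\<close>

definition induced_map :: "('v::real_vector \<Rightarrow> 'w::real_vector) \<Rightarrow> 'w set \<Rightarrow> 'v set \<Rightarrow> 'w set"
  where "induced_map f B c = {f z + b | z b. z \<in> c \<and> b \<in> B}"

lemma induced_map_class: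
  assumes "linear f" "subspace B" "subspace B'" "f ` B \<subseteq> B'"
  shows "induced_map f B' (homology_class B z) = homology_class B' (f z)"
proof (intro set_eqI iffI)
  fix w assume "w \<in> induced_map f B' (homology_class B z)"
  then obtain b b' where "w = f (z + b) + b'" "b \<in> B" "b' \<in> B'"
    unfolding induced_map_def homology_class_def by blast
  then have "w = f z + (f b + b')" "f b + b' \<in> B'"
    using assms(3,4) by (auto simp: linear_add[OF assms(1)] intro: subspace_add)
  then show "w \<in> homology_class B' (f z)" unfolding homology_class_def by blast
next
  fix w assume "w \<in> homology_class B' (f z)"
  then obtain b' where "w = f (z + 0) + b'" "b' \<in> B'" unfolding homology_class_def by auto
  then show "w \<in> induced_map f B' (homology_class B z)"
    using subspace_0[OF assms(2)] unfolding induced_map_def homology_class_def by blast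
qed

definition leibniz_cycles :: "nat \<Rightarrow> 'g::real_lie_algebra tensor set"
  where "leibniz_cycles n = {z \<in> tensor_power n. leibniz_boundary z = 0}"

definition leibniz_boundaries :: "nat \<Rightarrow> 'g::real_lie_algebra tensor set"
  where "leibniz_boundaries n = leibniz_boundary ` tensor_power (n + 1)"

definition lie_cycles :: "nat \<Rightarrow> 'g::real_lie_algebra exterior set"
  where "lie_cycles n = {z \<in> exterior_power n. lie_boundary z = 0}"

definition lie_boundaries :: "nat \<Rightarrow> 'g::real_lie_algebra exterior set"
  where "lie_boundaries n = lie_boundary ` exterior_power (n + 1)"

definition cyclic_cycles :: "nat \<Rightarrow> 'a::real_algebra cyclic set"
  where "cyclic_cycles n = {z \<in> cyclic_chains n. cyclic_boundary z = 0}"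

definition cyclic_boundaries :: "nat \<Rightarrow> 'a::real_algebra cyclic set"
  where "cyclic_boundaries n = cyclic_boundary ` cyclic_chains (n + 1)"

text \<open>\<open>HL\<^sub>n(\<g>)\<close>, \<open>H\<^sup>L\<^sup>i\<^sup>e\<^sub>n(\<g>)\<close> and \<open>HC\<^sub>n(A)\<close>.\<close>

definition leibniz_homology :: "nat \<Rightarrow> 'g::real_lie_algebra tensor set set"
  where "leibniz_homology n = homology (leibniz_cycles n) (leibniz_boundaries n)"

definition lie_homology :: "nat \<Rightarrow> 'g::real_lie_algebra exterior set set"
  where "lie_homology n = homology (lie_cycles n) (lie_boundaries n)"

definition cyclic_homology :: "nat \<Rightarrow> 'a::real_algebra cyclic set set"
  where "cyclic_homology n = homology (cyclic_cycles n) (cyclic_boundaries n)"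

text \<open>\<open>(\<pi>\<^sub>1)\<^sub>* : HL\<^sub>n(\<g>) \<rightarrow> H\<^sup>L\<^sup>i\<^sup>e\<^sub>n(\<g>)\<close>\<close>

definition pi1_star :: "nat \<Rightarrow> 'g::real_lie_algebra tensor set \<Rightarrow> 'g exterior set"
  where "pi1_star n = induced_map to_exterior (lie_boundaries n)"

text \<open>\<open>\<mu>\<^sub>2 : H\<^sup>L\<^sup>i\<^sup>e\<^sub>n(\<g>) \<rightarrow> H\<^sup>L\<^sup>i\<^sup>e\<^sub>n(U(\<g>))\<close>\<close>

definition mu2 :: "nat \<Rightarrow> 'g::real_lie_algebra exterior set \<Rightarrow> 'g uea exterior set"
  where "mu2 n = induced_map (exterior_map uea_incl) (lie_boundaries n)"

text \<open>\<open>\<theta>\<^sub>* : H\<^sup>L\<^sup>i\<^sup>e\<^sub>n\<^sub>+\<^sub>1(A) \<rightarrow> HC\<^sub>n(A)\<close>\<close>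

definition theta_star :: "nat \<Rightarrow> 'a::real_algebra exterior set \<Rightarrow> 'a cyclic set"
  where "theta_star n = induced_map theta (cyclic_boundaries n)"

section \<open>Polynomial vector fields on the line\<close>

text \<open>\<open>VF f\<close> is the vector field \<open>f d/dx\<close>.\<close>

typedef poly_vf = "UNIV :: real poly set"
  morphisms vf_coeff VF ..

setup_lifting type_definition_poly_vf

lemma jacobi_atoms:
  fixes f :: "'a::comm_ring_1"
  shows "f * (g * h2 + h1 * g1 - (h * g2 + g1 * h1)) - (g * h1 - h * g1) * f1 +
    (g * (h * f2 + f1 * h1 - (f * h2 + h1 * f1)) - (h * f1 - f * h1) * g1) +
    (h * (f * g2 + g1 * f1 - (g * f2 + f1 * g1)) - (f * g1 - g * f1) * h1) = 0"
  by (simp add: algebra_simps)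

instantiation poly_vf :: real_lie_algebra
begin
lift_definition zero_poly_vf :: poly_vf is 0 .
lift_definition plus_poly_vf :: "poly_vf \<Rightarrow> poly_vf \<Rightarrow> poly_vf" is "(+)" .
lift_definition minus_poly_vf :: "poly_vf \<Rightarrow> poly_vf \<Rightarrow> poly_vf" is "(-)" .
lift_definition uminus_poly_vf :: "poly_vf \<Rightarrow> poly_vf" is uminus .
lift_definition scaleR_poly_vf :: "real \<Rightarrow> poly_vf \<Rightarrow> poly_vf" is smult .
lift_definition lie_bracket_poly_vf :: "poly_vf \<Rightarrow> poly_vf \<Rightarrow> poly_vf"
  is "\<lambda>f g. f * pderiv g - g * pderiv f" .
instance
proof
  fix x y z :: poly_vf
  show "lie_bracket x (lie_bracket y z) + lie_bracket y (lie_bracket z x)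
      + lie_bracket z (lie_bracket x y) = 0"
  proof transfer
    fix f g h :: "real poly"
    show "f * pderiv (g * pderiv h - h * pderiv g) - (g * pderiv h - h * pderiv g) * pderiv f +
       (g * pderiv (h * pderiv f - f * pderiv h) - (h * pderiv f - f * pderiv h) * pderiv g) +
       (h * pderiv (f * pderiv g - g * pderiv f) - (f * pderiv g - g * pderiv f) * pderiv h) = 0"
      unfolding pderiv_diff pderiv_mult by (rule jacobi_atoms)
  qed
qed (transfer; simp add: smult_add_left smult_add_right pderiv_add pderiv_smult
    distrib_left distrib_right smult_diff_right)+
end

lemma lie_bracket_VF: "lie_bracket (VF f) (VF g) = VF (f * pderiv g - g * pderiv f)"
  by (simp add: lie_bracket_poly_vf_def VF_inverse)

lemma scaleR_VF: "r *\<^sub>R VF f = VF (smult r f)"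
  by (simp add: scaleR_poly_vf_def VF_inverse)

lemma lie_bracket_monomials:
  "lie_bracket (VF (monom 1 n)) (VF (monom 1 k)) = (real k - real n) *\<^sub>R VF (monom 1 (n + k - 1))"
proof -
  have "monom 1 n * pderiv (monom 1 k) = monom (real k) (n + k - 1)"
    "monom 1 k * pderiv (monom 1 n) = monom (real n) (n + k - 1)"
    by (cases k; simp add: pderiv_monom mult_monom) (cases n; simp add: pderiv_monom mult_monom add.commute[of k])
  then show ?thesis
    unfolding lie_bracket_VF scaleR_VF by (simp add: diff_monom smult_monom)
qed

text \<open>\<open>e\<^sub>i = x\<^sup>i\<^sup>+\<^sup>1 d/dx\<close> for \<open>i \<ge> -1\<close>.\<close>

definition vf_e :: "int \<Rightarrow> poly_vf"
  where "vf_e i = VF (monom 1 (nat (i + 1)))"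

lemma lie_bracket_vf_e:
  assumes "i \<ge> -1" "j \<ge> -1" "i + j \<ge> -1"
  shows "lie_bracket (vf_e i) (vf_e j) = real_of_int (j - i) *\<^sub>R vf_e (i + j)"
proof -
  have "nat (i + 1) + nat (j + 1) - 1 = nat (i + j + 1)"
    "real (nat (j + 1)) - real (nat (i + 1)) = real_of_int (j - i)"
    using assms by auto
  then show ?thesis unfolding vf_e_def lie_bracket_monomials by (simp only:)
qed

lemma wedge_scaleR_self: "wedge [r *\<^sub>R y, y] = 0"
  using multilinear_wedge[unfolded multilinear_def, rule_format, of "[]" r y 0 y "[y]"]
    alternating_wedge[unfolded alternating_def, rule_format, of "[]" y "[]"] by simp

definition godbillon_vey :: "poly_vf exterior set"
  where "godbillon_vey = homology_class (lie_boundaries 3) (wedge [vf_e (-1), vf_e 0, vf_e 1])"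

lemma godbillon_vey_cycle: "wedge [vf_e (-1), vf_e 0, vf_e 1] \<in> lie_cycles 3"
proof -
  have "tens [vf_e (-1), vf_e 0, vf_e 1] \<in> tensor_power 3"
    unfolding tensor_power_def by (rule span_base) auto
  moreover have "lie_boundary (wedge [vf_e (-1), vf_e 0, vf_e 1]) = 0"
  proof -
    have "lie_bracket (vf_e (-1)) (vf_e 0) = vf_e (-1)" "lie_bracket (vf_e 0) (vf_e 1) = vf_e 1"
      "lie_bracket (vf_e (-1)) (vf_e 1) = 2 *\<^sub>R vf_e 0"
      by (simp_all add: lie_bracket_vf_e)
    then show ?thesis
      unfolding lie_boundary(2)
      by (simp add: omit_def numeral_3_eq_3 lessThan_Suc wedge_scaleR_self)
  qed
  ultimately show ?thesis
    by (simp add: lie_cycles_def exterior_power_def wedge_def)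
qed

end

theory Submission
  imports Defs "HOL-Analysis.Product_Vector"
begin

text \<open>
  The theorem has two halves: \<open>HL\<^sub>3(W)\<close>, for \<open>W\<close> the polynomial vector fields on the line, is
  spanned by a class over the Godbillon-Vey class; and the image of that class in \<open>HC\<^sub>2(U(W))\<close>
  is not zero.

  \<^emph>\<open>The domain is at most a line.\<close> Appending \<open>y\<close> to a tensor is, up to sign, a homotopy between zero and the
  inner derivation \<open>ad y\<close> of the Leibniz complex (\<open>leibniz_boundary_mult_single\<close>). For the Euler field
  \<open>y = e\<^sub>0\<close> this derivation is diagonal on tensors of monomial fields, with eigenvalue minus the
  weight, and it commutes with the boundary. So a cycle splits into cycles of pure weight, and
  those of nonzero weight are boundaries (\<open>leibniz_cycles_reduce_to_weight_zero\<close>). In weight zero and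
  degree three there are only ten monomial tensors, and the boundaries of seven explicit
  \<open>4\<close>-tensors leave the multiples of one cycle \<open>godbillon_vey_lift\<close>, which lies over
  \<open>e\<^sub>-\<^sub>1 \<and> e\<^sub>0 \<and> e\<^sub>1\<close> (\<open>leibniz_3_cycles_mod_boundaries\<close>).

  \<^emph>\<open>Its image survives.\<close> It suffices to find a cyclic \<open>2\<close>-cocycle on \<open>U(W)\<close> that does not vanish on
  \<open>\<theta>(e\<^sub>-\<^sub>1 \<and> e\<^sub>0 \<and> e\<^sub>1)\<close>. Conceptually, it is the composition of Connes' operator
  \<open>HC\<^sub>2(U(W)) \<rightarrow> HH\<^sub>3(U(W))\<close>, of the augmentation \<open>HH\<^sub>3(U(W)) \<rightarrow> Tor\<^sub>3(\<real>, \<real>)\<close>, which is Lie homology, and of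
  the Godbillon-Vey cocycle. Concretely, the cyclic sum of a \<open>3\<close>-cocycle \<open>\<phi>\<close> of the bar
  complex of \<open>U(W)\<close> with trivial coefficients is a cyclic cocycle
  (\<open>cyclic_cocycle_cyclic_sum\<close>), and on \<open>\<theta>(x \<and> y \<and> z)\<close> it is the antisymmetrisation of \<open>\<phi>\<close>.

  The cocycle \<open>\<phi>\<close> is a Yoneda product of three classes in degree one, leading from the trivial
  \<open>W\<close>-module \<open>\<real>\<close> to \<open>F\<^sub>0\<close>, from \<open>F\<^sub>0\<close> to \<open>F\<^sub>1\<close> and from \<open>F\<^sub>1\<close> back to \<open>\<real>\<close>. Here \<open>F\<^sub>0\<close>
  and \<open>F\<^sub>1\<close> are the polynomial functions and \<open>1\<close>-forms, and the three \<open>1\<close>-cocycles are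
  \<open>\<delta>(f) t = t f'\<close>, \<open>\<gamma>(f) u = f'' u\<close> and \<open>\<alpha>(f) v = f(0) v(0)\<close>. Every such \<open>1\<close>-cocycle extends to a derivation
  of \<open>U(W)\<close>, because it turns the direct sum of the two modules into a module
  (\<open>uea_derivation_mult\<close>), and products of derivations are bar cocycles
  (\<open>bar_cocycle_uea\<close>). On vector fields \<open>\<phi>(f, g, h) = f(0) g''(0) h'(0)\<close>, whose
  antisymmetrisation is, up to sign, the determinant of the \<open>2\<close>-jets at \<open>0\<close>: the Godbillon-Vey cocycle, with
  value \<open>-2\<close> on \<open>e\<^sub>-\<^sub>1 \<and> e\<^sub>0 \<and> e\<^sub>1\<close>.
\<close>

section \<open>Linear maps on tensor powers\<close>

lemma linear_eq_on_tens:
  assumes "linear f" "linear g" "\<And>xs. f (tens xs) = g (tens xs)"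
  shows "f p = g p"
  by (rule linear_eq_on_span[OF assms(1,2), of "range tens"]) (use assms(3) in \<open>auto simp: span_tens\<close>)

lemma linear_mult_right: "linear (\<lambda>p :: 'a::real_algebra. p * q)"
  and linear_mult_left: "linear (\<lambda>q :: 'a::real_algebra. p * q)"
  by (rule linearI; simp add: algebra_simps)+

lemma linear_compose2: "linear f \<Longrightarrow> linear g \<Longrightarrow> linear (\<lambda>x. g (f x))"
  using linear_compose[of f g] by (simp add: o_def)

lemma tens_Cons: "tens (x # xs) = tens [x] * tens xs"
  by simp

lemma tens_scaleR_Cons: "tens (r *\<^sub>R x # xs) = r *\<^sub>R tens (x # xs)"
  using tens_slot[of "[]" r x 0 x xs] by simp

lemma tens_add_Cons: "tens ((x + y) # xs) = tens (x # xs) + tens (y # xs)"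
  using tens_slot[of "[]" 1 x 1 y xs] by simp

lemma linear_tens_single: "linear (\<lambda>x. tens [x])"
  by (rule linearI) (simp_all add: tens_add_Cons tens_scaleR_Cons)

lemma tens_in_power: "length xs = n \<Longrightarrow> tens xs \<in> tensor_power n"
  unfolding tensor_power_def by (rule span_base) blast

lemma subspace_tensor_power: "subspace (tensor_power n)"
  by (simp add: tensor_power_def)

lemma tensor_power_mult:
  assumes p: "p \<in> tensor_power m" and q: "q \<in> tensor_power n"
  shows "p * q \<in> tensor_power (m + n)"
proof -
  have "tens xs * q \<in> tensor_power (m + n)" if "length xs = m" for xs
    using q unfolding tensor_power_def[of n]
  proof (induction rule: span_induct)
    case base
    show ?case
      by (rule linear_subspace_vimage[OF linear_mult_left subspace_tensor_power, unfolded vimage_def])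
  next
    case (step x)
    then show ?case using that by (auto intro!: tens_in_power)
  qed
  note 1 = this
  show ?thesis
    using p unfolding tensor_power_def[of m]
  proof (induction rule: span_induct)
    case base
    show ?case
      by (rule linear_subspace_vimage[OF linear_mult_right subspace_tensor_power, unfolded vimage_def])
  next
    case (step x)
    then show ?case using 1 by auto
  qed
qed

section \<open>Inner derivations of the Leibniz complex\<close>

lemma multilinear_adjoint_sum: "multilinear (adjoint_sum y)"
  unfolding multilinear_def
  by (intro allI)
    (simp add: adjoint_sum_append adjoint_sum_Cons lie_bracket_linear tens_add_Cons
      tens_scaleR_Cons tens_slot algebra_simps tens_mult_left tens_slot[of "[]", simplified])

text \<open>The derivation of the tensor algebra that extends \<open>x \<mapsto> [x, y]\<close>.\<close>
definition adjoint :: "'g::real_lie_algebra \<Rightarrow> 'g tensor \<Rightarrow> 'g tensor"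
  where "adjoint y = linear_extension tens (adjoint_sum y)"

lemma adjoint: "linear (adjoint y)" "adjoint y (tens xs) = adjoint_sum y xs"
  using linear_extension_tens[OF multilinear_adjoint_sum] by (simp_all add: adjoint_def)

lemma adjoint_mult: "adjoint y (p * q) = adjoint y p * q + p * adjoint y q"
proof -
  have "adjoint y (tens us * q) = adjoint y (tens us) * q + tens us * adjoint y q" for us q
    by (rule linear_eq_on_tens[where p = q])
      (auto intro!: linear_compose2[OF _ adjoint(1)] linear_compose2[OF adjoint(1)]
        linear_mult_left linear_compose_add simp: adjoint(2) adjoint_sum_append)
  note 1 = this
  show ?thesis
    by (rule linear_eq_on_tens[where p = p])
      (auto intro!: linear_compose2[OF _ adjoint(1)] linear_compose2[OF adjoint(1)]
        linear_mult_right linear_compose_add simp: 1)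
qed

lemma adjoint_single: "adjoint y (tens [x]) = tens [lie_bracket x y]"
  by (simp add: adjoint adjoint_sum_Cons)

lemma adjoint_1: "adjoint y 1 = 0"
  using adjoint(2)[of y "[]"] by simp

lemma lie_bracket_flip: "lie_bracket x y = - lie_bracket y x"
proof -
  have "lie_bracket (x + y) (x + y) = 0" by (rule lie_bracket_self)
  then have "lie_bracket x y + lie_bracket y x = 0"
    by (simp only: lie_bracket_linear) (simp add: lie_bracket_self add.commute)
  then show ?thesis by (simp add: eq_neg_iff_add_eq_0)
qed

lemma lie_bracket_minus: "lie_bracket (- x) y = - lie_bracket x y" "lie_bracket y (- x) = - lie_bracket y x"
  using lie_bracket_scaleR_left[of "-1" x y] lie_bracket_scaleR_right[of y "-1" x] by simp_all

lemma lie_bracket_right_jacobi: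
  "lie_bracket (lie_bracket x z) y = lie_bracket (lie_bracket x y) z + lie_bracket x (lie_bracket z y)"
proof -
  have "lie_bracket x (lie_bracket z y) = - lie_bracket z (lie_bracket y x) - lie_bracket y (lie_bracket x z)"
    using jacobi[of x z y] by (simp add: algebra_simps eq_neg_iff_add_eq_0)
  moreover have "lie_bracket (lie_bracket x z) y = - lie_bracket y (lie_bracket x z)"
    by (rule lie_bracket_flip)
  moreover have "lie_bracket (lie_bracket x y) z = lie_bracket z (lie_bracket y x)"
    by (subst lie_bracket_flip, subst lie_bracket_flip[of x y]) (simp add: lie_bracket_minus)
  ultimately show ?thesis by simp
qed

text \<open>
  On a single vector this is the Jacobi identity for the right action \<open>x \<mapsto> [x, y]\<close>. On longer tensors
  the mixed terms, with \<open>y\<close> and \<open>z\<close> hitting different factors, agree on both sides.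
\<close>
lemma adjoint_commute: "adjoint y (adjoint z p) = adjoint z (adjoint y p) + adjoint (lie_bracket z y) p"
proof (rule linear_eq_on_tens[where p = p])
  show "adjoint y (adjoint z (tens xs)) = adjoint z (adjoint y (tens xs)) + adjoint (lie_bracket z y) (tens xs)" for xs
  proof (induction xs)
    case Nil
    then show ?case by (simp add: adjoint_1 linear_0[OF adjoint(1)])
  next
    case (Cons x xs)
    have "tens [lie_bracket (lie_bracket x z) y]
        = tens [lie_bracket (lie_bracket x y) z] + tens [lie_bracket x (lie_bracket z y)]"
      by (subst lie_bracket_right_jacobi) (rule tens_add_Cons)
    then show ?case
      by (subst (1 2 3) tens_Cons)
         (simp add: adjoint_mult adjoint_single linear_add[OF adjoint(1)] Cons algebra_simps
           del: tens_mult)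
  qed
qed (auto intro!: linear_compose2[OF adjoint(1)] linear_compose_add adjoint(1))

lemma adjoint_tensor_power:
  assumes "p \<in> tensor_power n"
  shows "adjoint y p \<in> tensor_power n"
  using assms unfolding tensor_power_def[of n]
proof (induction rule: span_induct)
  case base
  show ?case
    using linear_subspace_vimage[OF adjoint(1) subspace_tensor_power]
    by (simp add: vimage_def tensor_power_def)
next
  case (step x)
  then obtain xs where xs: "x = tens xs" "length xs = n" by blast
  have "adjoint_sum y xs \<in> tensor_power n"
    unfolding adjoint_sum_def
    by (rule subspace_sum[OF subspace_tensor_power]) (simp add: tens_in_power xs)
  then show ?case by (simp add: xs adjoint(2) flip: tensor_power_def)
qed

text \<open>
  Cartan's formula for the Leibniz complex. Only the pairs with the last entry \<open>y\<close> are new in the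
  boundary of \<open>p \<otimes> y\<close>, and they bracket every factor of \<open>p\<close> with \<open>y\<close>. So \<open>p \<mapsto> p \<otimes> y\<close> is, up to
  sign, a homotopy between \<open>ad y\<close> and zero.
\<close>
lemma leibniz_boundary_mult_single:
  assumes "p \<in> tensor_power n"
  shows "leibniz_boundary (p * tens [y]) = leibniz_boundary p * tens [y] + (-1) ^ (n + 1) *\<^sub>R adjoint y p"
  using assms unfolding tensor_power_def
proof (rule linear_eq_on_span[rotated 3])
  show "leibniz_boundary (x * tens [y]) = leibniz_boundary x * tens [y] + (-1) ^ (n + 1) *\<^sub>R adjoint y x"
    if "x \<in> {tens xs |xs. length xs = n}" for x
    using that leibniz_sum_snoc[of _ y] by (auto simp: leibniz_boundary_eq_sum adjoint(2))
qed (auto intro!: linear_compose2[OF _ leibniz_boundary(1)] linear_compose2[OF leibniz_boundary(1)]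
        linear_mult_right linear_compose_add linear_compose_sub linear_compose_scale_right adjoint(1))

lemma leibniz_boundary_1: "leibniz_boundary 1 = 0"
  using leibniz_boundary_eq_sum[of "[]"] by (simp add: leibniz_sum_def)

text \<open>
  By induction on the length through Cartan's formula; the defect produced by the last factor is
  \<open>ad z \<circ> ad y + ad [z, y] - ad y \<circ> ad z = 0\<close>.
\<close>
lemma leibniz_boundary_adjoint:
  "leibniz_boundary (adjoint y p) = adjoint y (leibniz_boundary p)"
proof (rule linear_eq_on_tens[where p = p])
  show "leibniz_boundary (adjoint y (tens xs)) = adjoint y (leibniz_boundary (tens xs))" for xs
  proof (induction xs rule: rev_induct)
    case Nil
    show ?case
      by (simp add: leibniz_boundary_1 adjoint_1 linear_0[OF adjoint(1)] linear_0[OF leibniz_boundary(1)])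
  next
    case (snoc z xs)
    have p: "tens xs \<in> tensor_power (length xs)" by (rule tens_in_power) simp
    have e: "tens (xs @ [z]) = tens xs * tens [z]" by simp
    show ?case
      unfolding e
      by (simp only: adjoint_mult adjoint_single linear_add[OF leibniz_boundary(1)]
          leibniz_boundary_mult_single[OF p] leibniz_boundary_mult_single[OF adjoint_tensor_power[OF p]]
          linear_add[OF adjoint(1)] linear_scale[OF adjoint(1)] snoc adjoint_commute[of y z])
         (simp add: algebra_simps del: power_Suc)
  qed
qed (auto intro!: linear_compose2[OF adjoint(1)] linear_compose2[OF leibniz_boundary(1)] adjoint(1) leibniz_boundary(1))

lemma leibniz_boundary_tensor_power:
  assumes "p \<in> tensor_power (Suc n)"
  shows "leibniz_boundary p \<in> tensor_power n"
  using assms unfolding tensor_power_def[of "Suc n"]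
proof (induction rule: span_induct)
  case base
  show ?case
    by (rule linear_subspace_vimage[OF leibniz_boundary(1) subspace_tensor_power, unfolded vimage_def])
next
  case (step x)
  then obtain xs where xs: "x = tens xs" "length xs = Suc n" by blast
  show ?case
    unfolding xs(1) leibniz_boundary(2)
    by (intro subspace_sum subspace_scale subspace_tensor_power tens_in_power) (simp add: length_omit xs(2))
qed

text \<open>
  In the expansion of \<open>d (d (p \<otimes> y))\<close> by Cartan's formula the two terms with \<open>ad y\<close> have
  opposite signs, since \<open>d\<close> lowers the degree by one and commutes with \<open>ad y\<close>.
\<close>
lemma leibniz_boundary_leibniz_boundary: "leibniz_boundary (leibniz_boundary p) = 0"
proof -
  have "leibniz_boundary (leibniz_boundary (tens xs)) = 0" for xs :: "'a list"
  proof (induction xs rule: rev_induct)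
    case Nil
    show ?case by (simp add: leibniz_boundary_1 linear_0[OF leibniz_boundary(1)])
  next
    case (snoc y xs)
    have p: "tens xs \<in> tensor_power (length xs)" by (rule tens_in_power) simp
    show ?case
    proof (cases xs)
      case Nil
      then show ?thesis by (simp add: leibniz_boundary(2)[of "[y]"] linear_0[OF leibniz_boundary(1)])
    next
      case (Cons x ys)
      then have q: "leibniz_boundary (tens xs) \<in> tensor_power (length ys)"
        using p by (simp add: leibniz_boundary_tensor_power)
      \<comment> \<open>The length of \<open>ys\<close> is the degree of the boundary of \<open>xs\<close>, whence the sign change.\<close>
      have "leibniz_boundary (leibniz_boundary (tens xs * tens [y])) =
         (-1) ^ (length ys + 1) *\<^sub>R adjoint y (leibniz_boundary (tens xs))
         + (-1) ^ (length xs + 1) *\<^sub>R adjoint y (leibniz_boundary (tens xs))"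
        by (simp only: leibniz_boundary_mult_single[OF p] linear_add[OF leibniz_boundary(1)]
            leibniz_boundary_mult_single[OF q] linear_scale[OF leibniz_boundary(1)] leibniz_boundary_adjoint snoc)
           simp
      also have "\<dots> = 0" using Cons by simp
      finally show ?thesis by simp
    qed
  qed
  then show ?thesis
    by (rule linear_eq_on_tens[of "\<lambda>p. leibniz_boundary (leibniz_boundary p)" "\<lambda>p. 0",
          OF linear_compose2[OF leibniz_boundary(1) leibniz_boundary(1)] module_hom_zero])
qed

lemma subspace_leibniz_cycles: "subspace (leibniz_cycles n :: 'g::real_lie_algebra tensor set)"
proof -
  have "leibniz_cycles n = (tensor_power n :: 'g tensor set) \<inter> {z. leibniz_boundary z = 0}"
    by (auto simp: leibniz_cycles_def)
  then show ?thesis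
    using subspace_inter[OF subspace_tensor_power linear_subspace_kernel[OF leibniz_boundary(1)]]
    by (simp only:)
qed

lemma subspace_leibniz_boundaries: "subspace (leibniz_boundaries n)"
  unfolding leibniz_boundaries_def
  by (rule linear_subspace_image[OF leibniz_boundary(1) subspace_tensor_power])

section \<open>Weights of polynomial vector fields\<close>

text \<open>
  The operator \<open>D - a\<close> kills the component with eigenvalue \<open>a\<close> and rescales the others by nonzero
  factors, so the components can be removed one by one without leaving \<open>Z\<close>.
\<close>
lemma eigenvectors_in_invariant_subspace:
  fixes Z :: "'v::real_vector set"
  assumes Z: "subspace Z" "\<And>z. z \<in> Z \<Longrightarrow> D z \<in> Z" and D: "linear D"
    and "finite W" "\<And>w. w \<in> W \<Longrightarrow> D (f w) = w *\<^sub>R f w" "sum f W \<in> Z"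
  shows "w \<in> W \<Longrightarrow> f w \<in> Z"
  using assms(4-)
proof (induction W arbitrary: f w rule: finite_induct)
  case (insert a W)
  have "D (sum f (insert a W)) - a *\<^sub>R sum f (insert a W) = (\<Sum>v\<in>W. (v - a) *\<^sub>R f v)"
    using insert by (simp add: linear_sum[OF D] scaleR_sum_right sum_subtractf scaleR_diff_left linear_add[OF D] scaleR_add_right)
  moreover have "D (sum f (insert a W)) - a *\<^sub>R sum f (insert a W) \<in> Z"
    by (intro subspace_diff[OF Z(1)] subspace_scale[OF Z(1)] Z(2) insert.prems(3))
  ultimately have s: "(\<Sum>v\<in>W. (v - a) *\<^sub>R f v) \<in> Z" by simp
  have *: "(v - a) *\<^sub>R f v \<in> Z" if "v \<in> W" for v
    by (rule insert.IH[OF that _ s]) (simp add: insert.prems linear_scale[OF D])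
  then have W: "f v \<in> Z" if "v \<in> W" for v
    using subspace_scale[OF Z(1) *[OF that], of "inverse (v - a)"] that insert.hyps
    by (cases "v = a") auto
  moreover have "f a = sum f (insert a W) - sum f W" using insert.hyps by simp
  then have "f a \<in> Z" using W insert.prems(3) by (metis subspace_diff subspace_sum Z(1))
  ultimately show ?case using insert.prems(1) by blast
qed simp

definition monomial_vf :: "nat \<Rightarrow> poly_vf"
  where "monomial_vf n = VF (monom 1 n)"

lemma vf_e_conv_monomial: "vf_e (-1) = monomial_vf 0" "vf_e 0 = monomial_vf 1" "vf_e 1 = monomial_vf 2"
  by (simp_all add: vf_e_def monomial_vf_def)

text \<open>The truncated exponent for \<open>n = k = 0\<close> is harmless, because the coefficient vanishes.\<close>
lemma lie_bracket_monomial_vf: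
  "lie_bracket (monomial_vf n) (monomial_vf k) = (real k - real n) *\<^sub>R monomial_vf (n + k - 1)"
  unfolding monomial_vf_def by (rule lie_bracket_monomials)

lemma VF_linear: "VF (f + g) = VF f + VF g" "VF 0 = 0"
  by (simp_all add: plus_poly_vf_def zero_poly_vf_def VF_inverse)

lemma span_monomial_vf: "span (range monomial_vf) = UNIV"
proof -
  have "VF p \<in> span (range monomial_vf)" for p
  proof -
    have "VF (\<Sum>i\<in>A. monom (c i) i) = (\<Sum>i\<in>A. c i *\<^sub>R monomial_vf i)" if "finite A" for A and c :: "nat \<Rightarrow> real"
      using that
      by (induction A rule: finite_induct)
         (simp_all add: VF_linear monomial_vf_def scaleR_VF smult_monom)
    from this[of "{..degree p}" "coeff p"]
    have "VF p = (\<Sum>i\<le>degree p. coeff p i *\<^sub>R monomial_vf i)"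
      by (simp add: poly_as_sum_of_monoms)
    then show "VF p \<in> span (range monomial_vf)"
      by (auto intro!: span_sum span_scale intro: span_base)
  qed
  then show ?thesis by (metis UNIV_eq_I VF_cases)
qed

definition monomial_tens :: "nat list \<Rightarrow> poly_vf tensor"
  where "monomial_tens ns = tens (map monomial_vf ns)"

lemma tensor_power_monomial_tens:
  "tensor_power n = span {monomial_tens ns | ns. length ns = n}" (is "_ = span (?M n)")
proof
  show "span (?M n) \<subseteq> tensor_power n"
    by (rule span_minimal) (auto simp: monomial_tens_def subspace_tensor_power intro!: tens_in_power)
  have "tens xs \<in> span (?M (length xs))" for xs
  proof (induction xs)
    case Nil
    show ?case by (rule span_base) (auto simp: monomial_tens_def)
  next
    case (Cons x xs)
    have 1: "monomial_tens [m] * t \<in> span (?M (Suc k))" if "t \<in> span (?M k)" for m t k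
      using that
    proof (induction rule: span_induct)
      case base
      show ?case
        by (rule linear_subspace_vimage[OF linear_mult_left subspace_span, unfolded vimage_def])
    next
      case (step t)
      then obtain ns where "t = monomial_tens ns" "length ns = k" by blast
      then have "monomial_tens [m] * t = monomial_tens (m # ns)" "length (m # ns) = Suc k"
        by (simp_all add: monomial_tens_def)
      then show ?case by (metis (mono_tags, lifting) mem_Collect_eq span_base)
    qed
    have "x \<in> span (range monomial_vf)" by (simp add: span_monomial_vf)
    then have "tens [x] * tens xs \<in> span (?M (Suc (length xs)))"
    proof (induction rule: span_induct)
      case base
      show ?case
        using linear_subspace_vimage[OF linear_compose2[OF linear_tens_single linear_mult_right] subspace_span]
        by (simp only: vimage_def)
    next
      case (step x)
      then show ?case using 1[OF Cons] by (auto simp: monomial_tens_def)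
    qed
    then show ?case by simp
  qed
  then show "tensor_power n \<subseteq> span (?M n)"
    unfolding tensor_power_def by (intro span_minimal) auto
qed

text \<open>The field \<open>x\<^sup>n d/dx = e\<^sub>n\<^sub>-\<^sub>1\<close> has weight \<open>n - 1\<close>, and weights add up in tensor products.\<close>
definition weight_space :: "nat \<Rightarrow> real \<Rightarrow> poly_vf tensor set"
  where "weight_space n w = span {monomial_tens ns | ns. length ns = n \<and> real (sum_list ns) - real n = w}"

lemma subspace_weight_space: "subspace (weight_space n w)"
  by (simp add: weight_space_def)

lemma adjoint_monomial_tens:
  "adjoint (vf_e 0) (monomial_tens ns) = (real (length ns) - real (sum_list ns)) *\<^sub>R monomial_tens ns"
proof (induction ns)
  case Nil
  show ?case by (simp add: monomial_tens_def adjoint_1)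
next
  case (Cons n ns)
  have "tens [lie_bracket (monomial_vf n) (vf_e 0)] = (1 - real n) *\<^sub>R tens [monomial_vf n]"
    by (simp only: vf_e_conv_monomial lie_bracket_monomial_vf tens_scaleR_Cons) simp
  moreover have "monomial_tens (n # ns) = tens [monomial_vf n] * monomial_tens ns"
    by (simp add: monomial_tens_def)
  ultimately show ?case
    by (simp only: adjoint_mult adjoint_single Cons) (simp add: algebra_simps)
qed

text \<open>The Euler field acts from the right, \<open>[e\<^sub>i, e\<^sub>0] = - i e\<^sub>i\<close>, which gives the sign.\<close>
lemma adjoint_weight_space:
  assumes "z \<in> weight_space n w"
  shows "adjoint (vf_e 0) z = (- w) *\<^sub>R z"
  using assms unfolding weight_space_def
proof (rule linear_eq_on_span[rotated 3])
  show "adjoint (vf_e 0) x = (- w) *\<^sub>R x"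
    if "x \<in> {monomial_tens ns | ns. length ns = n \<and> real (sum_list ns) - real n = w}" for x
    using that by (auto simp: adjoint_monomial_tens algebra_simps)
qed (auto intro!: adjoint(1) linear_compose_scale_right linear_ident linear_compose_neg)

lemma tensor_power_weight_decomposition:
  assumes "z \<in> tensor_power n"
  obtains W f where "finite W" "\<And>w. w \<in> W \<Longrightarrow> f w \<in> weight_space n w" "z = sum f W"
proof -
  have "\<exists>W f. finite W \<and> (\<forall>w\<in>W. f w \<in> weight_space n w) \<and> z = sum f W"
    using assms unfolding tensor_power_monomial_tens
  proof (induction rule: span_induct_alt)
    case base
    show ?case by (rule exI[of _ "{}"]) simp
  next
    case (step c x y)
    then obtain W f ns where y: "finite W" "\<forall>w\<in>W. f w \<in> weight_space n w" "y = sum f W"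
      and x: "x = monomial_tens ns" "length ns = n" by blast
    define v where "v = real (sum_list ns) - real n"
    have v: "c *\<^sub>R x \<in> weight_space n v"
      unfolding weight_space_def by (rule span_scale, rule span_base) (use x v_def in blast)
    define g where "g w = (if w \<in> W then f w else 0) + (if w = v then c *\<^sub>R x else 0)" for w
    have "sum g (insert v W) = (\<Sum>w\<in>insert v W. if w \<in> W then f w else 0) + (\<Sum>w\<in>insert v W. if w = v then c *\<^sub>R x else 0)"
      unfolding g_def by (rule sum.distrib)
    also have "(\<Sum>w\<in>insert v W. if w \<in> W then f w else 0) = sum f W"
      using y(1) by (intro sum.mono_neutral_cong_right) auto
    also have "(\<Sum>w\<in>insert v W. if w = v then c *\<^sub>R x else 0) = c *\<^sub>R x"
      using y(1) by (simp add: sum.delta)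
    finally have "c *\<^sub>R x + y = sum g (insert v W)" using y(3) by simp
    moreover have "g w \<in> weight_space n w" if "w \<in> insert v W" for w
      unfolding g_def using y(2) v
      by (auto intro!: subspace_add[OF subspace_weight_space] subspace_0[OF subspace_weight_space])
    ultimately show ?case using y(1) by (intro exI[of _ "insert v W"] exI[of _ g]) auto
  qed
  then show thesis using that by blast
qed

text \<open>For a cycle \<open>z\<close>, Cartan's formula reads \<open>d (z \<otimes> e\<^sub>0) = \<plusminus> w z\<close>.\<close>
lemma leibniz_cycles_weight_nonzero:
  assumes "z \<in> leibniz_cycles n" "z \<in> weight_space n w" "w \<noteq> 0"
  shows "z \<in> leibniz_boundaries n"
proof -
  have z: "z \<in> tensor_power n" "leibniz_boundary z = 0"
    using assms(1) by (auto simp: leibniz_cycles_def)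
  have "leibniz_boundary (z * tens [vf_e 0]) = ((-1) ^ (n + 1) * - w) *\<^sub>R z"
    by (simp add: leibniz_boundary_mult_single[OF z(1)] z(2) adjoint_weight_space[OF assms(2)])
  moreover have "z * tens [vf_e 0] \<in> tensor_power (n + 1)"
    by (intro tensor_power_mult z(1) tens_in_power) simp
  ultimately have "((-1) ^ (n + 1) * - w) *\<^sub>R z \<in> leibniz_boundaries n"
    unfolding leibniz_boundaries_def by (metis imageI)
  from subspace_scale[OF subspace_leibniz_boundaries this, of "inverse ((-1) ^ (n + 1) * - w)"]
  show ?thesis using assms(3) by (simp del: inverse_mult_distrib mult_minus_right)
qed

text \<open>
  The cycles are invariant under \<open>ad e\<^sub>0\<close>, hence contain the weight components of each of their
  elements, and all components but the one of weight zero bound.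
\<close>
lemma leibniz_cycles_reduce_to_weight_zero:
  assumes "z \<in> leibniz_cycles n"
  obtains z0 where "z0 \<in> leibniz_cycles n" "z0 \<in> weight_space n 0" "z - z0 \<in> leibniz_boundaries n"
proof -
  obtain W f where W: "finite W" "\<And>w. w \<in> W \<Longrightarrow> f w \<in> weight_space n w" "z = sum f W"
    using tensor_power_weight_decomposition[of z n] assms by (auto simp: leibniz_cycles_def)
  let ?D = "\<lambda>z. - adjoint (vf_e 0) z"
  have D: "?D z \<in> leibniz_cycles n" if "z \<in> leibniz_cycles n" for z
    using that adjoint_tensor_power[of z n "vf_e 0"] subspace_neg[OF subspace_tensor_power]
    by (auto simp: leibniz_cycles_def linear_neg[OF leibniz_boundary(1)] leibniz_boundary_adjoint linear_0[OF adjoint(1)])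
  have cyc: "f w \<in> leibniz_cycles n" if "w \<in> W" for w
  proof (rule eigenvectors_in_invariant_subspace[of _ ?D W f])
    show "linear ?D" by (intro linear_compose_neg adjoint(1))
    show "sum f W \<in> leibniz_cycles n" using assms W(3) by simp
    show "?D (f w) = w *\<^sub>R f w" if "w \<in> W" for w
      using adjoint_weight_space[OF W(2)[OF that]] by simp
  qed (fact subspace_leibniz_cycles D W(1) that)+
  have nz: "sum f (W - {0}) \<in> leibniz_boundaries n"
    by (rule subspace_sum[OF subspace_leibniz_boundaries])
       (use cyc W in \<open>auto intro: leibniz_cycles_weight_nonzero\<close>)
  show thesis
  proof (cases "0 \<in> W")
    case True
    then have "z - f 0 = sum f (W - {0})" using W by (simp add: sum.remove[of W 0])
    then show thesis using that[of "f 0"] cyc W(2) nz True by simp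
  next
    case False
    then show thesis
      using that[of 0] nz W(3)
      by (simp add: subspace_0 subspace_leibniz_cycles subspace_weight_space)
  qed
qed

section \<open>Leibniz homology of polynomial vector fields in degree three\<close>

lemma wedge_swap: "wedge (us @ a # b # vs) = - wedge (us @ b # a # vs)"
proof -
  have "tens us * (tens [a, b] + tens [b, a]) * tens vs \<in> exterior_ideal"
    by (intro exterior_ideal_mult_left exterior_ideal_mult_right tens_polarize)
  then have "to_exterior (tens (us @ a # b # vs) + tens (us @ b # a # vs)) = 0"
    by (simp add: to_exterior_eq_0_iff algebra_simps)
  then show ?thesis
    by (simp add: wedge_def linear_add[OF linear_to_exterior] eq_neg_iff_add_eq_0)
qed

lemma leibniz_boundary_3:
  "leibniz_boundary (tens [x, y, z])
    = tens [lie_bracket x y, z] - tens [lie_bracket x z, y] - tens [x, lie_bracket y z]"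
  by (simp add: leibniz_boundary(2) lessThan_Suc omit_def numeral_3_eq_3)

lemma leibniz_boundary_4:
  "leibniz_boundary (tens [x, y, z, w])
    = tens [lie_bracket x y, z, w] - tens [lie_bracket x z, y, w] - tens [x, lie_bracket y z, w]
      + tens [lie_bracket x w, y, z] + tens [x, lie_bracket y w, z] + tens [x, y, lie_bracket z w]"
  by (simp add: leibniz_boundary(2) lessThan_Suc omit_def)

lemma tens_scaleR_slot: "tens (us @ (r *\<^sub>R x) # vs) = r *\<^sub>R tens (us @ x # vs)"
  using tens_slot[of us r x 0 x vs] by simp

lemmas tens_scaleR_slots = tens_scaleR_slot[of "[]", simplified] tens_scaleR_slot[of "[a]" for a, simplified]
  tens_scaleR_slot[of "[a, b]" for a b, simplified]

lemma leibniz_boundary_monomial_tens_3: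
  "leibniz_boundary (monomial_tens [a, b, c])
    = (real b - real a) *\<^sub>R monomial_tens [a + b - 1, c] - (real c - real a) *\<^sub>R monomial_tens [a + c - 1, b]
      - (real c - real b) *\<^sub>R monomial_tens [a, b + c - 1]"
  by (simp add: monomial_tens_def leibniz_boundary_3 lie_bracket_monomial_vf tens_scaleR_slots)

lemma leibniz_boundary_monomial_tens_4:
  "leibniz_boundary (monomial_tens [a, b, c, d])
    = (real b - real a) *\<^sub>R monomial_tens [a + b - 1, c, d] - (real c - real a) *\<^sub>R monomial_tens [a + c - 1, b, d]
      - (real c - real b) *\<^sub>R monomial_tens [a, b + c - 1, d] + (real d - real a) *\<^sub>R monomial_tens [a + d - 1, b, c]
      + (real d - real b) *\<^sub>R monomial_tens [a, b + d - 1, c] + (real d - real c) *\<^sub>R monomial_tens [a, b, c + d - 1]"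
  by (simp add: monomial_tens_def leibniz_boundary_4 lie_bracket_monomial_vf tens_scaleR_slots)

lemma monomial_tens_in_power: "length ns = n \<Longrightarrow> monomial_tens ns \<in> tensor_power n"
  by (simp add: monomial_tens_def tens_in_power)

text \<open>
  The linear functional on tensors of degree two that reads off the coefficient of
  \<open>x\<^sup>i d/dx \<otimes> x\<^sup>j d/dx\<close>; it turns the vanishing of a boundary into linear equations.
\<close>
definition coeff_pairing :: "nat \<Rightarrow> nat \<Rightarrow> poly_vf tensor \<Rightarrow> real"
  where "coeff_pairing i j = linear_extension tens (\<lambda>xs. if length xs = 2
    then coeff (vf_coeff (xs ! 0)) i * coeff (vf_coeff (xs ! 1)) j else 0)"

lemma coeff_pairing:
  "linear (coeff_pairing i j)"
  "coeff_pairing i j (monomial_tens [m, n]) = (if m = i \<and> n = j then 1 else 0)"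
proof -
  have "multilinear (\<lambda>xs. if length xs = 2
      then coeff (vf_coeff (xs ! 0)) i * coeff (vf_coeff (xs ! 1)) j else 0)"
    by (rule multilinearI)
       (auto simp: nth_list_update less_2_cases_iff plus_poly_vf.rep_eq scaleR_poly_vf.rep_eq algebra_simps)
  note L = linear_extension_tens[OF this, folded coeff_pairing_def]
  show "linear (coeff_pairing i j)" by (rule L(1))
  show "coeff_pairing i j (monomial_tens [m, n]) = (if m = i \<and> n = j then 1 else 0)"
    by (simp add: monomial_tens_def L(2) monomial_vf_def VF_inverse)
qed

text \<open>
  Half of \<open>e\<^sub>-\<^sub>1 \<otimes> e\<^sub>0 \<otimes> e\<^sub>1 + e\<^sub>0 \<otimes> e\<^sub>1 \<otimes> e\<^sub>-\<^sub>1\<close> already projects to the Godbillon-Vey cycle, but its Leibniz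
  boundary is a nonzero symmetric tensor. The last summand, which dies in the exterior power,
  cancels it.
\<close>
definition godbillon_vey_lift :: "poly_vf tensor"
  where "godbillon_vey_lift = (1/2) *\<^sub>R (monomial_tens [0, 1, 2] + monomial_tens [1, 2, 0])
    + (1/6) *\<^sub>R monomial_tens [0, 0, 3]"

lemma godbillon_vey_lift_cycle: "godbillon_vey_lift \<in> leibniz_cycles 3"
proof -
  have "godbillon_vey_lift \<in> tensor_power 3"
    unfolding godbillon_vey_lift_def
    by (intro subspace_add subspace_scale subspace_tensor_power monomial_tens_in_power) simp_all
  moreover have "leibniz_boundary godbillon_vey_lift = 0"
    by (simp add: godbillon_vey_lift_def linear_add[OF leibniz_boundary(1)] linear_scale[OF leibniz_boundary(1)]
        leibniz_boundary_monomial_tens_3 numeral_2_eq_2 algebra_simps)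
  ultimately show ?thesis by (simp add: leibniz_cycles_def)
qed

lemma to_exterior_godbillon_vey_lift:
  "to_exterior godbillon_vey_lift = wedge [vf_e (-1), vf_e 0, vf_e 1]"
proof -
  let ?w = "\<lambda>ns. wedge (map monomial_vf ns)"
  have "?w [1, 2, 0] = ?w [0, 1, 2]"
    using wedge_swap[of "[monomial_vf 1]" "monomial_vf 2" "monomial_vf 0" "[]"]
      wedge_swap[of "[]" "monomial_vf 1" "monomial_vf 0" "[monomial_vf 2]"] by simp
  moreover have "?w [0, 0, 3] = 0"
    using alternating_wedge unfolding alternating_def by (metis append_Nil list.simps(9))
  moreover have "to_exterior (monomial_tens ns) = ?w ns" for ns
    by (simp add: monomial_tens_def wedge_def)
  ultimately have "to_exterior godbillon_vey_lift = (1/2) *\<^sub>R (?w [0, 1, 2] + ?w [0, 1, 2]) + (1/6) *\<^sub>R 0"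
    by (simp only: godbillon_vey_lift_def linear_add[OF linear_to_exterior] linear_scale[OF linear_to_exterior])
  also have "\<dots> = ?w [0, 1, 2]"
    by (simp flip: scaleR_2)
  finally show ?thesis by (simp add: vf_e_conv_monomial)
qed

text \<open>
  There are ten monomial tensors of degree three and weight zero, namely those whose exponents add
  up to \<open>3\<close>. Seven boundaries express all of them by the three that occur in
  \<open>godbillon_vey_lift\<close>.
\<close>
lemma weight_zero_mod_boundaries:
  assumes "z \<in> weight_space 3 0"
  obtains p q s where "z - (p *\<^sub>R monomial_tens [0, 1, 2] + q *\<^sub>R monomial_tens [1, 2, 0]
    + s *\<^sub>R monomial_tens [0, 0, 3]) \<in> leibniz_boundaries 3"
proof -
  let ?M = monomial_tens and ?B = "leibniz_boundaries 3 :: poly_vf tensor set"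
  let ?r = "\<lambda>p q s. p *\<^sub>R ?M [0, 1, 2] + q *\<^sub>R ?M [1, 2, 0] + s *\<^sub>R ?M [0, 0, 3]"
  have bd: "c *\<^sub>R leibniz_boundary (?M ns) \<in> ?B" if "length ns = 4" for c ns
    using that unfolding leibniz_boundaries_def
    by (intro subspace_scale linear_subspace_image leibniz_boundary(1) subspace_tensor_power imageI
        monomial_tens_in_power) simp
  note add = subspace_add[OF subspace_leibniz_boundaries]
  \<comment> \<open>Merges the terms that cancel in the boundaries of \<open>(0, 0, 1, 3)\<close> and \<open>(0, 3, 1, 0)\<close>.\<close>
  have third: "(1/3 :: real) *\<^sub>R v + (1/3 :: real) *\<^sub>R v = (2/3 :: real) *\<^sub>R v" for v :: "poly_vf tensor"
    by (simp flip: scaleR_add_left)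
  have r300: "?M [3, 0, 0] \<in> ?B"
    using bd[of "[0, 4, 0, 0]" "1/4"] by (simp add: leibniz_boundary_monomial_tens_4)
  have r111: "?M [1, 1, 1] \<in> ?B"
    using bd[of "[0, 2, 1, 1]" "1/2"] by (simp add: leibniz_boundary_monomial_tens_4)
  have r021: "?M [0, 2, 1] + ?M [0, 1, 2] \<in> ?B"
    using bd[of "[0, 2, 2, 0]" "-1/2"] by (simp add: leibniz_boundary_monomial_tens_4 algebra_simps)
  have r201: "?M [2, 0, 1] + ?M [0, 2, 1] \<in> ?B"
    using bd[of "[0, 0, 1, 3]" "1/3"] by (simp add: leibniz_boundary_monomial_tens_4 third algebra_simps)
  have r210: "?M [2, 1, 0] - ?M [0, 2, 1] \<in> ?B"
    using bd[of "[0, 3, 1, 0]" "1/3"] by (simp add: leibniz_boundary_monomial_tens_4 third algebra_simps)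
  have r030: "?M [3, 0, 0] + ?M [0, 3, 0] + ?M [0, 0, 3] \<in> ?B"
    using bd[of "[0, 0, 0, 4]" "1/4"] by (simp add: leibniz_boundary_monomial_tens_4 algebra_simps)
  have r102: "?M [1, 0, 2] + ?M [0, 1, 2] + ?M [1, 2, 0] + ?M [0, 2, 1] \<in> ?B"
    using bd[of "[0, 2, 0, 2]" "1/2"] by (simp add: leibniz_boundary_monomial_tens_4 algebra_simps)
  define S where "S = {z. \<exists>p q s. z - ?r p q s \<in> ?B}"
  have SI: "z \<in> S" if "z - ?r p q s \<in> ?B" for z p q s using that by (auto simp: S_def)
  have sS: "subspace S"
  proof (rule subspaceI)
    show "0 \<in> S" using SI[of 0 0 0 0] by (simp add: subspace_0 subspace_leibniz_boundaries)
    fix x y c assume "x \<in> S" "y \<in> S"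
    then obtain p q s p' q' s' where "x - ?r p q s \<in> ?B" "y - ?r p' q' s' \<in> ?B" by (auto simp: S_def)
    note xy = this
    have e: "x + y - ?r (p + p') (q + q') (s + s') = (x - ?r p q s) + (y - ?r p' q' s')"
      "c *\<^sub>R x - ?r (c * p) (c * q) (c * s) = c *\<^sub>R (x - ?r p q s)"
      by (simp_all add: algebra_simps)
    show "x + y \<in> S"
      by (rule SI[of _ "p + p'" "q + q'" "s + s'"]) (simp only: e add[OF xy])
    show "c *\<^sub>R x \<in> S"
      by (rule SI[of _ "c * p" "c * q" "c * s"]) (simp only: e subspace_scale[OF subspace_leibniz_boundaries xy(1)])
  qed
  have S: "?M [0, 1, 2] \<in> S" "?M [1, 2, 0] \<in> S" "?M [0, 0, 3] \<in> S"
    using SI[of "?M [0, 1, 2]" 1 0 0] SI[of "?M [1, 2, 0]" 0 1 0] SI[of "?M [0, 0, 3]" 0 0 1]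
    by (simp_all add: subspace_0 subspace_leibniz_boundaries)
  have S': "?M [3, 0, 0] \<in> S" "?M [1, 1, 1] \<in> S" "?M [0, 2, 1] \<in> S" "?M [2, 0, 1] \<in> S" "?M [2, 1, 0] \<in> S" "?M [0, 3, 0] \<in> S" "?M [1, 0, 2] \<in> S"
    using r300 SI[of "?M [3, 0, 0]" 0 0 0]
      r111 SI[of "?M [1, 1, 1]" 0 0 0]
      r021 SI[of "?M [0, 2, 1]" "-1" 0 0]
      subspace_diff[OF subspace_leibniz_boundaries r201 r021] SI[of "?M [2, 0, 1]" 1 0 0]
      add[OF r210 r021] SI[of "?M [2, 1, 0]" "-1" 0 0]
      subspace_diff[OF subspace_leibniz_boundaries r030 r300] SI[of "?M [0, 3, 0]" 0 0 "-1"]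
      subspace_diff[OF subspace_leibniz_boundaries r102 r021] SI[of "?M [1, 0, 2]" 0 "-1" 0]
    by (simp_all add: algebra_simps)
  have "?M ns \<in> S" if ns: "length ns = 3" "real (sum_list ns) - real 3 = 0" for ns
  proof -
    obtain a b c where abc: "ns = [a, b, c]" using ns(1) by (auto simp: length_Suc_conv numeral_3_eq_3)
    have sum: "a + b + c = 3" using ns(2) by (simp add: abc)
    then have "a = 0 \<or> a = 1 \<or> a = 2 \<or> a = 3" "b = 0 \<or> b = 1 \<or> b = 2 \<or> b = 3" by auto
    then have "(a, b, c) \<in> {(0, 1, 2), (1, 2, 0), (0, 0, 3), (3, 0, 0), (1, 1, 1), (0, 2, 1), (2, 0, 1), (2, 1, 0), (0, 3, 0), (1, 0, 2)}"
      using sum by (elim disjE) simp_all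
    then show ?thesis using S S' unfolding abc by blast
  qed
  then have "weight_space 3 0 \<subseteq> S"
    unfolding weight_space_def by (intro span_minimal sS) auto
  then show thesis using assms that by (auto simp: S_def)
qed

text \<open>
  The boundaries of the three remaining tensors span a plane, so the cycles among their
  combinations form a line. The coefficients of \<open>e\<^sub>0 \<otimes> e\<^sub>0\<close> and \<open>e\<^sub>-\<^sub>1 \<otimes> e\<^sub>1\<close> in the boundary give the two
  equations of this line.
\<close>
lemma leibniz_3_cycles_mod_boundaries:
  assumes "z \<in> leibniz_cycles 3"
  obtains r where "z - r *\<^sub>R godbillon_vey_lift \<in> leibniz_boundaries 3"
proof -
  let ?M = monomial_tens
  obtain z0 where z0: "z0 \<in> leibniz_cycles 3" "z0 \<in> weight_space 3 0" "z - z0 \<in> leibniz_boundaries 3"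
    using leibniz_cycles_reduce_to_weight_zero[OF assms] .
  obtain p q s where *: "z0 - (p *\<^sub>R ?M [0, 1, 2] + q *\<^sub>R ?M [1, 2, 0] + s *\<^sub>R ?M [0, 0, 3]) \<in> leibniz_boundaries 3"
    using weight_zero_mod_boundaries[OF z0(2)] .
  let ?y = "p *\<^sub>R ?M [0, 1, 2] + q *\<^sub>R ?M [1, 2, 0] + s *\<^sub>R ?M [0, 0, 3]"
  have "leibniz_boundary (z0 - ?y) = 0"
    using * by (auto simp: leibniz_boundaries_def leibniz_boundary_leibniz_boundary)
  then have 0: "leibniz_boundary ?y = 0"
    using z0(1) by (simp only: leibniz_cycles_def mem_Collect_eq linear_diff[OF leibniz_boundary(1)]) simp
  note lin = linear_add[OF leibniz_boundary(1)] linear_scale[OF leibniz_boundary(1)]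
    linear_add[OF coeff_pairing(1)] linear_scale[OF coeff_pairing(1)] linear_diff[OF coeff_pairing(1)]
    linear_neg[OF coeff_pairing(1)]
  have "coeff_pairing 1 1 (leibniz_boundary ?y) = 2 * q - 2 * p"
    "coeff_pairing 0 2 (leibniz_boundary ?y) = q - 3 * s"
    by (simp_all add: lin leibniz_boundary_monomial_tens_3 coeff_pairing(2))
  with 0 have "q = p" "s = p / 3" by (simp_all add: linear_0[OF coeff_pairing(1)])
  then have "?y = (2 * p) *\<^sub>R godbillon_vey_lift"
    by (simp add: godbillon_vey_lift_def scaleR_add_right)
  then have "z - (2 * p) *\<^sub>R godbillon_vey_lift \<in> leibniz_boundaries 3"
    using subspace_add[OF subspace_leibniz_boundaries z0(3) *] by simp
  then show thesis by (rule that)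
qed

section \<open>Lie modules and derivations of the enveloping algebra\<close>

definition lie_action :: "('g::real_lie_algebra \<Rightarrow> 'v::real_vector \<Rightarrow> 'v) \<Rightarrow> bool"
  where "lie_action act \<longleftrightarrow> (\<forall>v. linear (\<lambda>x. act x v)) \<and> (\<forall>x. linear (act x)) \<and>
    (\<forall>x y v. act (lie_bracket x y) v = act x (act y v) - act y (act x v))"

definition tensor_action :: "('g::real_vector \<Rightarrow> 'v::real_vector \<Rightarrow> 'v) \<Rightarrow> 'g tensor \<Rightarrow> 'v \<Rightarrow> 'v"
  where "tensor_action act p v = linear_extension tens (\<lambda>xs. foldr act xs v) p"

text \<open>
  Acting through an arbitrary representative is harmless because the defining ideal of the
  enveloping algebra acts by zero (\<open>uea_action_to_uea\<close>).
\<close>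
definition uea_action :: "('g::real_lie_algebra \<Rightarrow> 'v::real_vector \<Rightarrow> 'v) \<Rightarrow> 'g uea \<Rightarrow> 'v \<Rightarrow> 'v"
  where "uea_action act a v = tensor_action act (inv to_uea a) v"

lemma linear_foldr: "(\<And>x. linear (act x)) \<Longrightarrow> linear (foldr act xs)"
proof (induction xs)
  case (Cons x xs)
  then show ?case using linear_compose[of "foldr act xs" "act x"] by (simp add: o_def)
qed (simp add: linear_id[unfolded id_def] id_def)

context
  fixes act :: "'g::real_lie_algebra \<Rightarrow> 'v::real_vector \<Rightarrow> 'v"
  assumes act: "lie_action act"
begin

lemma act_linear: "linear (\<lambda>x. act x v)" "linear (act x)"
  and act_bracket: "act (lie_bracket x y) v = act x (act y v) - act y (act x v)"
  using act by (simp_all add: lie_action_def)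

lemma tensor_action:
  "linear (\<lambda>p. tensor_action act p v)" "tensor_action act (tens xs) v = foldr act xs v"
proof -
  have "multilinear (\<lambda>xs. foldr act xs v)" for v
    unfolding multilinear_def
    by (simp add: linear_add[OF act_linear(1)] linear_scale[OF act_linear(1)]
        linear_add[OF linear_foldr] linear_scale[OF linear_foldr] act_linear(2))
  note L = linear_extension_tens[OF this]
  show "linear (\<lambda>p. tensor_action act p v)" "tensor_action act (tens xs) v = foldr act xs v"
    unfolding tensor_action_def by (auto simp: L)
qed

lemma linear_tensor_action: "linear (tensor_action act p)"
proof (rule linearI)
  show "tensor_action act p (v + w) = tensor_action act p v + tensor_action act p w" for v w
    using linear_eq_on_tens[OF tensor_action(1) linear_compose_add[OF tensor_action(1) tensor_action(1)]]
    by (simp add: tensor_action(2) linear_add[OF linear_foldr] act_linear(2))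
  show "tensor_action act p (r *\<^sub>R v) = r *\<^sub>R tensor_action act p v" for r v
    using linear_eq_on_tens[OF tensor_action(1) linear_compose_scale_right[OF tensor_action(1)]]
    by (simp add: tensor_action(2) linear_scale[OF linear_foldr] act_linear(2))
qed

lemma tensor_action_mult: "tensor_action act (p * q) v = tensor_action act p (tensor_action act q v)"
proof -
  have 1: "tensor_action act (tens us * q) v = foldr act us (tensor_action act q v)" for us
  proof (rule linear_eq_on_tens[of "\<lambda>q. tensor_action act (tens us * q) v" "\<lambda>q. foldr act us (tensor_action act q v)"])
    show "linear (\<lambda>q. tensor_action act (tens us * q) v)"
      by (rule linear_compose2[OF linear_mult_left tensor_action(1)])
    show "linear (\<lambda>q. foldr act us (tensor_action act q v))"
      by (rule linear_compose2[OF tensor_action(1) linear_foldr[OF act_linear(2)]])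
  qed (simp add: tensor_action(2))
  show ?thesis
  proof (rule linear_eq_on_tens[of "\<lambda>p. tensor_action act (p * q) v" "\<lambda>p. tensor_action act p (tensor_action act q v)"])
    show "linear (\<lambda>p. tensor_action act (p * q) v)"
      by (rule linear_compose2[OF linear_mult_right tensor_action(1)])
  qed (simp_all add: 1 tensor_action)
qed

text \<open>
  An element \<open>p (x y - y x - [x, y]) q\<close> of the ideal acts as the composition of the actions of its
  three factors, and the middle one is zero in a Lie module.
\<close>
lemma tensor_action_uea_ideal:
  assumes "p \<in> uea_ideal"
  shows "tensor_action act p v = 0"
  using assms unfolding uea_ideal_def ideal_gen_def
proof (induction rule: span_induct)
  case base
  show ?case by (rule linear_subspace_kernel[OF tensor_action(1)])
next
  case (step x)
  then obtain p q a b where x: "x = p * (tens [a] * tens [b] - tens [b] * tens [a] - tens [lie_bracket a b]) * q"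
    by blast
  show ?case
    unfolding x
    by (simp only: tensor_action_mult linear_diff[OF tensor_action(1)] tensor_action(2) foldr.simps
       o_apply id_apply act_bracket)
      (simp add: linear_0[OF linear_tensor_action])
qed

lemma uea_action_to_uea: "uea_action act (to_uea p) v = tensor_action act p v"
proof -
  have "inv to_uea (to_uea p) - p \<in> uea_ideal"
    using to_uea_surj[of "to_uea p"] by (simp add: f_inv_into_f flip: to_uea_eq_iff)
  from tensor_action_uea_ideal[OF this] show ?thesis
    by (simp add: uea_action_def linear_diff[OF tensor_action(1)])
qed

lemma uea_action_incl: "uea_action act (uea_incl x) v = act x v"
  by (simp add: uea_incl_def uea_action_to_uea tensor_action(2))

lemma uea_action_mult: "uea_action act (a * b) v = uea_action act a (uea_action act b v)"
proof -
  obtain p q where "a = to_uea p" "b = to_uea q" using to_uea_surj by blast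
  then show ?thesis by (simp add: uea_action_to_uea tensor_action_mult flip: to_uea_hom(2))
qed

lemma linear_uea_action: "linear (uea_action act a)"
  using linear_tensor_action by (simp add: uea_action_def[abs_def])

lemma linear_uea_action_left: "linear (\<lambda>a. uea_action act a v)"
proof (rule linearI)
  fix a b :: "'g uea" and r
  obtain p q where "a = to_uea p" "b = to_uea q" using to_uea_surj by blast
  then show "uea_action act (a + b) v = uea_action act a v + uea_action act b v"
    "uea_action act (r *\<^sub>R a) v = r *\<^sub>R uea_action act a v"
    by (simp_all add: uea_action_to_uea linear_add[OF tensor_action(1)] linear_scale[OF tensor_action(1)]
        flip: linear_add[OF to_uea_hom(1)] linear_scale[OF to_uea_hom(1)])
qed

end

lemma uea_action_intertwine:
  assumes A: "lie_action A" and B: "lie_action B" and h: "linear h" "\<And>x v. h (A x v) = B x (h v)"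
  shows "h (uea_action A a v) = uea_action B a (h v)"
proof -
  obtain p where a: "a = to_uea p" using to_uea_surj by blast
  have "h (foldr A xs v) = foldr B xs (h v)" for xs
    by (induction xs) (simp_all add: h)
  then have "h (tensor_action A p v) = tensor_action B p (h v)"
    using linear_eq_on_tens[OF linear_compose2[OF tensor_action(1)[OF A] h(1)] tensor_action(1)[OF B]]
    by (simp add: tensor_action(2) A B)
  then show ?thesis by (simp add: a uea_action_to_uea A B)
qed

text \<open>
  A \<open>1\<close>-cocycle of the Lie algebra with values in \<open>Hom(N, M)\<close>. This condition is what makes the
  direct sum of \<open>N\<close> and \<open>M\<close> with \<open>extension_action\<close> a Lie module.
\<close>
definition lie_cocycle where
  "lie_cocycle N M \<gamma> \<longleftrightarrow> (\<forall>n. linear (\<lambda>x. \<gamma> x n)) \<and> (\<forall>x. linear (\<gamma> x)) \<and>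
    (\<forall>x y n. \<gamma> (lie_bracket x y) n = M x (\<gamma> y n) + \<gamma> x (N y n) - M y (\<gamma> x n) - \<gamma> y (N x n))"

definition extension_action where
  "extension_action N M \<gamma> x v = (N x (fst v), M x (snd v) + \<gamma> x (fst v))"

text \<open>The component \<open>N \<rightarrow> M\<close> of the action of the enveloping algebra on the extension of \<open>N\<close> by \<open>M\<close>.\<close>
definition uea_derivation where
  "uea_derivation N M \<gamma> a n = snd (uea_action (extension_action N M \<gamma>) a (n, 0))"

context
  fixes N :: "'g::real_lie_algebra \<Rightarrow> 'n::real_vector \<Rightarrow> 'n"
    and M :: "'g \<Rightarrow> 'm::real_vector \<Rightarrow> 'm" and \<gamma> :: "'g \<Rightarrow> 'n \<Rightarrow> 'm"
  assumes N: "lie_action N" and M: "lie_action M" and c: "lie_cocycle N M \<gamma>"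
begin

lemma lie_action_extension: "lie_action (extension_action N M \<gamma>)"
proof -
  note l = act_linear[OF N] act_linear[OF M]
  have g: "linear (\<lambda>x. \<gamma> x n)" "linear (\<gamma> x)"
    "\<gamma> (lie_bracket x y) n = M x (\<gamma> y n) + \<gamma> x (N y n) - M y (\<gamma> x n) - \<gamma> y (N x n)" for x y n
    using c by (simp_all add: lie_cocycle_def)
  note la = l[THEN linear_add] g(1,2)[THEN linear_add]
  note ls = l[THEN linear_scale] g(1,2)[THEN linear_scale]
  show ?thesis
    unfolding lie_action_def
  proof (intro conjI allI)
    show "linear (\<lambda>x. extension_action N M \<gamma> x v)" for v
      by (rule linearI) (simp_all add: extension_action_def la ls algebra_simps)
    show "linear (extension_action N M \<gamma> x)" for x
      by (rule linearI) (simp_all add: extension_action_def la ls algebra_simps)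
    show "extension_action N M \<gamma> (lie_bracket x y) v = extension_action N M \<gamma> x (extension_action N M \<gamma> y v)
      - extension_action N M \<gamma> y (extension_action N M \<gamma> x v)" for x y v
      by (simp add: extension_action_def act_bracket[OF N] act_bracket[OF M] g(3) la)
  qed
qed

lemma uea_derivation_incl: "uea_derivation N M \<gamma> (uea_incl x) n = \<gamma> x n"
proof -
  have "M x 0 = 0" by (rule linear_0[OF act_linear(2)[OF M]])
  then show ?thesis
    by (simp add: uea_derivation_def uea_action_incl[OF lie_action_extension] extension_action_def)
qed

lemma linear_uea_derivation: "linear (uea_derivation N M \<gamma> a)"
proof -
  have "linear (\<lambda>n :: 'n. (n, 0 :: 'm))" by (rule linearI) simp_all
  from linear_compose2[OF linear_compose2[OF this linear_uea_action[OF lie_action_extension]] linear_snd]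
  show ?thesis by (simp add: uea_derivation_def[abs_def])
qed

lemma linear_uea_derivation_left: "linear (\<lambda>a. uea_derivation N M \<gamma> a n)"
  unfolding uea_derivation_def
  by (rule linear_compose2[OF linear_uea_action_left[OF lie_action_extension] linear_snd])

text \<open>
  The enveloping algebra acts on the extension by triangular \<open>2 \<times> 2\<close> matrices with the actions on
  \<open>N\<close> and \<open>M\<close> on the diagonal; the Leibniz rule is the corner of a matrix product.
\<close>
lemma uea_derivation_mult:
  "uea_derivation N M \<gamma> (a * b) n = uea_action M a (uea_derivation N M \<gamma> b n) + uea_derivation N M \<gamma> a (uea_action N b n)"
proof -
  let ?E = "uea_action (extension_action N M \<gamma>)"
  \<comment> \<open>\<open>M\<close> is a submodule of the extension, and \<open>N\<close> is the quotient by it.\<close>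
  have 1: "fst (?E b v) = uea_action N b (fst v)" for b v
    by (rule uea_action_intertwine[OF lie_action_extension N linear_fst]) (simp add: extension_action_def)
  have "linear (\<lambda>m :: 'm. (0 :: 'n, m))" by (rule linearI) simp_all
  moreover have "N x 0 = 0" "\<gamma> x 0 = 0" for x
    using linear_0[OF act_linear(2)[OF N]] c linear_0[of "\<gamma> x"] by (simp_all add: lie_cocycle_def)
  ultimately have 2: "(0, uea_action M b m) = ?E b (0, m)" for b m
    by (intro uea_action_intertwine[OF M lie_action_extension, where h = "\<lambda>m. (0, m)"])
      (simp_all add: extension_action_def)
  have "?E b (n, 0) = (uea_action N b n, 0) + (0, uea_derivation N M \<gamma> b n)"
    by (simp add: prod_eq_iff 1 uea_derivation_def)
  then have "?E (a * b) (n, 0) = ?E a (uea_action N b n, 0) + (0, uea_action M a (uea_derivation N M \<gamma> b n))"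
    by (simp only: uea_action_mult[OF lie_action_extension] linear_add[OF linear_uea_action[OF lie_action_extension]] 2)
  then show ?thesis by (simp add: uea_derivation_def)
qed

end

section \<open>Cyclic cocycles from bar cocycles\<close>

definition trilinear :: "('a::real_vector \<Rightarrow> 'b::real_vector \<Rightarrow> 'c::real_vector \<Rightarrow> 'd::real_vector) \<Rightarrow> bool"
  where "trilinear f \<longleftrightarrow> (\<forall>b c. linear (\<lambda>a. f a b c)) \<and> (\<forall>a c. linear (\<lambda>b. f a b c)) \<and> (\<forall>a b. linear (f a b))"

lemma trilinearD:
  assumes "trilinear f"
  shows "linear (\<lambda>a. f a b c)" "linear (\<lambda>b. f a b c)" "linear (f a b)"
  using assms by (simp_all add: trilinear_def)

text \<open>
  The condition that \<open>\<phi>\<close> is a Hochschild \<open>3\<close>-cocycle with values in \<open>\<real>\<close>, on which the algebra acts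
  through \<open>\<epsilon>\<close> from both sides.
\<close>
definition bar_cocycle :: "('a::real_algebra \<Rightarrow> real) \<Rightarrow> ('a \<Rightarrow> 'a \<Rightarrow> 'a \<Rightarrow> real) \<Rightarrow> bool"
  where "bar_cocycle \<epsilon> \<phi> \<longleftrightarrow> trilinear \<phi> \<and>
    (\<forall>a b c d. \<epsilon> a * \<phi> b c d - \<phi> (a * b) c d + \<phi> a (b * c) d - \<phi> a b (c * d) + \<epsilon> d * \<phi> a b c = 0)"

definition cyclic_cocycle :: "('a::real_algebra \<Rightarrow> 'a \<Rightarrow> 'a \<Rightarrow> real) \<Rightarrow> bool"
  where "cyclic_cocycle \<psi> \<longleftrightarrow> trilinear \<psi> \<and> (\<forall>a b c. \<psi> c a b = \<psi> a b c) \<and>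
    (\<forall>a b c d. \<psi> (a * b) c d - \<psi> a (b * c) d + \<psi> a b (c * d) - \<psi> (d * a) b c = 0)"

definition cyclic_sum :: "('a \<Rightarrow> 'a \<Rightarrow> 'a \<Rightarrow> real) \<Rightarrow> 'a \<Rightarrow> 'a \<Rightarrow> 'a \<Rightarrow> real"
  where "cyclic_sum \<phi> a b c = \<phi> a b c + \<phi> b c a + \<phi> c a b"

text \<open>
  This is the dual of Connes' operator \<open>B\<close>. In the alternating sum of the bar cocycle conditions for the four
  cyclic rotations of \<open>(a, b, c, d)\<close> each term with \<open>\<epsilon>\<close> occurs twice with opposite signs.
\<close>
lemma cyclic_cocycle_cyclic_sum:
  assumes "bar_cocycle \<epsilon> \<phi>"
  shows "cyclic_cocycle (cyclic_sum \<phi>)"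
  unfolding cyclic_cocycle_def
proof (intro conjI allI)
  have tri: "trilinear \<phi>" using assms by (simp add: bar_cocycle_def)
  show "trilinear (cyclic_sum \<phi>)"
    unfolding trilinear_def cyclic_sum_def[abs_def]
    by (intro conjI allI linear_compose_add trilinearD[OF tri])
  fix a b c d
  show "cyclic_sum \<phi> c a b = cyclic_sum \<phi> a b c" by (simp add: cyclic_sum_def)
  have *: "\<phi> (a * b) c d - \<phi> a (b * c) d + \<phi> a b (c * d) = \<epsilon> a * \<phi> b c d + \<epsilon> d * \<phi> a b c" for a b c d
    using assms by (simp add: bar_cocycle_def algebra_simps)
  show "cyclic_sum \<phi> (a * b) c d - cyclic_sum \<phi> a (b * c) d + cyclic_sum \<phi> a b (c * d) - cyclic_sum \<phi> (d * a) b c = 0"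
    unfolding cyclic_sum_def using *[of a b c d] *[of b c d a] *[of c d a b] *[of d a b c] by linarith
qed

text \<open>
  Cyclic invariance lets the functional descend to cyclic chains without a sign, since the sign
  \<open>(-1)\<^sup>n\<close> of the cyclic operator is \<open>1\<close> in degree \<open>n = 2\<close>.
\<close>
lemma cyclic_cocycle_functional:
  fixes \<psi> :: "'a::real_algebra \<Rightarrow> 'a \<Rightarrow> 'a \<Rightarrow> real"
  assumes \<psi>: "cyclic_cocycle \<psi>"
  obtains \<Psi> where "linear \<Psi>" "\<And>a b c. \<Psi> (to_cyclic (tens [a, b, c])) = \<psi> a b c"
    "\<And>z. z \<in> cyclic_boundaries 2 \<Longrightarrow> \<Psi> z = 0"
proof -
  have tri: "trilinear \<psi>" and cyc: "\<psi> c a b = \<psi> a b c"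
    and coc: "\<psi> (a * b) c d - \<psi> a (b * c) d + \<psi> a b (c * d) - \<psi> (d * a) b c = 0" for a b c d
    using \<psi> unfolding cyclic_cocycle_def by blast+
  let ?f = "\<lambda>xs. if length xs = 3 then \<psi> (xs ! 0) (xs ! 1) (xs ! 2) else 0"
  have "multilinear ?f"
  proof (rule multilinearI)
    fix xs :: "'a list" and k x y r s
    assume "k < length xs"
    then have "k = 0 \<or> k = 1 \<or> k = 2" if "length xs = 3" using that by auto
    then show "?f (xs[k := r *\<^sub>R x + s *\<^sub>R y]) = r *\<^sub>R ?f (xs[k := x]) + s *\<^sub>R ?f (xs[k := y])"
      using \<open>k < length xs\<close>
      by (auto simp: nth_list_update trilinearD[OF tri, THEN linear_add] trilinearD[OF tri, THEN linear_scale])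
  qed
  then obtain L where L: "linear L" "\<And>xs. L (tens xs) = ?f xs" using tensor_universal by blast
  have "L p = L (cyclic_operator p)" for p
  proof (rule linear_eq_on_tens[of L "\<lambda>p. L (cyclic_operator p)"])
    show "linear (\<lambda>p. L (cyclic_operator p))" by (rule linear_compose2[OF cyclic_operator(1) L(1)])
    fix xs :: "'a list"
    have "L (tens (rotate_right xs)) = L (tens xs)" if "length xs = 3"
    proof -
      have "0 < length xs" "1 < length xs" "2 < length xs" using that by simp_all
      then show ?thesis using that cyc[of "xs ! 2" "xs ! 0" "xs ! 1"] by (simp add: L(2) nth_rotate_right)
    qed
    then show "L (tens xs) = L (cyclic_operator (tens xs))"
      by (cases "length xs = 3") (simp_all add: cyclic_operator(2) linear_scale[OF L(1)], simp_all add: L(2))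
  qed (rule L(1))
  then have L0: "L p = 0" if "p \<in> cyclic_relations" for p
    using that by (auto simp: cyclic_relations_def linear_diff[OF L(1)])
  define \<Psi> where "\<Psi> t = L (inv to_cyclic t)" for t
  have \<Psi>: "\<Psi> (to_cyclic p) = L p" for p
  proof -
    have "inv to_cyclic (to_cyclic p) - p \<in> cyclic_relations"
      using to_cyclic_surj[of "to_cyclic p"] by (simp add: f_inv_into_f flip: to_cyclic_eq_iff)
    from L0[OF this] show ?thesis by (simp add: \<Psi>_def linear_diff[OF L(1)])
  qed
  have lin: "linear \<Psi>"
  proof (rule linearI)
    fix a b :: "'a cyclic" and r
    obtain p q where "a = to_cyclic p" "b = to_cyclic q" using to_cyclic_surj by blast
    then show "\<Psi> (a + b) = \<Psi> a + \<Psi> b" "\<Psi> (r *\<^sub>R a) = r *\<^sub>R \<Psi> a"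
      by (simp_all add: \<Psi> linear_add[OF L(1)] linear_scale[OF L(1)]
          flip: linear_add[OF linear_to_cyclic] linear_scale[OF linear_to_cyclic])
  qed
  have b0: "L (hochschild_boundary p) = 0" if "p \<in> tensor_power 4" for p
    using that unfolding tensor_power_def
  proof (induction rule: span_induct)
    case base
    show ?case by (rule linear_subspace_kernel[OF linear_compose2[OF hochschild_boundary(1) L(1)]])
  next
    case (step p)
    then obtain a b c d where "p = tens [a, b, c, d]" by (auto simp: length_Suc_conv eval_nat_numeral)
    then show ?case
      using coc[of a b c d]
      by (simp add: hochschild_boundary(2) lessThan_Suc linear_add[OF L(1)] linear_diff[OF L(1)] linear_neg[OF L(1)] L(2))
  qed
  show thesis
  proof
    show "linear \<Psi>" by (rule lin)
    show "\<Psi> (to_cyclic (tens [a, b, c])) = \<psi> a b c" for a b c by (simp add: \<Psi> L(2))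
    show "\<Psi> z = 0" if "z \<in> cyclic_boundaries 2" for z
      using that b0 by (auto simp: cyclic_boundaries_def cyclic_chains_def cyclic_boundary(2) \<Psi>)
  qed
qed

text \<open>
  The cup product of three derivations. The derivation rules for \<open>a * b\<close>, \<open>b * c\<close> and \<open>c * d\<close> produce each
  mixed term twice with opposite signs; the terms that survive carry the action on the one-dimensional
  module \<open>K\<close> at either end, which is \<open>\<epsilon>\<close>.
\<close>
lemma bar_cocycle_uea:
  fixes N1 :: "'g::real_lie_algebra \<Rightarrow> 'n::real_vector \<Rightarrow> 'n" and N2 :: "'g \<Rightarrow> 'm::real_vector \<Rightarrow> 'm"
    and K :: "'g \<Rightarrow> real \<Rightarrow> real"
  assumes N: "lie_action N1" "lie_action N2" "lie_action K"
    and c: "lie_cocycle K N1 \<delta>" "lie_cocycle N1 N2 \<gamma>" "lie_cocycle N2 K \<alpha>"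
  shows "bar_cocycle (\<lambda>a. uea_action K a 1)
    (\<lambda>a b c. uea_derivation N2 K \<alpha> a (uea_derivation N1 N2 \<gamma> b (uea_derivation K N1 \<delta> c 1)))"
  unfolding bar_cocycle_def
proof (intro conjI allI)
  note l1 = linear_uea_derivation[OF N(3,1) c(1)] linear_uea_derivation_left[OF N(3,1) c(1)]
  note l2 = linear_uea_derivation[OF N(1,2) c(2)] linear_uea_derivation_left[OF N(1,2) c(2)]
  note l3 = linear_uea_derivation[OF N(2,3) c(3)] linear_uea_derivation_left[OF N(2,3) c(3)]
  show "trilinear (\<lambda>a b c. uea_derivation N2 K \<alpha> a (uea_derivation N1 N2 \<gamma> b (uea_derivation K N1 \<delta> c 1)))"
    unfolding trilinear_def
    by (intro conjI allI l3(2) linear_compose2[OF l2(2) l3(1)]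
        linear_compose2[OF l1(2) linear_compose2[OF l2(1) l3(1)]])
  fix a b c d :: "'g uea"
  have K: "uea_action K a r = uea_action K a 1 * r" for a r
    using linear_scale[OF linear_uea_action[OF N(3)], of a r 1] by (simp add: mult.commute)
  have K': "uea_derivation K N1 \<delta> c (uea_action K d 1) = uea_action K d 1 *\<^sub>R uea_derivation K N1 \<delta> c 1" for c d
    using linear_scale[OF l1(1), of c "uea_action K d 1" 1] by simp
  let ?\<phi> = "\<lambda>a b c. uea_derivation N2 K \<alpha> a (uea_derivation N1 N2 \<gamma> b (uea_derivation K N1 \<delta> c 1))"
  show "uea_action K a 1 * ?\<phi> b c d - ?\<phi> (a * b) c d + ?\<phi> a (b * c) d - ?\<phi> a b (c * d) + uea_action K d 1 * ?\<phi> a b c = 0"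
    unfolding uea_derivation_mult[OF N(3,1) c(1)] uea_derivation_mult[OF N(1,2) c(2)] uea_derivation_mult[OF N(2,3) c(3)]
      K' linear_add[OF l2(1)] linear_add[OF l3(1)] linear_scale[OF l2(1)] linear_scale[OF l3(1)]
      K[of a "uea_derivation N2 K \<alpha> b _"]
    by simp
qed

lemma theta_wedge_3: "theta (wedge [a, b, c]) = to_cyclic (tens [a, b, c]) - to_cyclic (tens [a, c, b])"
proof -
  let ?t = "Transposition.transpose 1 2 :: nat \<Rightarrow> nat"
  have "{1..<length [a, b, c]} = {1, 2 :: nat}" by auto
  then have P: "{\<sigma>. \<sigma> permutes {1..<length [a, b, c]}} = {id, ?t}"
    by (auto simp: permutes_doubleton_iff)
  have "?t 1 \<noteq> id 1" by simp
  then have "id \<noteq> ?t" by metis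
  then show ?thesis
    unfolding theta(2) P
    by (simp add: sign_id sign_swap_id permute_list_def Transposition.transpose_def inv_id)
qed

lemma lie_boundary_wedge_4:
  "lie_boundary (wedge [x, y, z, w])
    = wedge [lie_bracket x y, z, w] - wedge [lie_bracket x z, y, w] - wedge [x, lie_bracket y z, w]
      + wedge [lie_bracket x w, y, z] + wedge [x, lie_bracket y w, z] + wedge [x, y, lie_bracket z w]"
  by (simp add: lie_boundary(2) lessThan_Suc omit_def)

text \<open>
  On \<open>\<theta>(a \<and> b \<and> c)\<close> a cyclic cocycle takes the value \<open>\<psi>(a, b, c) - \<psi>(a, c, b)\<close>. Evaluated on the boundary of a
  \<open>4\<close>-fold wedge, with brackets expanded to commutators, this is the alternating sum of the
  Hochschild cocycle conditions over the six cyclic orderings of the four entries.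
\<close>
lemma theta_lie_boundary_cyclic_cocycle:
  fixes \<Psi> :: "'g::real_lie_algebra uea cyclic \<Rightarrow> real"
  assumes \<psi>: "cyclic_cocycle \<psi>" and \<Psi>: "linear \<Psi>" "\<And>a b c. \<Psi> (to_cyclic (tens [a, b, c])) = \<psi> a b c"
    and "w \<in> lie_boundaries 3"
  shows "\<Psi> (theta w) = 0"
proof -
  have tri: "trilinear \<psi>" and cyc: "\<psi> c a b = \<psi> a b c"
    and coc: "\<psi> (a * b) c d - \<psi> a (b * c) d + \<psi> a b (c * d) - \<psi> (d * a) b c = 0" for a b c d
    using \<psi> unfolding cyclic_cocycle_def by blast+
  let ?F = "\<lambda>w. \<Psi> (theta (lie_boundary w))"
  have lT: "linear (\<lambda>w. \<Psi> (theta w))" by (rule linear_compose2[OF theta(1) \<Psi>(1)])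
  have T: "\<Psi> (theta (wedge [a, b, c])) = \<psi> a b c - \<psi> a c b" for a b c
    by (simp add: theta_wedge_3 linear_diff[OF \<Psi>(1)] \<Psi>(2))
  have *: "?F (wedge [a, b, c, d]) = 0" for a b c d
  proof -
    \<comment> \<open>Rotating products to the front makes equal terms literally equal.\<close>
    have c: "\<psi> a (b * c) d = \<psi> (b * c) d a" "\<psi> a b (c * d) = \<psi> (c * d) a b" for a b c d
      using cyc by metis+
    have coc': "\<psi> (a * b) c d - \<psi> (b * c) d a + \<psi> (c * d) a b - \<psi> (d * a) b c = 0" for a b c d
      using coc[of a b c d] by (simp only: c)
    show ?thesis
      unfolding lie_boundary_wedge_4
      using coc'[of a b c d] coc'[of a b d c] coc'[of a c b d] coc'[of a c d b] coc'[of a d b c] coc'[of a d c b]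
      by (simp add: linear_add[OF lT] linear_diff[OF lT] T lie_bracket_uea_def c
          trilinearD[OF tri, THEN linear_diff])
  qed
  have "?F (to_exterior p) = 0" if "p \<in> tensor_power 4" for p
    using that unfolding tensor_power_def
  proof (induction rule: span_induct)
    case base
    show ?case
      by (rule linear_subspace_kernel[OF linear_compose2[OF linear_to_exterior linear_compose2[OF lie_boundary(1) lT]]])
  next
    case (step p)
    then obtain a b c d where "p = tens [a, b, c, d]" by (auto simp: length_Suc_conv eval_nat_numeral)
    then show ?case using *[of a b c d] by (simp add: wedge_def)
  qed
  then show ?thesis using assms(4) by (auto simp: lie_boundaries_def exterior_power_def)
qed

section \<open>A bar cocycle extending the Godbillon-Vey cocycle\<close>

instantiation poly :: ("{real_algebra_1, comm_ring_1}") real_vector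
begin
definition scaleR_poly :: "real \<Rightarrow> 'a poly \<Rightarrow> 'a poly"
  where "scaleR_poly r p = smult (of_real r) p"
instance
  by standard (simp_all add: scaleR_poly_def smult_add_left smult_add_right)
end

lemma scaleR_poly_real [simp]: "r *\<^sub>R p = smult r (p :: real poly)"
  by (simp add: scaleR_poly_def)

text \<open>The Lie derivatives on the module \<open>F\<^sub>0\<close> of functions \<open>u\<close> and on the module \<open>F\<^sub>1\<close> of \<open>1\<close>-forms \<open>v dx\<close>.\<close>
definition vf_on_functions :: "poly_vf \<Rightarrow> real poly \<Rightarrow> real poly"
  where "vf_on_functions x u = vf_coeff x * pderiv u"

definition vf_on_forms :: "poly_vf \<Rightarrow> real poly \<Rightarrow> real poly"
  where "vf_on_forms x v = pderiv (vf_coeff x * v)"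

definition vf_on_reals :: "poly_vf \<Rightarrow> real \<Rightarrow> real"
  where "vf_on_reals x t = 0"

text \<open>
  The three \<open>1\<close>-cocycles. The first two are the classical ones \<open>f \<mapsto> f'\<close> and \<open>f \<mapsto> f'' dx\<close>, the second
  acting on functions by multiplication. The third is the class of the extension
  \<open>0 \<rightarrow> \<real> \<rightarrow> F\<^sub>0 \<rightarrow> F\<^sub>1 \<rightarrow> 0\<close> given by the de Rham differential, split by the primitive that vanishes at \<open>0\<close>.
\<close>
definition divergence_cocycle :: "poly_vf \<Rightarrow> real \<Rightarrow> real poly"
  where "divergence_cocycle x t = smult t (pderiv (vf_coeff x))"

definition second_derivative_cocycle :: "poly_vf \<Rightarrow> real poly \<Rightarrow> real poly"
  where "second_derivative_cocycle x u = pderiv (pderiv (vf_coeff x)) * u"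

definition evaluation_cocycle :: "poly_vf \<Rightarrow> real poly \<Rightarrow> real"
  where "evaluation_cocycle x v = poly (vf_coeff x * v) 0"

lemma vf_coeff_simps:
  "vf_coeff (x + y) = vf_coeff x + vf_coeff y" "vf_coeff (r *\<^sub>R x) = smult r (vf_coeff x)"
  "vf_coeff (lie_bracket x y) = vf_coeff x * pderiv (vf_coeff y) - vf_coeff y * pderiv (vf_coeff x)"
  by (simp_all add: plus_poly_vf.rep_eq scaleR_poly_vf.rep_eq lie_bracket_poly_vf.rep_eq)

lemmas pderiv_simps = pderiv_add pderiv_diff pderiv_mult pderiv_smult smult_add_right smult_add_left smult_diff_right

lemma lie_action_vf:
  "lie_action vf_on_functions" "lie_action vf_on_forms" "lie_action vf_on_reals"
  unfolding lie_action_def vf_on_functions_def vf_on_forms_def vf_on_reals_def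
  by (intro conjI allI linearI; simp add: vf_coeff_simps pderiv_simps algebra_simps)+

lemma lie_cocycle_divergence: "lie_cocycle vf_on_reals vf_on_functions divergence_cocycle"
  unfolding lie_cocycle_def vf_on_functions_def vf_on_reals_def divergence_cocycle_def
  by (intro conjI allI linearI) (simp_all add: vf_coeff_simps pderiv_simps algebra_simps)

lemma lie_cocycle_second_derivative: "lie_cocycle vf_on_functions vf_on_forms second_derivative_cocycle"
  unfolding lie_cocycle_def vf_on_functions_def vf_on_forms_def second_derivative_cocycle_def
  by (intro conjI allI linearI) (simp_all add: vf_coeff_simps pderiv_simps algebra_simps)

lemma lie_cocycle_evaluation: "lie_cocycle vf_on_forms vf_on_reals evaluation_cocycle"
  unfolding lie_cocycle_def vf_on_forms_def vf_on_reals_def evaluation_cocycle_def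
  by (intro conjI allI linearI) (simp_all add: vf_coeff_simps pderiv_simps algebra_simps)

definition godbillon_vey_cochain :: "poly_vf uea \<Rightarrow> poly_vf uea \<Rightarrow> poly_vf uea \<Rightarrow> real"
  where "godbillon_vey_cochain a b c = uea_derivation vf_on_forms vf_on_reals evaluation_cocycle a
    (uea_derivation vf_on_functions vf_on_forms second_derivative_cocycle b
      (uea_derivation vf_on_reals vf_on_functions divergence_cocycle c 1))"

lemma bar_cocycle_godbillon_vey: "bar_cocycle (\<lambda>a. uea_action vf_on_reals a 1) godbillon_vey_cochain"
  unfolding godbillon_vey_cochain_def[abs_def]
  by (rule bar_cocycle_uea[OF lie_action_vf lie_cocycle_divergence lie_cocycle_second_derivative lie_cocycle_evaluation])

lemma godbillon_vey_cochain_incl: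
  "godbillon_vey_cochain (uea_incl x) (uea_incl y) (uea_incl z)
    = poly (vf_coeff x * (pderiv (pderiv (vf_coeff y)) * pderiv (vf_coeff z))) 0"
  unfolding godbillon_vey_cochain_def
    uea_derivation_incl[OF lie_action_vf(3,1) lie_cocycle_divergence]
    uea_derivation_incl[OF lie_action_vf(1,2) lie_cocycle_second_derivative]
    uea_derivation_incl[OF lie_action_vf(2,3) lie_cocycle_evaluation]
  by (simp add: evaluation_cocycle_def second_derivative_cocycle_def divergence_cocycle_def)

section \<open>Induced maps on homology\<close>

lemma subspace_lie_boundaries: "subspace (lie_boundaries n)"
  unfolding lie_boundaries_def exterior_power_def
  by (intro linear_subspace_image lie_boundary(1) linear_to_exterior subspace_tensor_power)

lemma to_exterior_leibniz_boundaries: "to_exterior ` leibniz_boundaries n \<subseteq> lie_boundaries n"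
  by (auto simp: leibniz_boundaries_def lie_boundaries_def exterior_power_def simp flip: lie_boundary(3))

lemma exterior_map_power:
  assumes "linear f" "w \<in> exterior_power n"
  shows "exterior_map f w \<in> exterior_power n"
proof -
  have "exterior_map f (to_exterior p) \<in> exterior_power n" if "p \<in> tensor_power n" for p
    using that unfolding tensor_power_def[of n]
  proof (induction rule: span_induct)
    case base
    have "subspace (exterior_power n :: 'b exterior set)"
      unfolding exterior_power_def by (intro linear_subspace_image linear_to_exterior subspace_tensor_power)
    from linear_subspace_vimage[OF linear_compose2[OF linear_to_exterior exterior_map(1)[OF assms(1)]] this]
    show ?case by (simp only: vimage_def)
  next
    case (step p)
    then obtain xs where "p = tens xs" "length xs = n" by blast
    then show ?case
      using exterior_map(2)[OF assms(1), of xs]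
      by (auto simp: wedge_def exterior_power_def intro!: imageI tens_in_power)
  qed
  then show ?thesis using assms(2) by (auto simp: exterior_power_def)
qed

lemma exterior_map_lie_boundaries:
  assumes "linear f" "\<And>x y. f (lie_bracket x y) = lie_bracket (f x) (f y)"
  shows "exterior_map f ` lie_boundaries n \<subseteq> lie_boundaries n"
  using exterior_map_power[OF assms(1)]
  by (auto simp: lie_boundaries_def exterior_map_lie_boundary[OF assms])

lemma pi1_star_class: "pi1_star n (homology_class (leibniz_boundaries n) z) = homology_class (lie_boundaries n) (to_exterior z)"
  unfolding pi1_star_def
  by (rule induced_map_class[OF linear_to_exterior subspace_leibniz_boundaries subspace_lie_boundaries
      to_exterior_leibniz_boundaries])

lemma mu2_class: "mu2 n (homology_class (lie_boundaries n) w) = homology_class (lie_boundaries n) (exterior_map uea_incl w)"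
  unfolding mu2_def
  by (rule induced_map_class[OF exterior_map(1)[OF linear_uea_incl] subspace_lie_boundaries subspace_lie_boundaries
      exterior_map_lie_boundaries[OF linear_uea_incl uea_incl_bracket]])

lemma homology_class_eqI:
  assumes "subspace B" "z - z' \<in> B"
  shows "homology_class B z = homology_class B z'"
proof -
  have "homology_class B z \<subseteq> homology_class B z'" if "z - z' \<in> B" for z z'
  proof
    fix x assume "x \<in> homology_class B z"
    then obtain b where "x = z + b" "b \<in> B" by (auto simp: homology_class_def)
    then have "x = z' + ((z - z') + b)" "(z - z') + b \<in> B"
      using subspace_add[OF assms(1) that] by auto
    then show "x \<in> homology_class B z'" unfolding homology_class_def by blast
  qed
  then show ?thesis using assms(2) subspace_neg[OF assms] by (metis minus_diff_eq subset_antisym)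
qed

theorem corollary3p5:
  shows "inj_on (theta_star 2 \<circ> mu2 3 \<circ> pi1_star 3)
           (leibniz_homology 3 :: poly_vf tensor set set) \<and>
         (\<exists>c \<in> leibniz_homology 3. pi1_star 3 c = godbillon_vey)"
proof
  have \<psi>: "cyclic_cocycle (cyclic_sum godbillon_vey_cochain)"
    by (rule cyclic_cocycle_cyclic_sum[OF bar_cocycle_godbillon_vey])
  obtain \<Psi> where \<Psi>: "linear \<Psi>" "\<And>a b c. \<Psi> (to_cyclic (tens [a, b, c])) = cyclic_sum godbillon_vey_cochain a b c"
    "\<And>z. z \<in> cyclic_boundaries 2 \<Longrightarrow> \<Psi> z = 0"
    using cyclic_cocycle_functional[OF \<psi>] by blast
  note \<Psi>0 = theta_lie_boundary_cyclic_cocycle[OF \<psi> \<Psi>(1,2)]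
  define \<Phi> where "\<Phi> w = \<Psi> (theta (exterior_map uea_incl w))" for w
  have lin: "linear \<Phi>"
    unfolding \<Phi>_def by (intro linear_compose2[OF exterior_map(1)[OF linear_uea_incl] linear_compose2[OF theta(1) \<Psi>(1)]])
  let ?B = "leibniz_boundaries 3 :: poly_vf tensor set"
  let ?F = "theta_star 2 \<circ> mu2 3 \<circ> pi1_star 3"
  have F: "?F (homology_class ?B z) = {theta w + b' | w b'.
      w \<in> homology_class (lie_boundaries 3) (exterior_map uea_incl (to_exterior z)) \<and> b' \<in> cyclic_boundaries 2}" for z
    by (simp add: pi1_star_class mu2_class theta_star_def induced_map_def)
  \<comment> \<open>The cocycle is constant on the image of a class, since it kills the boundaries that enter
      at each of the three stages.\<close>
  have const: "\<Psi> x = \<Phi> (to_exterior z)" if x: "x \<in> ?F (homology_class ?B z)" for x z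
  proof -
    obtain b b' where "x = theta (exterior_map uea_incl (to_exterior z) + b) + b'"
      "b \<in> lie_boundaries 3" "b' \<in> cyclic_boundaries 2"
      using x[unfolded F] unfolding homology_class_def by blast
    then show ?thesis
      by (simp add: \<Phi>_def linear_add[OF \<Psi>(1)] linear_add[OF theta(1)] \<Psi>(3) \<Psi>0)
  qed
  have ne: "\<exists>x. x \<in> ?F (homology_class ?B z)" for z
  proof -
    have "0 \<in> lie_boundaries 3" by (rule subspace_0[OF subspace_lie_boundaries])
    moreover have "0 \<in> cyclic_boundaries 2"
      unfolding cyclic_boundaries_def cyclic_chains_def
      by (intro subspace_0 linear_subspace_image cyclic_boundary(1) linear_to_cyclic subspace_tensor_power)
    ultimately show ?thesis
      unfolding F unfolding homology_class_def by blast
  qed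
  have bd: "\<Phi> (to_exterior b) = 0" if "b \<in> ?B" for b
  proof -
    have "to_exterior b \<in> lie_boundaries 3" using that to_exterior_leibniz_boundaries by blast
    then have "exterior_map uea_incl (to_exterior b) \<in> lie_boundaries 3"
      using exterior_map_lie_boundaries[OF linear_uea_incl uea_incl_bracket] by blast
    then show ?thesis by (simp add: \<Phi>_def \<Psi>0)
  qed
  \<comment> \<open>With \<open>(f, g, h) = (1, x\<^sup>2, x)\<close> as its only nonzero term, the antisymmetrisation is
      \<open>- f g'' h' = - 2\<close>.\<close>
  have gv: "\<Phi> (to_exterior godbillon_vey_lift) = - 2"
    by (simp add: \<Phi>_def to_exterior_godbillon_vey_lift exterior_map(2)[OF linear_uea_incl] theta_wedge_3
        linear_diff[OF \<Psi>(1)] \<Psi>(2) cyclic_sum_def godbillon_vey_cochain_incl vf_e_def VF_inverse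
        pderiv_monom poly_monom)
  show "inj_on ?F (leibniz_homology 3 :: poly_vf tensor set set)"
  proof (rule inj_onI)
    fix c c' :: "poly_vf tensor set"
    assume "c \<in> leibniz_homology 3" "c' \<in> leibniz_homology 3" and eq: "?F c = ?F c'"
    then obtain z z' where z: "z \<in> leibniz_cycles 3" "z' \<in> leibniz_cycles 3"
      and c: "c = homology_class ?B z" "c' = homology_class ?B z'"
      by (auto simp: leibniz_homology_def homology_def)
    obtain x where "x \<in> ?F c" using ne c(1) by blast
    then have "\<Phi> (to_exterior z) = \<Phi> (to_exterior z')"
      using const[of x z] const[of x z'] eq c by simp
    then have 0: "\<Phi> (to_exterior (z - z')) = 0"
      by (simp add: linear_diff[OF linear_to_exterior] linear_diff[OF lin])
    obtain r where r: "z - z' - r *\<^sub>R godbillon_vey_lift \<in> ?B"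
      using leibniz_3_cycles_mod_boundaries[OF subspace_diff[OF subspace_leibniz_cycles z]] .
    have r0: "r = 0"
      using bd[OF r] 0
      by (simp add: linear_diff[OF linear_to_exterior] linear_scale[OF linear_to_exterior]
          linear_diff[OF lin] linear_scale[OF lin] gv)
    have "homology_class ?B z = homology_class ?B z'"
      using r r0 by (intro homology_class_eqI subspace_leibniz_boundaries) simp
    then show "c = c'" by (simp only: c)
  qed
  have "homology_class ?B godbillon_vey_lift \<in> leibniz_homology 3"
    using godbillon_vey_lift_cycle by (simp add: leibniz_homology_def homology_def)
  moreover have "pi1_star 3 (homology_class ?B godbillon_vey_lift) = godbillon_vey"
    by (simp add: pi1_star_class godbillon_vey_def to_exterior_godbillon_vey_lift)
  ultimately show "\<exists>c \<in> leibniz_homology 3. pi1_star 3 c = godbillon_vey" by blast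
qed

end
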